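(* Let $b>0$ and let $\Gamma_b:=\{(x_1,x_2,x_3)\in\mathbb{R}^3: x_3=0,\ 2bx_1=x_2^2\}$. There exists a global nondegenerate $\mathbb{Z}_2$ harmonic function $f_b$ on $\mathbb{R}^3$ whose branching set is $\Gamma_b$.
   Context: $\mathbb{Z}_2$ harmonic functions. Let $(M,g)$ be a Riemannian $n$-manifold (here $\mathbb{R}^3$ with the Euclidean metric) and $\Sigma\subset M$ a closed oriented (and co-oriented) codimension-two submanifold. Let $\mathcal I$ be a flat real line bundle over $M\setminus\Sigma$ with structure group $\{\pm1\}$ whose monodromy around every sufficiently small loop linking $\Sigma$ is $-1$. A $\mathbb{Z}_2$ harmonic function with branching set $\Sigma$ is a smooth section $f$ of $\mathcal I$ over $M\setminus\Sigma$ with $|f|,|\nabla f|\in L^2_{\mathrm{loc}}(M)$ and $\Delta_g f=0$ on $M\setminus\Sigma$; "global" means defined over all of $\mathbb{R}^3\setminus\Sigma$. The normal bundle $N_\Sigma$ is made into a complex line bundle by the co-orientation and the metric, and $\zeta$ denotes the inverse of the normal exponential map on a tubular neighbourhood of $\Sigma$. Near $\Sigma$ such an $f$ has an expansion $$f=\operatorname{Re}(A\zeta^{1/2}+B\zeta^{3/2})-\tfrac12\operatorname{Re}(\overline{\mu}\zeta)\operatorname{Re}(A\zeta^{1/2})+O(|\zeta|^{5/2}),$$ with $A\in\Gamma(\Sigma,N_\Sigma^{-1/2})$, $B\in\Gamma(\Sigma,N_\Sigma^{-3/2})$ and $\mu\in\Gamma(\Sigma,N_\Sigma)$ the mean curvature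 vector of $\Sigma$. $f$ is critical if $A\equiv0$, and nondegenerate if it is critical and $B$ is nowhere vanishing on $\Sigma$. *)

theory Defs
  imports "HOL-Analysis.Analysis" "HOL-Library.Landau_Symbols"
begin

section \<open>Smooth maps\<close>

primrec Ck_on :: "nat \<Rightarrow> 'a set \<Rightarrow> ('a::real_normed_vector \<Rightarrow> 'b::real_normed_vector) \<Rightarrow> bool" where
  "Ck_on 0 S f \<longleftrightarrow> continuous_on S f"
| "Ck_on (Suc k) S f \<longleftrightarrow>
     (\<forall>x\<in>S. f differentiable (at x)) \<and> (\<forall>v. Ck_on k S (\<lambda>x. frechet_derivative f (at x) v))"

text \<open>Intended for open \<open>S\<close>.\<close>
definition smooth_on :: "'a set \<Rightarrow> ('a::real_normed_vector \<Rightarrow> 'b::real_normed_vector) \<Rightarrow> bool" where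
  "smooth_on S f \<longleftrightarrow> (\<forall>k. Ck_on k S f)"

text \<open>Smoothness on an arbitrary subset, such as a submanifold: local smooth extendability.\<close>
definition smooth_along :: "'a set \<Rightarrow> ('a::real_normed_vector \<Rightarrow> 'b::real_normed_vector) \<Rightarrow> bool" where
  "smooth_along S f \<longleftrightarrow>
     (\<forall>p\<in>S. \<exists>V F. open V \<and> p \<in> V \<and> smooth_on V F \<and> (\<forall>x\<in>S \<inter> V. F x = f x))"

definition gradient :: "(real^3 \<Rightarrow> real) \<Rightarrow> real^3 \<Rightarrow> real^3" where
  "gradient f x = (\<Sum>b\<in>Basis. frechet_derivative f (at x) b *\<^sub>R b)"

definition laplacian :: "(real^3 \<Rightarrow> real) \<Rightarrow> real^3 \<Rightarrow> real" where
  "laplacian f x =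
     (\<Sum>b\<in>Basis. frechet_derivative (\<lambda>y. frechet_derivative f (at y) b) (at x) b)"


section \<open>Closed oriented codimension-two submanifolds of Euclidean 3-space\<close>

definition codim2_submanifold :: "(real^3) set \<Rightarrow> bool" where
  "codim2_submanifold \<Sigma> \<longleftrightarrow>
     (\<forall>p\<in>\<Sigma>. \<exists>V (h :: real^3 \<Rightarrow> real^2). open V \<and> p \<in> V \<and> smooth_on V h \<and>
        (\<forall>x\<in>V. surj (frechet_derivative h (at x))) \<and> \<Sigma> \<inter> V = {x \<in> V. h x = 0})"

definition tangent_space :: "(real^3) set \<Rightarrow> real^3 \<Rightarrow> (real^3) set" where
  "tangent_space \<Sigma> p =
     {w. \<exists>c \<delta>. 0 < \<delta> \<and> smooth_on {-\<delta><..<\<delta>} c \<and> c ` {-\<delta><..<\<delta>} \<subseteq> \<Sigma> \<and> c 0 = p \<and>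
         (c has_vector_derivative w) (at 0)}"

text \<open>An orientation is a smooth unit tangent field \<open>\<tau>\<close>. \<open>closed\<close> means closed as a subset:
  \<open>\<Sigma>\<close> may be noncompact.\<close>
definition closed_oriented_submanifold :: "(real^3) set \<Rightarrow> (real^3 \<Rightarrow> real^3) \<Rightarrow> bool" where
  "closed_oriented_submanifold \<Sigma> \<tau> \<longleftrightarrow>
     closed \<Sigma> \<and> codim2_submanifold \<Sigma> \<and> smooth_along \<Sigma> \<tau> \<and>
     (\<forall>p\<in>\<Sigma>. norm (\<tau> p) = 1 \<and> \<tau> p \<in> tangent_space \<Sigma> p)"

text \<open>The fibre of the normal bundle at \<open>p\<close> is \<open>{v. v \<bullet> \<tau> p = 0}\<close>; the co-orientation and the metric
  make it a complex line in which multiplication by \<open>\<i>\<close> is \<open>v \<mapsto> \<tau> p \<times> v\<close>.\<close>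
definition normal_bundle :: "(real^3) set \<Rightarrow> (real^3 \<Rightarrow> real^3) \<Rightarrow> ((real^3) \<times> (real^3)) set" where
  "normal_bundle \<Sigma> \<tau> = {(p, v). p \<in> \<Sigma> \<and> v \<bullet> \<tau> p = 0}"

text \<open>\<open>\<zeta>\<close> inverts the normal exponential map, which in Euclidean space is \<open>(p, v) \<mapsto> p + v\<close>,
  from a disc bundle of variable radius onto \<open>W\<close>. Thus \<open>fst (\<zeta> x)\<close> is the foot point of \<open>x\<close> and
  \<open>snd (\<zeta> x)\<close> its normal displacement.\<close>
definition tubular_neighbourhood ::
    "(real^3) set \<Rightarrow> (real^3 \<Rightarrow> real^3) \<Rightarrow> (real^3) set \<Rightarrow> (real^3 \<Rightarrow> (real^3) \<times> (real^3)) \<Rightarrow> bool" where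
  "tubular_neighbourhood \<Sigma> \<tau> W \<zeta> \<longleftrightarrow>
     (\<exists>\<epsilon> :: real^3 \<Rightarrow> real. continuous_on \<Sigma> \<epsilon> \<and> (\<forall>p\<in>\<Sigma>. 0 < \<epsilon> p) \<and> open W \<and>
        homeomorphism {(p, v) \<in> normal_bundle \<Sigma> \<tau>. norm v < \<epsilon> p} W (\<lambda>(p, v). p + v) \<zeta> \<and>
        smooth_on W \<zeta>)"

text \<open>The sign is that of the gradient of length. It is the one for which the expansion of
  \<open>\<int>\<^sub>2\<close> harmonic functions below holds with the coefficient \<open>-1/2\<close>; that is, \<open>\<mu>\<close> is minus
  the curvature vector of the curve. The derivative within \<open>\<Sigma>\<close> is determined only on
  tangent vectors, which is where it is evaluated.\<close>
definition mean_curvature :: "(real^3) set \<Rightarrow> (real^3 \<Rightarrow> real^3) \<Rightarrow> real^3 \<Rightarrow> real^3" where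
  "mean_curvature \<Sigma> \<tau> p = - frechet_derivative \<tau> (at p within \<Sigma>) (\<tau> p)"


section \<open>Flat real line bundles with structure group \<open>{1, -1}\<close>\<close>

text \<open>A bundle over \<open>X\<close> is given by trivialising open sets \<open>U i\<close> and locally constant
  transition functions \<open>g i j\<close>: \<open>\<plusminus>1\<close>-valued and continuous.\<close>
definition flat_line_bundle ::
    "'a::topological_space set \<Rightarrow> ('i \<Rightarrow> 'a set) \<Rightarrow> ('i \<Rightarrow> 'i \<Rightarrow> 'a \<Rightarrow> real) \<Rightarrow> bool" where
  "flat_line_bundle X U g \<longleftrightarrow>
     (\<forall>i. open (U i)) \<and> (\<Union>i. U i) = X \<and>
     (\<forall>i j. continuous_on (U i \<inter> U j) (g i j) \<and> g i j ` (U i \<inter> U j) \<subseteq> {1, -1}) \<and>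
     (\<forall>i j k. \<forall>x\<in>U i \<inter> U j \<inter> U k. g i j x * g j k x = g i k x)"

text \<open>Sections over \<open>W\<close> of the bundle tensored with a vector space \<open>'b\<close>; \<open>s i\<close> represents the
  section on \<open>U i\<close>.\<close>
definition bundle_section ::
    "('i \<Rightarrow> 'a set) \<Rightarrow> ('i \<Rightarrow> 'i \<Rightarrow> 'a \<Rightarrow> real) \<Rightarrow> 'a set \<Rightarrow> ('i \<Rightarrow> 'a \<Rightarrow> 'b::real_vector) \<Rightarrow> bool" where
  "bundle_section U g W s \<longleftrightarrow> (\<forall>i j. \<forall>x\<in>U i \<inter> U j \<inter> W. s i x = g i j x *\<^sub>R s j x)"

text \<open>The pointwise norm, independent of the chosen trivialisation around \<open>x\<close>
  (lemma \<open>section_norm_eq\<close>).\<close>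
definition section_norm ::
    "('i \<Rightarrow> 'a set) \<Rightarrow> ('i \<Rightarrow> 'a \<Rightarrow> 'b::real_normed_vector) \<Rightarrow> 'a \<Rightarrow> real" where
  "section_norm U s x = norm (s (SOME i. x \<in> U i) x)"

lemma section_norm_eq:
  assumes "flat_line_bundle X U g" "bundle_section U g W s" "x \<in> U i" "x \<in> W"
  shows "section_norm U s x = norm (s i x)"
proof -
  define j where "j = (SOME i. x \<in> U i)"
  have j: "x \<in> U j" unfolding j_def using assms(3) by (rule someI)
  have "s j x = g j i x *\<^sub>R s i x"
    using assms j unfolding bundle_section_def by blast
  moreover have "g j i ` (U j \<inter> U i) \<subseteq> {1, -1}"
    using assms(1) unfolding flat_line_bundle_def by blast
  hence "g j i x \<in> {1, -1}" using assms(3) j by blast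
  ultimately show ?thesis unfolding section_norm_def j_def[symmetric] by auto
qed

text \<open>Parallel transport around the loop \<open>\<gamma>\<close> is multiplication by \<open>m\<close>: \<open>s\<close> is a parallel
  unit section along \<open>\<gamma>\<close>, i.e. continuous and \<open>\<plusminus>1\<close>-valued in every trivialisation.\<close>
definition monodromy ::
    "('i \<Rightarrow> 'a set) \<Rightarrow> ('i \<Rightarrow> 'i \<Rightarrow> 'a \<Rightarrow> real) \<Rightarrow> (real \<Rightarrow> 'a) \<Rightarrow> real \<Rightarrow> bool" where
  "monodromy U g \<gamma> m \<longleftrightarrow>
     (\<exists>s :: 'i \<Rightarrow> real \<Rightarrow> real.
        (\<forall>i. continuous_on {t\<in>{0..1}. \<gamma> t \<in> U i} (s i) \<and> s i ` {t\<in>{0..1}. \<gamma> t \<in> U i} \<subseteq> {1, -1}) \<and>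
        (\<forall>i j. \<forall>t\<in>{0..1}. \<gamma> t \<in> U i \<inter> U j \<longrightarrow> s i t = g i j (\<gamma> t) * s j t) \<and>
        (\<forall>i. \<gamma> 0 \<in> U i \<longrightarrow> s i 1 = m * s i 0))"

definition meridian :: "(real^3 \<Rightarrow> real^3) \<Rightarrow> real^3 \<Rightarrow> real^3 \<Rightarrow> real \<Rightarrow> real \<Rightarrow> real^3" where
  "meridian \<tau> p e r t =
     p + r *\<^sub>R (cos (2 * pi * t) *\<^sub>R e + sin (2 * pi * t) *\<^sub>R (cross3 (\<tau> p) e))"

text \<open>Loops in a ball around \<open>p\<close> that link \<open>\<Sigma>\<close> once, in either direction.\<close>
definition linking_loop ::
    "(real^3) set \<Rightarrow> (real^3 \<Rightarrow> real^3) \<Rightarrow> real^3 \<Rightarrow> real \<Rightarrow> (real \<Rightarrow> real^3) \<Rightarrow> bool" where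
  "linking_loop \<Sigma> \<tau> p \<delta> \<gamma> \<longleftrightarrow>
     (\<exists>e r. norm e = 1 \<and> e \<bullet> \<tau> p = 0 \<and> 0 < r \<and> r < \<delta> \<and>
        (homotopic_loops (ball p \<delta> - \<Sigma>) (meridian \<tau> p e r) \<gamma> \<or>
         homotopic_loops (ball p \<delta> - \<Sigma>) (reversepath (meridian \<tau> p e r)) \<gamma>))"

definition branched_line_bundle ::
    "(real^3) set \<Rightarrow> (real^3 \<Rightarrow> real^3) \<Rightarrow> ('i \<Rightarrow> (real^3) set) \<Rightarrow> ('i \<Rightarrow> 'i \<Rightarrow> real^3 \<Rightarrow> real) \<Rightarrow> bool" where
  "branched_line_bundle \<Sigma> \<tau> U g \<longleftrightarrow>
     flat_line_bundle (- \<Sigma>) U g \<and>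
     (\<forall>p\<in>\<Sigma>. \<exists>\<delta>>0. \<forall>\<gamma>. linking_loop \<Sigma> \<tau> p \<delta> \<gamma> \<longrightarrow> monodromy U g \<gamma> (-1))"


section \<open>\<open>\<int>\<^sub>2\<close> harmonic functions\<close>

text \<open>Membership of \<open>|s|\<close> in \<open>L\<^sup>2\<^sub>l\<^sub>o\<^sub>c\<close> of the whole space, for a section \<open>s\<close> over the complement of
  the null set \<open>\<Sigma>\<close>.\<close>
definition locally_L2 ::
    "(real^3) set \<Rightarrow> ('i \<Rightarrow> (real^3) set) \<Rightarrow> ('i \<Rightarrow> real^3 \<Rightarrow> 'b::real_normed_vector) \<Rightarrow> bool" where
  "locally_L2 \<Sigma> U s \<longleftrightarrow>
     (\<forall>K. compact K \<longrightarrow> set_integrable lebesgue (K - \<Sigma>) (\<lambda>x. (section_norm U s x)\<^sup>2))"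

text \<open>Global: the function lives on the complement of \<open>\<Sigma>\<close> in the whole space.\<close>
definition Z2_harmonic_function ::
    "(real^3) set \<Rightarrow> (real^3 \<Rightarrow> real^3) \<Rightarrow> ('i \<Rightarrow> (real^3) set) \<Rightarrow> ('i \<Rightarrow> 'i \<Rightarrow> real^3 \<Rightarrow> real) \<Rightarrow>
     ('i \<Rightarrow> real^3 \<Rightarrow> real) \<Rightarrow> bool" where
  "Z2_harmonic_function \<Sigma> \<tau> U g f \<longleftrightarrow>
     closed_oriented_submanifold \<Sigma> \<tau> \<and> branched_line_bundle \<Sigma> \<tau> U g \<and>
     bundle_section U g (- \<Sigma>) f \<and> (\<forall>i. smooth_on (U i) (f i)) \<and>
     locally_L2 \<Sigma> U f \<and> locally_L2 \<Sigma> U (\<lambda>i. gradient (f i)) \<and>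
     (\<forall>i. \<forall>x\<in>U i. laplacian (f i) x = 0)"

text \<open>A smooth unit normal field \<open>e\<close> trivialises the complex line bundle \<open>N\<^sub>\<Sigma>\<close>: a normal vector
  \<open>v\<close> at \<open>p\<close> is \<open>normal_coord \<tau> e (p, v)\<close> times \<open>e p\<close>.\<close>
definition normal_frame :: "(real^3) set \<Rightarrow> (real^3 \<Rightarrow> real^3) \<Rightarrow> (real^3 \<Rightarrow> real^3) \<Rightarrow> bool" where
  "normal_frame \<Sigma> \<tau> e \<longleftrightarrow> smooth_along \<Sigma> e \<and> (\<forall>p\<in>\<Sigma>. norm (e p) = 1 \<and> e p \<bullet> \<tau> p = 0)"

definition normal_coord ::
    "(real^3 \<Rightarrow> real^3) \<Rightarrow> (real^3 \<Rightarrow> real^3) \<Rightarrow> (real^3) \<times> (real^3) \<Rightarrow> complex" where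
  "normal_coord \<tau> e = (\<lambda>(p, v). Complex (v \<bullet> e p) (v \<bullet> (cross3 (\<tau> p) (e p))))"

text \<open>\<open>\<zeta>\<^sup>1\<^sup>/\<^sup>2\<close> as a continuous section \<open>r\<close> over \<open>W - \<Sigma>\<close> of the complexified bundle, in the
  trivialisation of \<open>N\<^sub>\<Sigma>\<close> by \<open>e\<close>. Along any closed oriented curve in 3-space a frame \<open>e\<close> for which
  such an \<open>r\<close> exists can be found: twisting a frame by one full turn along a closed component
  changes the sign of the monodromy of \<open>\<zeta>\<^sup>1\<^sup>/\<^sup>2\<close> in the longitudinal direction.\<close>
definition sqrt_section ::
    "(real^3 \<Rightarrow> real^3) \<Rightarrow> ('i \<Rightarrow> (real^3) set) \<Rightarrow> ('i \<Rightarrow> 'i \<Rightarrow> real^3 \<Rightarrow> real) \<Rightarrow> (real^3) set \<Rightarrow>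
     (real^3 \<Rightarrow> (real^3) \<times> (real^3)) \<Rightarrow> (real^3 \<Rightarrow> real^3) \<Rightarrow> ('i \<Rightarrow> real^3 \<Rightarrow> complex) \<Rightarrow> bool" where
  "sqrt_section \<tau> U g W \<zeta> e r \<longleftrightarrow>
     bundle_section U g W r \<and>
     (\<forall>i. continuous_on (U i \<inter> W) (r i) \<and>
          (\<forall>x\<in>U i \<inter> W. (r i x)\<^sup>2 = normal_coord \<tau> e (\<zeta> x)))"

text \<open>\<open>f = Re (A \<zeta>\<^sup>1\<^sup>/\<^sup>2 + B \<zeta>\<^sup>3\<^sup>/\<^sup>2) - 1/2 Re (cnj \<mu> \<zeta>) Re (A \<zeta>\<^sup>1\<^sup>/\<^sup>2) + O(|\<zeta>|\<^sup>5\<^sup>/\<^sup>2)\<close>, where \<open>Re (cnj \<mu> \<zeta>)\<close> is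
  the real inner product of \<open>\<mu>\<close> and \<open>\<zeta>\<close>, and where the complex functions \<open>A\<close> and \<open>B\<close> represent
  sections of the powers \<open>-1/2\<close> and \<open>-3/2\<close> of \<open>N\<^sub>\<Sigma>\<close> in the trivialisations induced by \<open>e\<close>
  and \<open>r\<close>. The error bound is locally uniform along \<open>\<Sigma>\<close>, which may be noncompact.\<close>
definition has_expansion ::
    "(real^3) set \<Rightarrow> (real^3 \<Rightarrow> real^3) \<Rightarrow> ('i \<Rightarrow> (real^3) set) \<Rightarrow> ('i \<Rightarrow> 'i \<Rightarrow> real^3 \<Rightarrow> real) \<Rightarrow>
     ('i \<Rightarrow> real^3 \<Rightarrow> real) \<Rightarrow> (real^3 \<Rightarrow> complex) \<Rightarrow> (real^3 \<Rightarrow> complex) \<Rightarrow> bool" where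
  "has_expansion \<Sigma> \<tau> U g f A B \<longleftrightarrow>
     smooth_along \<Sigma> A \<and> smooth_along \<Sigma> B \<and>
     (\<exists>W \<zeta> e r.
        tubular_neighbourhood \<Sigma> \<tau> W \<zeta> \<and> normal_frame \<Sigma> \<tau> e \<and> sqrt_section \<tau> U g W \<zeta> e r \<and>
        (\<forall>p\<in>\<Sigma>.
           section_norm U
             (\<lambda>i x. f i x -
                (Re (A (fst (\<zeta> x)) * r i x + B (fst (\<zeta> x)) * r i x ^ 3)
                 - 1/2 * (mean_curvature \<Sigma> \<tau> (fst (\<zeta> x)) \<bullet> snd (\<zeta> x)) * Re (A (fst (\<zeta> x)) * r i x)))
           \<in> O[at p within (W - \<Sigma>)](\<lambda>x. norm (snd (\<zeta> x)) powr (5/2))))"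

definition critical ::
    "(real^3) set \<Rightarrow> (real^3 \<Rightarrow> real^3) \<Rightarrow> ('i \<Rightarrow> (real^3) set) \<Rightarrow> ('i \<Rightarrow> 'i \<Rightarrow> real^3 \<Rightarrow> real) \<Rightarrow>
     ('i \<Rightarrow> real^3 \<Rightarrow> real) \<Rightarrow> bool" where
  "critical \<Sigma> \<tau> U g f \<longleftrightarrow> (\<exists>A B. has_expansion \<Sigma> \<tau> U g f A B \<and> (\<forall>p\<in>\<Sigma>. A p = 0))"

text \<open>For given \<open>e\<close> and \<open>r\<close> the coefficients are determined by \<open>f\<close>, and the conditions on their
  zeros do not depend on \<open>e\<close> and \<open>r\<close>; so quantifying over expansions is harmless.\<close>
definition nondegenerate ::
    "(real^3) set \<Rightarrow> (real^3 \<Rightarrow> real^3) \<Rightarrow> ('i \<Rightarrow> (real^3) set) \<Rightarrow> ('i \<Rightarrow> 'i \<Rightarrow> real^3 \<Rightarrow> real) \<Rightarrow>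
     ('i \<Rightarrow> real^3 \<Rightarrow> real) \<Rightarrow> bool" where
  "nondegenerate \<Sigma> \<tau> U g f \<longleftrightarrow>
     critical \<Sigma> \<tau> U g f \<and> (\<exists>A B. has_expansion \<Sigma> \<tau> U g f A B \<and> (\<forall>p\<in>\<Sigma>. B p \<noteq> 0))"


section \<open>The parabola\<close>

definition parabola :: "real \<Rightarrow> (real^3) set" where
  "parabola b = {x. x$3 = 0 \<and> 2 * b * x$1 = (x$2)\<^sup>2}"

text \<open>The orientation in the direction of increasing second coordinate. Reversing an orientation
  conjugates the complex structure of the normal bundle, and hence the coefficients of expansions.\<close>
definition parabola_tangent :: "real \<Rightarrow> real^3 \<Rightarrow> real^3" where
  "parabola_tangent b x = (1 / sqrt ((x$2)\<^sup>2 + b\<^sup>2)) *\<^sub>R vector [x$2, b, 0]"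

end

theory Submission
  imports Defs "HOL-Real_Asymp.Real_Asymp"
begin

text \<open>The function is elementary and comes from the family of paraboloids confocal with the
  parabola. Put \<open>Q(x,s) = x\<^sub>2\<^sup>2/(b+s) + x\<^sub>3\<^sup>2/s - 2x\<^sub>1 - s\<close>. The quadrics \<open>Q(\<cdot>,s) = 0\<close> form a confocal
  family whose focal curve (\<open>s \<rightarrow> 0\<close>) is \<open>\<Gamma>\<^sub>b\<close>, and they satisfy \<open>|\<nabla>Q|\<^sup>2 = -4 \<partial>\<^sub>sQ\<close>. With the
  weight \<open>w(s) = (s(b+s))\<^sup>-\<^sup>1\<^sup>/\<^sup>2\<close> one has \<open>w \<Delta>Q = -4 w'\<close>, and these two identities say that the integral
  of \<open>Q w ds\<close> up to the root \<open>s = s(x)\<close> of \<open>Q(x,s) = 0\<close> is a harmonic function of \<open>x\<close>: the boundary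
  term of the first derivative vanishes because \<open>Q = 0\<close> there, and that of the second cancels the
  integral of \<open>\<Delta>Q\<close>. The substitution \<open>s = \<tau>\<^sup>2\<close> turns the integrand into an even function of \<open>\<tau>\<close>, so the
  finite part of the integral from \<open>0\<close> to \<open>\<tau>\<close> is odd in \<open>\<tau>\<close>; this is \<open>potential\<close>.

  The positive root \<open>s(x)\<close> exists off the closed plane region inside the parabola and tends to zero
  at that region; \<open>\<tau> = \<surd>s\<close> continues analytically across it with a change of sign. Together with
  \<open>\<sigma> = x\<^sub>3/\<tau>\<close> it forms a pair \<open>(\<tau>,\<sigma>)\<close>, defined up to a common sign and governed by
  \<open>\<tau>\<sigma> = x\<^sub>3\<close> and \<open>\<sigma>\<^sup>2 + x\<^sub>2\<^sup>2/(b+\<tau>\<^sup>2) - 2x\<^sub>1 - \<tau>\<^sup>2 = 0\<close>. On the complement of the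
  plane region outside the parabola it is \<open>\<sigma>\<close> that is positive. The
  equations form a nonsingular system off \<open>\<Gamma>\<^sub>b\<close>, which gives smoothness
  (\<open>branch_pair_Ck\<close>) and \<open>\<Delta>f = 0\<close> (\<open>potential_laplacian\<close>); both \<open>f\<close> and its gradient are odd continuous
  functions of \<open>(\<tau>,\<sigma>)\<close>, hence sections of the bundle that are locally bounded.

  The bundle is the pullback of the Moebius bundle of the punctured complex plane under
  \<open>x \<mapsto> (x\<^sub>2\<^sup>2/b - 2x\<^sub>1) + \<i> x\<^sub>3\<close>, a function that vanishes exactly on \<open>\<Gamma>\<^sub>b\<close>. A meridian is mapped to a
  loop that winds once around \<open>0\<close>, and a logarithm along it lifts through any homotopy
  (\<open>homotopic_loops_logarithm\<close>); so every linking loop has monodromy \<open>-1\<close>.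

  Near \<open>\<Gamma>\<^sub>b\<close>, let \<open>\<zeta>\<close> be the complex normal coordinate, \<open>r = \<zeta>\<^sup>1\<^sup>/\<^sup>2\<close> and \<open>\<kappa> = 1 + y\<^sup>2/b\<^sup>2\<close> at a foot point
  with second coordinate \<open>y\<close>. The two equations for \<open>\<tau>\<close> and \<open>\<sigma>\<close> say that
  \<open>w = (\<kappa>\<^sup>1\<^sup>/\<^sup>4\<tau> + \<i> \<kappa>\<^sup>-\<^sup>1\<^sup>/\<^sup>4\<sigma>)/\<surd>2\<close> has \<open>w\<^sup>2 = \<zeta> + O(|\<zeta>|\<^sup>2)\<close> (\<open>square_defect\<close>), whence \<open>w = r + O(|\<zeta>|\<^sup>3\<^sup>/\<^sup>2)\<close>,
  while the Taylor expansion of the potential in \<open>\<tau>\<close> starts with a multiple of \<open>Re w\<^sup>3\<close>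
  (\<open>cubic_main_term\<close>). So \<open>A = 0\<close> and \<open>B = (4\<surd>2/(3\<surd>b)) \<kappa>\<^sup>1\<^sup>/\<^sup>4\<close>, which never vanishes.\<close>

section \<open>Calculus of smooth maps\<close>

lemma Ck_on_continuous: "Ck_on k S f \<Longrightarrow> continuous_on S f"
  by (cases k) (auto intro!: continuous_at_imp_continuous_on differentiable_imp_continuous_within)

lemma Ck_on_SucD: "Ck_on (Suc k) S f \<Longrightarrow> Ck_on k S f"
proof (induction k arbitrary: f)
  case 0
  then show ?case using Ck_on_continuous by fastforce
next
  case (Suc k)
  have "\<forall>x\<in>S. f differentiable (at x)"
    and "\<forall>v. Ck_on (Suc k) S (\<lambda>x. frechet_derivative f (at x) v)"
    using Suc.prems by (auto simp only: Ck_on.simps(2))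
  then show ?case using Suc.IH unfolding Ck_on.simps(2)[of k] by blast
qed

lemma Ck_on_differentiable: "Ck_on (Suc k) S f \<Longrightarrow> x \<in> S \<Longrightarrow> f differentiable (at x)"
  by simp

lemma frechet_derivative_at_eq:
  "(f has_derivative f') (at x) \<Longrightarrow> frechet_derivative f (at x) v = f' v"
  using frechet_derivative_at by fastforce

lemma Ck_on_cong:
  assumes "open S" "\<And>x. x \<in> S \<Longrightarrow> f x = g x" "Ck_on k S f"
  shows "Ck_on k S g"
  using assms(2,3)
proof (induction k arbitrary: f g)
  case 0
  then show ?case using continuous_on_cong by fastforce
next
  case (Suc k)
  have der: "(g has_derivative frechet_derivative f (at x)) (at x)" if "x \<in> S" for x
  proof (rule has_derivative_transform_within_open[OF _ assms(1) that])
    show "(f has_derivative frechet_derivative f (at x)) (at x)"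
      using Suc.prems that frechet_derivative_works by (auto simp only: Ck_on.simps(2))
  qed (use Suc.prems in auto)
  have "Ck_on k S (\<lambda>x. frechet_derivative g (at x) v)" for v
  proof (rule Suc.IH)
    show "Ck_on k S (\<lambda>x. frechet_derivative f (at x) v)" using Suc.prems by simp
    show "frechet_derivative f (at x) v = frechet_derivative g (at x) v" if "x \<in> S" for x
      using frechet_derivative_at[OF der[OF that]] by simp
  qed
  moreover have "\<forall>x\<in>S. g differentiable (at x)"
    using der differentiableI by blast
  ultimately show ?case by (simp only: Ck_on.simps(2)) auto
qed

text \<open>Smoothness is proved by exhibiting a derivative: nothing has to be said about the chosen
  \<open>frechet_derivative\<close>, since on an open set it agrees with the exhibited one.\<close>
lemma Ck_on_SucI:
  assumes "open S" "\<And>x. x \<in> S \<Longrightarrow> (f has_derivative f' x) (at x)"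
    and "\<And>v. Ck_on k S (\<lambda>x. f' x v)"
  shows "Ck_on (Suc k) S f"
proof -
  have "Ck_on k S (\<lambda>x. frechet_derivative f (at x) v)" for v
    by (rule Ck_on_cong[OF assms(1) _ assms(3)[of v]])
       (use frechet_derivative_at[OF assms(2)] in metis)
  then show ?thesis using assms(2) differentiableI by auto blast
qed

lemma Ck_on_const: "open (S :: 'a::real_normed_vector set) \<Longrightarrow> Ck_on k S (\<lambda>x. c)"
proof (induction k arbitrary: c)
  case (Suc k)
  show ?case
    by (rule Ck_on_SucI[where f' = "\<lambda>x v. 0"]) (use Suc in auto)
qed simp

lemma Ck_on_linear:
  assumes "bounded_linear L" "open S"
  shows "Ck_on k S L"
proof (cases k)
  case 0
  then show ?thesis using assms linear_continuous_on by auto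
next
  case (Suc l)
  show ?thesis unfolding Suc
    by (rule Ck_on_SucI[where f' = "\<lambda>x. L"])
       (use assms bounded_linear_imp_has_derivative Ck_on_const in auto)
qed

lemma Ck_on_add:
  assumes "open S" "Ck_on k S f" "Ck_on k S g"
  shows "Ck_on k S (\<lambda>x. f x + g x)"
  using assms(2,3)
proof (induction k arbitrary: f g)
  case 0
  then show ?case by (simp add: continuous_on_add)
next
  case (Suc k)
  show ?case
  proof (rule Ck_on_SucI[OF assms(1)])
    show "((\<lambda>x. f x + g x) has_derivative
        (\<lambda>v. frechet_derivative f (at x) v + frechet_derivative g (at x) v)) (at x)" if "x \<in> S" for x
      using Suc.prems that by (intro has_derivative_add) (auto simp: frechet_derivative_works)
  qed (use Suc in auto)
qed

lemma Ck_on_bilinear: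
  assumes "bounded_bilinear B" "open S" "Ck_on k S f" "Ck_on k S g"
  shows "Ck_on k S (\<lambda>x. B (f x) (g x))"
  using assms(3,4)
proof (induction k arbitrary: f g)
  case 0
  then show ?case using bounded_bilinear.continuous_on[OF assms(1)] by auto
next
  case (Suc k)
  have f: "Ck_on k S f" and g: "Ck_on k S g" using Suc.prems Ck_on_SucD by blast+
  show ?case
  proof (rule Ck_on_SucI[OF assms(2)])
    show "((\<lambda>x. B (f x) (g x)) has_derivative
        (\<lambda>v. B (f x) (frechet_derivative g (at x) v) + B (frechet_derivative f (at x) v) (g x))) (at x)"
      if "x \<in> S" for x
      using Suc.prems that
      by (intro bounded_bilinear.FDERIV[OF assms(1)]) (auto simp: frechet_derivative_works)
    show "Ck_on k S (\<lambda>x. B (f x) (frechet_derivative g (at x) v) + B (frechet_derivative f (at x) v) (g x))"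
      for v
      by (intro Ck_on_add[OF assms(2)] Suc.IH f g) (use Suc.prems in auto)
  qed
qed

lemma Ck_on_linear_compose:
  assumes "bounded_linear L" "open S" "Ck_on k S f"
  shows "Ck_on k S (\<lambda>x. L (f x))"
  using assms(3)
proof (induction k arbitrary: f)
  case 0
  then show ?case using bounded_linear.continuous_on[OF assms(1)] by simp
next
  case (Suc k)
  show ?case
  proof (rule Ck_on_SucI[OF assms(2)])
    show "((\<lambda>x. L (f x)) has_derivative (\<lambda>v. L (frechet_derivative f (at x) v))) (at x)" if "x \<in> S" for x
      using Suc.prems that
      by (intro bounded_linear.has_derivative[OF assms(1)]) (auto simp: frechet_derivative_works)
  qed (use Suc in auto)
qed

lemma Ck_on_mult:
  fixes f g :: "'a::real_normed_vector \<Rightarrow> real"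
  assumes "open S" "Ck_on k S f" "Ck_on k S g"
  shows "Ck_on k S (\<lambda>x. f x * g x)"
  by (rule Ck_on_bilinear[OF bounded_bilinear_mult assms])

lemma Ck_on_minus:
  assumes "open S" "Ck_on k S f"
  shows "Ck_on k S (\<lambda>x. - f x)"
  by (rule Ck_on_linear_compose[OF _ assms]) (simp add: bounded_linear_minus bounded_linear_ident)

lemma Ck_on_diff:
  assumes "open S" "Ck_on k S f" "Ck_on k S g"
  shows "Ck_on k S (\<lambda>x. f x - g x)"
  using Ck_on_add[OF assms(1,2) Ck_on_minus[OF assms(1,3)]] by simp

lemma Ck_on_power:
  fixes f :: "'a::real_normed_vector \<Rightarrow> real"
  assumes "open S" "Ck_on k S f"
  shows "Ck_on k S (\<lambda>x. f x ^ n)"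
proof (induction n)
  case 0
  then show ?case using Ck_on_const[OF assms(1)] by simp
next
  case (Suc n)
  then show ?case using Ck_on_mult[OF assms Suc] by simp
qed

text \<open>Only outer functions of one real variable are composed: then the chain rule is a product of
  two functions already known to be smooth, and the induction closes.\<close>
lemma Ck_on_compose_real:
  fixes g :: "'a::real_normed_vector \<Rightarrow> real" and h :: "real \<Rightarrow> real"
  assumes "open S" "g ` S \<subseteq> T" "Ck_on k S g" "Ck_on k T h"
  shows "Ck_on k S (\<lambda>x. h (g x))"
  using assms(2,3,4)
proof (induction k arbitrary: h)
  case 0
  then show ?case using continuous_on_compose2[of T h S g] by simp
next
  case (Suc k)
  have g: "Ck_on k S g" using Suc.prems Ck_on_SucD by blast
  show ?case
  proof (rule Ck_on_SucI[OF assms(1)])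
    fix x assume x: "x \<in> S"
    have gx: "g x \<in> T" using Suc.prems(1) x by blast
    have dg: "(g has_derivative frechet_derivative g (at x)) (at x)"
      using Ck_on_differentiable[OF Suc.prems(2) x] by (simp only: frechet_derivative_works)
    have dh: "(h has_derivative frechet_derivative h (at (g x))) (at (g x))"
      using Ck_on_differentiable[OF Suc.prems(3) gx] by (simp only: frechet_derivative_works)
    have comp: "((\<lambda>x. h (g x)) has_derivative
        (\<lambda>v. frechet_derivative h (at (g x)) (frechet_derivative g (at x) v))) (at x)"
      by (rule has_derivative_compose[OF dg dh])
    have lin: "frechet_derivative h (at (g x)) u = frechet_derivative h (at (g x)) 1 * u" for u
    proof -
      have "bounded_linear (frechet_derivative h (at (g x)))"
        by (rule has_derivative_bounded_linear[OF dh])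
      from linear_cmul[OF bounded_linear.linear[OF this], of u 1] show ?thesis by simp
    qed
    show "((\<lambda>x. h (g x)) has_derivative
        (\<lambda>v. frechet_derivative h (at (g x)) 1 * frechet_derivative g (at x) v)) (at x)"
      by (rule has_derivative_eq_rhs[OF comp], rule ext, rule lin)
  next
    show "Ck_on k S (\<lambda>x. frechet_derivative h (at (g x)) 1 * frechet_derivative g (at x) v)" for v
    proof (rule Ck_on_mult[OF assms(1)])
      show "Ck_on k S (\<lambda>x. frechet_derivative h (at (g x)) 1)"
        using Suc.IH[OF Suc.prems(1) g, of "\<lambda>y. frechet_derivative h (at y) 1"] Suc.prems(3) by simp
      show "Ck_on k S (\<lambda>x. frechet_derivative g (at x) v)" using Suc.prems(2) by simp
    qed
  qed
qed

lemma Ck_on_real_SucI: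
  fixes h :: "real \<Rightarrow> real"
  assumes "open T" "\<And>y. y \<in> T \<Longrightarrow> (h has_real_derivative h' y) (at y)" "Ck_on k T h'"
  shows "Ck_on (Suc k) T h"
  by (rule Ck_on_SucI[OF assms(1), where f' = "\<lambda>y v. h' y * v"])
     (use assms in \<open>auto simp: has_field_derivative_def Ck_on_mult Ck_on_const\<close>)

lemma Ck_on_inverse_real: "Ck_on k (- {0}) (inverse :: real \<Rightarrow> real)"
proof (induction k)
  case 0
  have "continuous_on (- {0}) (\<lambda>x::real. inverse x)"
    by (rule continuous_on_inverse[OF continuous_on_id]) simp
  then show ?case unfolding Ck_on.simps .
next
  case (Suc k)
  show ?case
  proof (rule Ck_on_real_SucI)
    show "(inverse has_real_derivative - (inverse y ^ 2)) (at y)" if "y \<in> - {0}" for y :: real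
      using DERIV_inverse[of y UNIV] that by (simp add: numeral_2_eq_2)
    show "Ck_on k (- {0}) (\<lambda>y::real. - (inverse y ^ 2))"
      by (intro Ck_on_minus Ck_on_power Suc) auto
  qed auto
qed

lemma Ck_on_inverse:
  fixes f :: "'a::real_normed_vector \<Rightarrow> real"
  assumes "open S" "Ck_on k S f" "\<And>x. x \<in> S \<Longrightarrow> f x \<noteq> 0"
  shows "Ck_on k S (\<lambda>x. inverse (f x))"
proof -
  have "f ` S \<subseteq> - {0}" using assms(3) by auto
  from Ck_on_compose_real[OF assms(1) this assms(2) Ck_on_inverse_real] show ?thesis .
qed

lemma Ck_on_divide:
  fixes f :: "'a::real_normed_vector \<Rightarrow> real"
  assumes "open S" "Ck_on k S f" "Ck_on k S g" "\<And>x. x \<in> S \<Longrightarrow> g x \<noteq> 0"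
  shows "Ck_on k S (\<lambda>x. f x / g x)"
  unfolding divide_inverse by (intro Ck_on_mult Ck_on_inverse assms)

lemma Ck_on_sqrt:
  fixes f :: "'a::real_normed_vector \<Rightarrow> real"
  assumes "open S" "Ck_on k S f" "\<And>x. x \<in> S \<Longrightarrow> f x > 0"
  shows "Ck_on k S (\<lambda>x. sqrt (f x))"
proof -
  have "Ck_on k {0<..} sqrt"
  proof (induction k)
    case 0
    have "continuous_on {0<..} (\<lambda>x. sqrt x)"
      by (rule continuous_on_real_sqrt[OF continuous_on_id])
    then show ?case unfolding Ck_on.simps .
  next
    case (Suc k)
    show ?case
    proof (rule Ck_on_real_SucI)
      show "(sqrt has_real_derivative inverse (sqrt y) / 2) (at y)" if "y \<in> {0<..}" for y
        using DERIV_real_sqrt[of y] that by simp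
      show "Ck_on k {0<..} (\<lambda>y. inverse (sqrt y) / 2)"
        by (intro Ck_on_divide Ck_on_inverse Ck_on_const Suc) auto
    qed auto
  qed
  moreover have "f ` S \<subseteq> {0<..}" using assms(3) by auto
  ultimately show ?thesis by (intro Ck_on_compose_real[OF assms(1) _ assms(2), where h = sqrt])
qed

lemma Ck_on_arsinh:
  fixes f :: "'a::real_normed_vector \<Rightarrow> real"
  assumes "open S" "Ck_on k S f"
  shows "Ck_on k S (\<lambda>x. arsinh (f x))"
proof -
  have "Ck_on k UNIV (arsinh :: real \<Rightarrow> real)"
  proof (cases k)
    case (Suc l)
    have pos: "x\<^sup>2 + 1 > 0" for x :: real by (smt (verit) zero_le_power2)
    have "Ck_on l UNIV (\<lambda>x::real. x)" by (rule Ck_on_linear) auto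
    then have "Ck_on l UNIV (\<lambda>y::real. 1 / sqrt (y\<^sup>2 + 1))"
      by (intro Ck_on_divide Ck_on_sqrt Ck_on_add Ck_on_power Ck_on_const pos)
         (auto simp: less_imp_neq[OF pos, symmetric])
    then show ?thesis unfolding Suc
      by (intro Ck_on_real_SucI) (auto intro: arsinh_real_has_field_derivative)
  qed (use continuous_on_arsinh[of UNIV] in simp)
  then show ?thesis by (rule Ck_on_compose_real[OF assms(1) subset_UNIV assms(2)])
qed

lemma Ck_on_scaleR:
  assumes "open S" "Ck_on k S f" "Ck_on k S g"
  shows "Ck_on k S (\<lambda>x. f x *\<^sub>R g x)"
  by (rule Ck_on_bilinear[OF bounded_bilinear_scaleR assms])

lemma Ck_on_Pair:
  assumes "open S" "Ck_on k S f" "Ck_on k S g"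
  shows "Ck_on k S (\<lambda>x. (f x, g x))"
proof -
  have "Ck_on k S (\<lambda>x. (f x, 0) + (0, g x))"
    by (intro Ck_on_add Ck_on_linear_compose[OF _ assms(1,2), of "\<lambda>u. (u, 0)"]
        Ck_on_linear_compose[OF _ assms(1,3), of "\<lambda>u. (0, u)"] assms(1) bounded_linear_Pair)
      (auto simp: bounded_linear_ident)
  then show ?thesis by simp
qed

lemma Ck_on_vec_nth: "open S \<Longrightarrow> Ck_on k S (\<lambda>x :: real^'n. x $ i)"
  by (intro Ck_on_linear bounded_linear_vec_nth)

lemma vector3_sum: "vector [u, v, w] = u *\<^sub>R axis 1 1 + v *\<^sub>R axis 2 1 + w *\<^sub>R (axis 3 1 :: real^3)"
  by (simp add: vec_eq_iff forall_3 axis_def)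

lemma Ck_on_vector3:
  assumes "open S" "Ck_on k S f" "Ck_on k S g" "Ck_on k S h"
  shows "Ck_on k S (\<lambda>x. vector [f x, g x, h x] :: real^3)"
  unfolding vector3_sum by (intro Ck_on_add Ck_on_scaleR Ck_on_const assms)

lemma Ck_on_of_real:
  assumes "open S" "Ck_on k S f"
  shows "Ck_on k S (\<lambda>x. complex_of_real (f x))"
  by (intro Ck_on_linear_compose[OF _ assms] bounded_linear_of_real)

lemmas Ck_on_intros = Ck_on_const Ck_on_add Ck_on_diff Ck_on_minus Ck_on_mult Ck_on_power
  Ck_on_divide Ck_on_inverse Ck_on_sqrt Ck_on_arsinh Ck_on_scaleR Ck_on_Pair Ck_on_vec_nth
  Ck_on_vector3 Ck_on_of_real

section \<open>The potential along a branch\<close>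

text \<open>A local choice of the square root \<open>\<tau>\<close> of the confocal parameter together with \<open>\<sigma> = x\<^sub>3/\<tau>\<close>.
  Keeping both functions and the two equations treats \<open>\<tau> = 0\<close> and \<open>\<sigma> = 0\<close> alike; the second
  equation is \<open>Q(x,\<tau>\<^sup>2) = 0\<close> with \<open>x\<^sub>3\<^sup>2/\<tau>\<^sup>2\<close> written as \<open>\<sigma>\<^sup>2\<close>.\<close>
definition branch_pair ::
  "real \<Rightarrow> (real^3) set \<Rightarrow> (real^3 \<Rightarrow> real) \<Rightarrow> (real^3 \<Rightarrow> real) \<Rightarrow> bool" where
  "branch_pair b S \<tau> \<sigma> \<longleftrightarrow> open S \<and> S \<inter> parabola b = {} \<and>
     (\<forall>x\<in>S. \<tau> x * \<sigma> x = x$3 \<and>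
        (\<sigma> x)\<^sup>2 + (x$2)\<^sup>2 / (b + (\<tau> x)\<^sup>2) - 2 * x$1 - (\<tau> x)\<^sup>2 = 0 \<and>
        \<tau> differentiable (at x) \<and> \<sigma> differentiable (at x))"

lemma derivative_zero_of_constant_on:
  assumes "(f has_derivative f') (at x)" "open S" "x \<in> S" "\<And>y. y \<in> S \<Longrightarrow> f y = c"
  shows "f' v = 0"
proof -
  have "((\<lambda>y. c) has_derivative f') (at x)"
    by (rule has_derivative_transform_within_open[OF assms(1,2,3)]) (use assms(4) in auto)
  then have "f' = (\<lambda>v. 0)" using has_derivative_unique has_derivative_const by blast
  then show ?thesis by simp
qed

text \<open>Half the Jacobian determinant in \<open>(\<tau>,\<sigma>)\<close> of the two equations of a branch pair. It is a sum of squares that vanishes only for \<open>\<tau> = \<sigma> = 0\<close>, that is, on the parabola.\<close>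
definition jac :: "real \<Rightarrow> real \<Rightarrow> real \<Rightarrow> real \<Rightarrow> real" where
  "jac b y t s = s\<^sup>2 + t\<^sup>2 * (1 + y\<^sup>2 / (b + t\<^sup>2)\<^sup>2)"

lemma branch_pair_nonzero:
  assumes "0 < b" "branch_pair b S \<tau> \<sigma>" "x \<in> S"
  shows "\<tau> x \<noteq> 0 \<or> \<sigma> x \<noteq> 0"
proof (rule ccontr)
  assume "\<not> ?thesis"
  then have "x$3 = 0" "(x$2)\<^sup>2 / b - 2 * x$1 = 0"
    using assms unfolding branch_pair_def by force+
  then have "x \<in> parabola b" using assms(1) by (simp add: parabola_def field_simps)
  then show False using assms unfolding branch_pair_def by blast
qed

lemma jac_pos: "0 < b \<Longrightarrow> t \<noteq> 0 \<or> s \<noteq> 0 \<Longrightarrow> 0 < jac b y t s"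
  unfolding jac_def
  by (smt (verit) divide_nonneg_nonneg mult_nonneg_nonneg mult_pos_pos zero_le_power2 zero_less_power2)

text \<open>The differentiated equations, solved by Cramer's rule. The second equation was cleared of its
  denominator before differentiating.\<close>
lemma implicit_linear_system:
  fixes b y t s t' s' v1 v2 v3 x1 :: real
  assumes "0 < b" "t \<noteq> 0 \<or> s \<noteq> 0"
    and "t' * s + t * s' = v3"
    and "s\<^sup>2 + y\<^sup>2 / (b + t\<^sup>2) - 2 * x1 - t\<^sup>2 = 0"
    and "(2 * s * s' - 2 * v1 - 2 * t * t') * (b + t\<^sup>2) + (s\<^sup>2 - 2 * x1 - t\<^sup>2) * (2 * t * t') + 2 * y * v2 = 0"
  shows "t' = (s * v3 - t * (v1 - y * v2 / (b + t\<^sup>2))) / jac b y t s"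
    and "s' = (t * (1 + y\<^sup>2 / (b + t\<^sup>2)\<^sup>2) * v3 + s * (v1 - y * v2 / (b + t\<^sup>2))) / jac b y t s"
proof -
  define P where "P = b + t\<^sup>2"
  have P: "P > 0" using assms(1) by (simp add: P_def add_pos_nonneg)
  define c where "c = v1 - y * v2 / P"
  define M where "M = 1 + y\<^sup>2 / P\<^sup>2"
  have J: "jac b y t s = s\<^sup>2 + t\<^sup>2 * M" by (simp add: jac_def M_def P_def)
  have Jpos: "s\<^sup>2 + t\<^sup>2 * M > 0" using jac_pos[OF assms(1,2), of y] J by simp
  have e: "s\<^sup>2 - 2 * x1 - t\<^sup>2 = - (y\<^sup>2 / P)" using assms(4) by (simp add: P_def)
  have "(2 * s * s' - 2 * v1 - 2 * t * t') * P - (y\<^sup>2 / P) * (2 * t * t') + 2 * y * v2 = 0"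
    using assms(5) unfolding e P_def[symmetric] by simp
  moreover have "s * s' - M * t * t' - c =
      ((2 * s * s' - 2 * v1 - 2 * t * t') * P - (y\<^sup>2 / P) * (2 * t * t') + 2 * y * v2) / (2 * P)"
    using P unfolding M_def c_def by (simp add: field_simps power2_eq_square)
  ultimately have d: "s * s' - M * t * t' = c" by simp
  have "(s\<^sup>2 + t\<^sup>2 * M) * t' = s * v3 - t * c"
    unfolding d[symmetric] assms(3)[symmetric] by (simp add: algebra_simps power2_eq_square)
  then show "t' = (s * v3 - t * (v1 - y * v2 / (b + t\<^sup>2))) / jac b y t s"
    unfolding J P_def[symmetric] c_def[symmetric] using Jpos by (simp add: field_simps)
  have "(s\<^sup>2 + t\<^sup>2 * M) * s' = t * M * v3 + s * c"
    unfolding d[symmetric] assms(3)[symmetric] by (simp add: algebra_simps power2_eq_square)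
  then show "s' = (t * (1 + y\<^sup>2 / (b + t\<^sup>2)\<^sup>2) * v3 + s * (v1 - y * v2 / (b + t\<^sup>2))) / jac b y t s"
    unfolding J P_def[symmetric] c_def[symmetric] M_def[symmetric] using Jpos by (simp add: field_simps)
qed

lemma vec_nth_has_derivative: "((\<lambda>x::real^3. x $ i) has_derivative (\<lambda>v. v $ i)) (at x)"
  by (rule bounded_linear_imp_has_derivative[OF bounded_linear_vec_nth])

lemma branch_pair_derivative:
  fixes \<tau> \<sigma> :: "real^3 \<Rightarrow> real" and x v :: "real^3"
  assumes "0 < b" "branch_pair b S \<tau> \<sigma>" "x \<in> S"
  defines "\<tau>' \<equiv> frechet_derivative \<tau> (at x)" and "\<sigma>' \<equiv> frechet_derivative \<sigma> (at x)"
  shows "(\<tau> has_derivative \<tau>') (at x)" "(\<sigma> has_derivative \<sigma>') (at x)"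
    and "\<tau>' v * \<sigma> x + \<tau> x * \<sigma>' v = v$3"
    and "\<tau>' v = (\<sigma> x * v$3 - \<tau> x * (v$1 - x$2 * v$2 / (b + (\<tau> x)\<^sup>2))) / jac b (x$2) (\<tau> x) (\<sigma> x)"
    and "\<sigma>' v = (\<tau> x * (1 + (x$2)\<^sup>2 / (b + (\<tau> x)\<^sup>2)\<^sup>2) * v$3 + \<sigma> x * (v$1 - x$2 * v$2 / (b + (\<tau> x)\<^sup>2)))
            / jac b (x$2) (\<tau> x) (\<sigma> x)"
proof -
  show t: "(\<tau> has_derivative \<tau>') (at x)" and s: "(\<sigma> has_derivative \<sigma>') (at x)"
    unfolding \<tau>'_def \<sigma>'_def using assms(2,3)
    by (auto simp: branch_pair_def frechet_derivative_works[symmetric])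
  have S: "open S" using assms(2) by (simp add: branch_pair_def)
  have pos: "b + (\<tau> y)\<^sup>2 > 0" for y using assms(1) by (simp add: add_pos_nonneg)
  have E1: "\<tau> y * \<sigma> y - y$3 = 0" if "y \<in> S" for y
    using assms(2) that by (simp add: branch_pair_def)
  have E2: "((\<sigma> y)\<^sup>2 - 2 * y$1 - (\<tau> y)\<^sup>2) * (b + (\<tau> y)\<^sup>2) + (y$2)\<^sup>2 = 0" if "y \<in> S" for y
  proof -
    have "(\<sigma> y)\<^sup>2 + (y$2)\<^sup>2 / (b + (\<tau> y)\<^sup>2) - 2 * y$1 - (\<tau> y)\<^sup>2 = 0"
      using assms(2) that unfolding branch_pair_def by blast
    then have "(\<sigma> y)\<^sup>2 - 2 * y$1 - (\<tau> y)\<^sup>2 = - ((y$2)\<^sup>2 / (b + (\<tau> y)\<^sup>2))" by linarith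
    then show ?thesis using pos[of y] by simp
  qed
  have "((\<lambda>y. \<tau> y * \<sigma> y - y$3) has_derivative (\<lambda>v. \<tau> x * \<sigma>' v + \<tau>' v * \<sigma> x - v$3)) (at x)"
    by (intro has_derivative_diff has_derivative_mult t s vec_nth_has_derivative)
  from derivative_zero_of_constant_on[OF this S assms(3) E1]
  show D1: "\<tau>' v * \<sigma> x + \<tau> x * \<sigma>' v = v$3" by (simp add: algebra_simps)
  have "((\<lambda>y. ((\<sigma> y)\<^sup>2 - 2 * y$1 - (\<tau> y)\<^sup>2) * (b + (\<tau> y)\<^sup>2) + (y$2)\<^sup>2) has_derivative
     (\<lambda>v. (2 * \<sigma> x * \<sigma>' v - 2 * v$1 - 2 * \<tau> x * \<tau>' v) * (b + (\<tau> x)\<^sup>2)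
        + ((\<sigma> x)\<^sup>2 - 2 * x$1 - (\<tau> x)\<^sup>2) * (2 * \<tau> x * \<tau>' v) + 2 * x$2 * v$2)) (at x)"
    by (rule derivative_eq_intros t s vec_nth_has_derivative refl | simp)+ (simp add: algebra_simps)
  from derivative_zero_of_constant_on[OF this S assms(3) E2]
  have D2: "(2 * \<sigma> x * \<sigma>' v - 2 * v$1 - 2 * \<tau> x * \<tau>' v) * (b + (\<tau> x)\<^sup>2)
        + ((\<sigma> x)\<^sup>2 - 2 * x$1 - (\<tau> x)\<^sup>2) * (2 * \<tau> x * \<tau>' v) + 2 * x$2 * v$2 = 0" .
  have E2': "(\<sigma> x)\<^sup>2 + (x$2)\<^sup>2 / (b + (\<tau> x)\<^sup>2) - 2 * x$1 - (\<tau> x)\<^sup>2 = 0"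
    using assms(2,3) by (simp add: branch_pair_def)
  note sys = implicit_linear_system[OF assms(1) branch_pair_nonzero[OF assms(1-3)] D1 E2' D2]
  show "\<tau>' v = (\<sigma> x * v$3 - \<tau> x * (v$1 - x$2 * v$2 / (b + (\<tau> x)\<^sup>2))) / jac b (x$2) (\<tau> x) (\<sigma> x)"
    by (rule sys)
  show "\<sigma>' v = (\<tau> x * (1 + (x$2)\<^sup>2 / (b + (\<tau> x)\<^sup>2)\<^sup>2) * v$3 + \<sigma> x * (v$1 - x$2 * v$2 / (b + (\<tau> x)\<^sup>2)))
            / jac b (x$2) (\<tau> x) (\<sigma> x)"
    by (rule sys)
qed

text \<open>The derivatives of \<open>\<tau>\<close> and \<open>\<sigma>\<close> are rational functions of \<open>x\<close>, \<open>\<tau>\<close> and \<open>\<sigma>\<close> with denominator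
  nowhere zero, so each order of differentiability yields the next.\<close>
lemma branch_pair_Ck:
  assumes "0 < b" "branch_pair b S \<tau> \<sigma>"
  shows "Ck_on k S \<tau> \<and> Ck_on k S \<sigma>"
proof (induction k)
  case 0
  have "\<tau> differentiable (at x)" "\<sigma> differentiable (at x)" if "x \<in> S" for x
    using assms(2) that by (auto simp: branch_pair_def)
  then show ?case
    by (auto intro!: continuous_at_imp_continuous_on differentiable_imp_continuous_within)
next
  case (Suc k)
  have S: "open S" using assms(2) by (simp add: branch_pair_def)
  have t: "Ck_on k S \<tau>" and s: "Ck_on k S \<sigma>" using Suc by auto
  have pos: "b + (\<tau> y)\<^sup>2 \<noteq> 0" for y using assms(1) by (smt (verit) zero_le_power2)
  have Jn: "jac b (x$2) (\<tau> x) (\<sigma> x) \<noteq> 0" if "x \<in> S" for x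
    using jac_pos[OF assms(1) branch_pair_nonzero[OF assms that], of "x$2"] by simp
  have J: "Ck_on k S (\<lambda>x. jac b (x$2) (\<tau> x) (\<sigma> x))"
    unfolding jac_def by (intro Ck_on_intros S t s) (simp_all add: pos)
  have "Ck_on (Suc k) S \<tau>"
  proof (rule Ck_on_SucI[OF S branch_pair_derivative(1)[OF assms]])
    fix v :: "real^3"
    have "Ck_on k S (\<lambda>x. (\<sigma> x * v$3 - \<tau> x * (v$1 - x$2 * v$2 / (b + (\<tau> x)\<^sup>2))) / jac b (x$2) (\<tau> x) (\<sigma> x))"
      by (rule Ck_on_divide[OF S _ J Jn]) (intro Ck_on_intros S t s pos)
    then show "Ck_on k S (\<lambda>x. frechet_derivative \<tau> (at x) v)"
      by (rule Ck_on_cong[OF S, rotated]) (simp add: branch_pair_derivative(4)[OF assms])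
  qed
  moreover have "Ck_on (Suc k) S \<sigma>"
  proof (rule Ck_on_SucI[OF S branch_pair_derivative(2)[OF assms]])
    fix v :: "real^3"
    have "Ck_on k S (\<lambda>x. (\<tau> x * (1 + (x$2)\<^sup>2 / (b + (\<tau> x)\<^sup>2)\<^sup>2) * v$3
        + \<sigma> x * (v$1 - x$2 * v$2 / (b + (\<tau> x)\<^sup>2))) / jac b (x$2) (\<tau> x) (\<sigma> x))"
      by (rule Ck_on_divide[OF S _ J Jn]) (intro Ck_on_intros S t s, simp_all add: pos)
    then show "Ck_on k S (\<lambda>x. frechet_derivative \<sigma> (at x) v)"
      by (rule Ck_on_cong[OF S, rotated]) (simp add: branch_pair_derivative(5)[OF assms])
  qed
  ultimately show ?case by blast
qed

text \<open>Half the finite part of the integral of \<open>Q(x,s) w(s) ds\<close> from \<open>0\<close> to \<open>t\<^sup>2\<close>, that is, of the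
  integral of \<open>Q(x,v\<^sup>2) / sqrt (b + v\<^sup>2) dv\<close> from \<open>0\<close> to \<open>t\<close>. The term with \<open>x\<^sub>3\<^sup>2/t\<close> is written with
  \<open>s = x\<^sub>3/t\<close>, so that it makes sense at \<open>t = 0\<close>.\<close>
definition potential :: "real \<Rightarrow> real^3 \<Rightarrow> real \<Rightarrow> real \<Rightarrow> real" where
  "potential b x t s =
     (x$2)\<^sup>2 * t / (b * sqrt (b + t\<^sup>2)) - x$3 * s * sqrt (b + t\<^sup>2) / b
     - 2 * x$1 * arsinh (t / sqrt b) - t * sqrt (b + t\<^sup>2) / 2 + b * arsinh (t / sqrt b) / 2"

lemma potential_Ck:
  assumes "0 < b" "branch_pair b S \<tau> \<sigma>"
  shows "Ck_on k S (\<lambda>x. potential b x (\<tau> x) (\<sigma> x))"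
proof -
  have S: "open S" using assms(2) by (simp add: branch_pair_def)
  have pos: "b + (\<tau> y)\<^sup>2 > 0" for y using assms(1) by (simp add: add_pos_nonneg)
  show ?thesis
    unfolding potential_def
    by (intro Ck_on_intros S branch_pair_Ck[OF assms, THEN conjunct1]
        branch_pair_Ck[OF assms, THEN conjunct2] pos)
      (use assms(1) pos in \<open>simp_all add: less_imp_neq[symmetric]\<close>)
qed

text \<open>The terms containing \<open>t'\<close> add up to \<open>t'/R\<close> times the left-hand side of the branch equation,
  so only the explicit dependence on \<open>x\<close> contributes to the gradient.\<close>
lemma potential_derivative_identity:
  fixes b R t s t' s' x1 y z v1 v2 v3 A :: real
  assumes "0 < b" "0 < R" "R\<^sup>2 = b + t\<^sup>2" "z = t * s" "t' * s + t * s' = v3"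
    and "s\<^sup>2 + y\<^sup>2 / R\<^sup>2 - 2 * x1 - t\<^sup>2 = 0"
  shows "(2 * y * v2 * t + y\<^sup>2 * t') / (b * R) - y\<^sup>2 * t * (t * t' / R) / (b * R\<^sup>2)
      - (v3 * s * R + z * s' * R + z * s * (t * t' / R)) / b
      - 2 * v1 * A - 2 * x1 * (t' / R) - (t' * R + t * (t * t' / R)) / 2 + b * (t' / R) / 2
    = v1 * (-2 * A) + v2 * (2 * y * t / (b * R)) + v3 * (-2 * s * R / b)"
proof -
  have y2: "y\<^sup>2 = R\<^sup>2 * (2 * x1 + t\<^sup>2 - s\<^sup>2)" using assms(2,6) by (simp add: field_simps)
  have b: "b = R\<^sup>2 - t\<^sup>2" using assms(3) by simp
  have nz: "R \<noteq> 0" "R\<^sup>2 - t\<^sup>2 \<noteq> 0" using assms(1,2) b by auto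
  show ?thesis unfolding y2 assms(4) assms(5)[symmetric] b using nz
    by (simp add: divide_simps) (simp add: algebra_simps power2_eq_square)
qed

lemma has_derivative_divide_const:
  "(f has_derivative f') (at x) \<Longrightarrow> ((\<lambda>x. f x / c) has_derivative (\<lambda>v. f' v / (c::real))) (at x)"
  by (rule bounded_linear.has_derivative[OF bounded_linear_divide])

lemma branch_pair_root_derivative:
  assumes "0 < b" "(\<tau> has_derivative \<tau>') (at x)"
  defines "R \<equiv> sqrt (b + (\<tau> x)\<^sup>2)"
  shows "((\<lambda>x. sqrt (b + (\<tau> x)\<^sup>2)) has_derivative (\<lambda>v. \<tau> x * \<tau>' v / R)) (at x)"
    and "((\<lambda>x. arsinh (\<tau> x / sqrt b)) has_derivative (\<lambda>v. \<tau>' v / R)) (at x)"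
    and "((\<lambda>x. \<tau> x / sqrt (b + (\<tau> x)\<^sup>2)) has_derivative (\<lambda>v. \<tau>' v / R - \<tau> x * (\<tau> x * \<tau>' v / R) / R\<^sup>2)) (at x)"
proof -
  have pos: "b + (\<tau> x)\<^sup>2 > 0" using assms(1) by (simp add: add_pos_nonneg)
  then have R: "0 < R" by (simp add: R_def)
  show dR: "((\<lambda>x. sqrt (b + (\<tau> x)\<^sup>2)) has_derivative (\<lambda>v. \<tau> x * \<tau>' v / R)) (at x)"
    unfolding R_def using pos
    by (auto intro!: derivative_eq_intros assms(2) simp: field_simps)
  have "(\<tau> x / sqrt b)\<^sup>2 + 1 = (b + (\<tau> x)\<^sup>2) / b" using assms(1) by (simp add: field_simps)
  then have "sqrt ((\<tau> x / sqrt b)\<^sup>2 + 1) = R / sqrt b" by (simp add: R_def real_sqrt_divide)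
  then have "(arsinh has_real_derivative 1 / (R / sqrt b)) (at (\<tau> x / sqrt b))"
    using arsinh_real_has_field_derivative[of "\<tau> x / sqrt b" UNIV] by simp
  then have arsinh: "(arsinh has_derivative (\<lambda>u. 1 / (R / sqrt b) * u)) (at (\<tau> x / sqrt b))"
    unfolding has_field_derivative_def .
  have "((\<lambda>x. \<tau> x / sqrt b) has_derivative (\<lambda>v. \<tau>' v / sqrt b)) (at x)"
    by (rule bounded_linear.has_derivative[OF bounded_linear_divide assms(2)])
  from has_derivative_compose[OF this arsinh]
  show "((\<lambda>x. arsinh (\<tau> x / sqrt b)) has_derivative (\<lambda>v. \<tau>' v / R)) (at x)"
    using assms(1) by simp
  have "((\<lambda>x. \<tau> x / sqrt (b + (\<tau> x)\<^sup>2)) has_derivative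
      (\<lambda>v. (\<tau>' v * R - \<tau> x * (\<tau> x * \<tau>' v / R)) / (R * R))) (at x)"
    using has_derivative_divide'[OF assms(2) dR] R by (simp add: R_def)
  then show "((\<lambda>x. \<tau> x / sqrt (b + (\<tau> x)\<^sup>2)) has_derivative
      (\<lambda>v. \<tau>' v / R - \<tau> x * (\<tau> x * \<tau>' v / R) / R\<^sup>2)) (at x)"
    using R by (simp add: diff_divide_distrib power2_eq_square)
qed

text \<open>The gradient again involves \<open>x\<close>, \<open>\<tau>\<close> and \<open>\<sigma>\<close> only, without a denominator that vanishes at
  the parabola; this gives its local boundedness, and the Laplacian needs only
  one more derivative of \<open>\<tau>\<close> and \<open>\<sigma>\<close>.\<close>
lemma potential_derivative:
  assumes "0 < b" "branch_pair b S \<tau> \<sigma>" "x \<in> S"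
  shows "((\<lambda>x. potential b x (\<tau> x) (\<sigma> x)) has_derivative
     (\<lambda>v. v$1 * (-2 * arsinh (\<tau> x / sqrt b)) + v$2 * (2 * x$2 * \<tau> x / (b * sqrt (b + (\<tau> x)\<^sup>2)))
        + v$3 * (-2 * \<sigma> x * sqrt (b + (\<tau> x)\<^sup>2) / b))) (at x)"
proof -
  define \<tau>' where "\<tau>' = frechet_derivative \<tau> (at x)"
  define \<sigma>' where "\<sigma>' = frechet_derivative \<sigma> (at x)"
  define R where "R = sqrt (b + (\<tau> x)\<^sup>2)"
  have t: "(\<tau> has_derivative \<tau>') (at x)" and s: "(\<sigma> has_derivative \<sigma>') (at x)"
    unfolding \<tau>'_def \<sigma>'_def by (rule branch_pair_derivative[OF assms])+
  have pos: "b + (\<tau> x)\<^sup>2 > 0" using assms(1) by (simp add: add_pos_nonneg)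
  have R: "0 < R" "R\<^sup>2 = b + (\<tau> x)\<^sup>2" using pos by (simp_all add: R_def)
  note root = branch_pair_root_derivative[OF assms(1) t, folded R_def]
  have eq: "(\<sigma> x)\<^sup>2 + (x$2)\<^sup>2 / R\<^sup>2 - 2 * x$1 - (\<tau> x)\<^sup>2 = 0"
    using assms(2,3) unfolding R(2) branch_pair_def by blast
  have z: "x$3 = \<tau> x * \<sigma> x" using assms(2,3) by (simp add: branch_pair_def)
  have y2: "((\<lambda>x. (x$2)\<^sup>2) has_derivative (\<lambda>v. 2 * x$2 * v$2)) (at x)"
    by (rule derivative_eq_intros vec_nth_has_derivative refl | simp)+ (simp add: fun_eq_iff mult_ac)
  have raw: "((\<lambda>x. (x$2)\<^sup>2 * (\<tau> x / sqrt (b + (\<tau> x)\<^sup>2)) / b - x$3 * \<sigma> x * sqrt (b + (\<tau> x)\<^sup>2) / b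
     - 2 * x$1 * arsinh (\<tau> x / sqrt b) - \<tau> x * sqrt (b + (\<tau> x)\<^sup>2) / 2 + b * arsinh (\<tau> x / sqrt b) / 2)
    has_derivative
     (\<lambda>v. ((x$2)\<^sup>2 * (\<tau>' v / R - \<tau> x * (\<tau> x * \<tau>' v / R) / R\<^sup>2) + (2 * x$2 * v$2) * (\<tau> x / R)) / b
      - ((x$3 * \<sigma> x) * (\<tau> x * \<tau>' v / R) + (x$3 * \<sigma>' v + v$3 * \<sigma> x) * R) / b
      - ((2 * x$1) * (\<tau>' v / R) + (2 * v$1) * arsinh (\<tau> x / sqrt b))
      - (\<tau> x * (\<tau> x * \<tau>' v / R) + \<tau>' v * R) / 2 + b * (\<tau>' v / R) / 2)) (at x)"
    unfolding R_def
    by (intro has_derivative_add has_derivative_diff has_derivative_divide_const has_derivative_mult has_derivative_mult_right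
        t s y2 root[unfolded R_def] vec_nth_has_derivative)
  have simplified: "((x$2)\<^sup>2 * (\<tau>' v / R - \<tau> x * (\<tau> x * \<tau>' v / R) / R\<^sup>2) + (2 * x$2 * v$2) * (\<tau> x / R)) / b
      - ((x$3 * \<sigma> x) * (\<tau> x * \<tau>' v / R) + (x$3 * \<sigma>' v + v$3 * \<sigma> x) * R) / b
      - ((2 * x$1) * (\<tau>' v / R) + (2 * v$1) * arsinh (\<tau> x / sqrt b))
      - (\<tau> x * (\<tau> x * \<tau>' v / R) + \<tau>' v * R) / 2 + b * (\<tau>' v / R) / 2
    = v$1 * (-2 * arsinh (\<tau> x / sqrt b)) + v$2 * (2 * x$2 * \<tau> x / (b * R))
        + v$3 * (-2 * \<sigma> x * R / b)" for v
    using potential_derivative_identity[OF assms(1) R z branch_pair_derivative(3)[OF assms,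
        folded \<tau>'_def \<sigma>'_def] eq, of "v$2" v "v$1" "arsinh (\<tau> x / sqrt b)"]
    by (simp add: add_divide_distrib diff_divide_distrib algebra_simps)
  have "(\<lambda>x. potential b x (\<tau> x) (\<sigma> x)) =
      (\<lambda>x. (x$2)\<^sup>2 * (\<tau> x / sqrt (b + (\<tau> x)\<^sup>2)) / b - x$3 * \<sigma> x * sqrt (b + (\<tau> x)\<^sup>2) / b
     - 2 * x$1 * arsinh (\<tau> x / sqrt b) - \<tau> x * sqrt (b + (\<tau> x)\<^sup>2) / 2 + b * arsinh (\<tau> x / sqrt b) / 2)"
    by (simp add: potential_def fun_eq_iff mult.commute[of b])
  then show ?thesis using raw[unfolded simplified] unfolding R_def by (simp only:)
qed

lemma sum_Basis_vec3: "(\<Sum>i\<in>Basis. h i) = h (axis 1 1) + h (axis 2 1) + h (axis 3 (1::real) :: real^3)"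
proof -
  have B: "(Basis :: (real^3) set) = {axis 1 1, axis 2 1, axis 3 1}"
    by (auto simp: Basis_vec_def UNIV_3)
  show ?thesis unfolding B by (simp add: axis_eq_axis add.assoc)
qed

lemma potential_gradient:
  assumes "0 < b" "branch_pair b S \<tau> \<sigma>" "x \<in> S"
  shows "gradient (\<lambda>x. potential b x (\<tau> x) (\<sigma> x)) x =
     vector [-2 * arsinh (\<tau> x / sqrt b), 2 * x$2 * \<tau> x / (b * sqrt (b + (\<tau> x)\<^sup>2)),
       -2 * \<sigma> x * sqrt (b + (\<tau> x)\<^sup>2) / b]"
  unfolding gradient_def sum_Basis_vec3 vector3_sum
    frechet_derivative_at_eq[OF potential_derivative[OF assms]]
  by (simp add: axis_def)

text \<open>With \<open>q = y/R\<^sup>2\<close> everything becomes a multiple of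
  \<open>b + J + q\<^sup>2R\<^sup>2 - t\<^sup>2q\<^sup>2 - (1 + q\<^sup>2)R\<^sup>2 - s\<^sup>2\<close>, which is zero by the formulas for \<open>J\<close> and \<open>R\<close>.\<close>
lemma laplacian_identity:
  fixes b R t s x y J :: real
  assumes "0 < b" "0 < R" "R\<^sup>2 = b + t\<^sup>2" "J = s\<^sup>2 + t\<^sup>2 * (1 + y\<^sup>2 / (R\<^sup>2)\<^sup>2)" "0 < J"
  shows "-2 * ((- t / J) / R) + (2 * (t + y * (t * (y / R\<^sup>2) / J)) / (b * R)
       - 2 * y * t * (t * (t * (y / R\<^sup>2) / J) / R) / (b * R\<^sup>2))
    - 2 * ((t * (1 + y\<^sup>2 / (R\<^sup>2)\<^sup>2) / J) * R + s * (t * (s / J) / R)) / b = 0" (is "?lhs = 0")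
proof -
  define q where "q = y / R\<^sup>2"
  have y: "y = q * R\<^sup>2" using assms(2) by (simp add: q_def)
  have q: "y\<^sup>2 / (R\<^sup>2)\<^sup>2 = q\<^sup>2" by (simp add: q_def power_divide)
  have "?lhs = (2 * t / (J * b * R)) * (b + J + q\<^sup>2 * R\<^sup>2 - t\<^sup>2 * q\<^sup>2 - (1 + q\<^sup>2) * R\<^sup>2 - s\<^sup>2)"
    unfolding q q_def[symmetric] unfolding y using assms(1,2,5)
    by (simp add: field_simps power2_eq_square)
  also have "b + J + q\<^sup>2 * R\<^sup>2 - t\<^sup>2 * q\<^sup>2 - (1 + q\<^sup>2) * R\<^sup>2 - s\<^sup>2 = 0"
    unfolding assms(4) q unfolding assms(3) by (simp add: algebra_simps)
  finally show ?thesis by simp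
qed

lemma potential_laplacian:
  assumes "0 < b" "branch_pair b S \<tau> \<sigma>" "x \<in> S"
  shows "laplacian (\<lambda>x. potential b x (\<tau> x) (\<sigma> x)) x = 0"
proof -
  define F where "F = (\<lambda>x. potential b x (\<tau> x) (\<sigma> x))"
  define \<tau>' where "\<tau>' = frechet_derivative \<tau> (at x)"
  define \<sigma>' where "\<sigma>' = frechet_derivative \<sigma> (at x)"
  define R where "R = sqrt (b + (\<tau> x)\<^sup>2)"
  define J where "J = jac b (x$2) (\<tau> x) (\<sigma> x)"
  have S: "open S" using assms(2) by (simp add: branch_pair_def)
  have t: "(\<tau> has_derivative \<tau>') (at x)" and s: "(\<sigma> has_derivative \<sigma>') (at x)"
    unfolding \<tau>'_def \<sigma>'_def by (rule branch_pair_derivative[OF assms])+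
  have pos: "b + (\<tau> x)\<^sup>2 > 0" using assms(1) by (simp add: add_pos_nonneg)
  have R: "0 < R" "R\<^sup>2 = b + (\<tau> x)\<^sup>2" using pos by (simp_all add: R_def)
  have J: "J = (\<sigma> x)\<^sup>2 + (\<tau> x)\<^sup>2 * (1 + (x$2)\<^sup>2 / (R\<^sup>2)\<^sup>2)" by (simp add: J_def jac_def R(2))
  have Jpos: "0 < J" unfolding J_def by (rule jac_pos[OF assms(1) branch_pair_nonzero[OF assms]])
  note tv = branch_pair_derivative(4)[OF assms, folded \<tau>'_def J_def R(2)]
  note sv = branch_pair_derivative(5)[OF assms, folded \<sigma>'_def J_def R(2)]
  note root = branch_pair_root_derivative[OF assms(1) t, folded R_def]
  have D: "frechet_derivative F (at y) v = v$1 * (-2 * arsinh (\<tau> y / sqrt b))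
      + v$2 * (2 * y$2 * (\<tau> y / sqrt (b + (\<tau> y)\<^sup>2)) / b)
      + v$3 * (-2 * \<sigma> y * sqrt (b + (\<tau> y)\<^sup>2) / b)" if "y \<in> S" for y v
    using frechet_derivative_at_eq[OF potential_derivative[OF assms(1,2) that]]
    by (simp add: F_def mult.commute[of b])
  have second: "frechet_derivative (\<lambda>y. frechet_derivative F (at y) v) (at x) v = G' v"
    if "(G has_derivative G') (at x)" and "\<And>y. y \<in> S \<Longrightarrow> frechet_derivative F (at y) v = G y" for v G G'
    by (rule frechet_derivative_at_eq, rule has_derivative_transform_within_open[OF that(1) S assms(3)])
       (use that(2) in auto)
  have 1: "frechet_derivative (\<lambda>y. frechet_derivative F (at y) (axis 1 1)) (at x) (axis 1 1)
      = -2 * (\<tau>' (axis 1 1) / R)"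
    by (rule second[OF has_derivative_mult_right[OF root(2)]]) (simp add: D axis_def)
  have 2: "frechet_derivative (\<lambda>y. frechet_derivative F (at y) (axis 2 1)) (at x) (axis 2 1)
      = (2 * x$2 * (\<tau>' (axis 2 1) / R - \<tau> x * (\<tau> x * \<tau>' (axis 2 1) / R) / R\<^sup>2)
        + 2 * (axis 2 1 :: real^3) $ 2 * (\<tau> x / R)) / b"
    unfolding R_def
    by (rule second[OF has_derivative_divide_const[OF has_derivative_mult[OF has_derivative_mult_right[OF vec_nth_has_derivative]
          root(3)[unfolded R_def]]]]) (simp add: D axis_def)
  have 3: "frechet_derivative (\<lambda>y. frechet_derivative F (at y) (axis 3 1)) (at x) (axis 3 1)
      = (-2 * \<sigma> x * (\<tau> x * \<tau>' (axis 3 1) / R) + -2 * \<sigma>' (axis 3 1) * R) / b"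
    unfolding R_def
    by (rule second[OF has_derivative_divide_const[OF has_derivative_mult[OF has_derivative_mult_right[OF s]
          root(1)[unfolded R_def]]]]) (simp add: D axis_def)
  have v: "\<tau>' (axis 1 1) = - \<tau> x / J" "\<tau>' (axis 2 1) = \<tau> x * (x$2 / R\<^sup>2) / J"
      "\<tau>' (axis 3 1) = \<sigma> x / J" "\<sigma>' (axis 3 1) = \<tau> x * (1 + (x$2)\<^sup>2 / (R\<^sup>2)\<^sup>2) / J"
    unfolding tv sv by (simp_all add: axis_def)
  show ?thesis
    using laplacian_identity[OF assms(1) R J Jpos]
    unfolding laplacian_def sum_Basis_vec3 F_def[symmetric] 1 2 3 v
    by (simp add: axis_def add_divide_distrib diff_divide_distrib algebra_simps)
qed

section \<open>The two branches\<close>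

text \<open>Positive outside the parabola in its plane, negative inside.\<close>
definition parabola_defect :: "real \<Rightarrow> real^3 \<Rightarrow> real" where
  "parabola_defect b x = (x$2)\<^sup>2 / b - 2 * x$1"

text \<open>The complement of the closed region of the plane inside the parabola: here the confocal
  parameter is positive.\<close>
definition outer_domain :: "real \<Rightarrow> (real^3) set" where
  "outer_domain b = {x. x$3 \<noteq> 0 \<or> 0 < parabola_defect b x}"

definition inner_domain :: "real \<Rightarrow> (real^3) set" where
  "inner_domain b = {x. x$3 \<noteq> 0 \<or> parabola_defect b x < 0}"

lemma continuous_on_parabola_defect [continuous_intros]: "continuous_on S (parabola_defect b)"
  unfolding parabola_defect_def divide_inverse by (intro continuous_intros)

lemma open_domains: "open (outer_domain b)" "open (inner_domain b)"
proof -
  have "open ({x::real^3. x$3 \<noteq> 0} \<union> {x. 0 < parabola_defect b x})"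
    "open ({x::real^3. x$3 \<noteq> 0} \<union> {x. parabola_defect b x < 0})"
    by (intro open_Un open_Collect_neq open_Collect_less continuous_intros)+
  then show "open (outer_domain b)" "open (inner_domain b)"
    unfolding outer_domain_def inner_domain_def by (simp_all only: Collect_disj_eq)
qed

lemma parabola_iff: "0 < b \<Longrightarrow> x \<in> parabola b \<longleftrightarrow> x$3 = 0 \<and> parabola_defect b x = 0"
  by (auto simp: parabola_def parabola_defect_def field_simps)

lemma domains_Un: "0 < b \<Longrightarrow> outer_domain b \<union> inner_domain b = - parabola b"
  by (auto simp: outer_domain_def inner_domain_def parabola_iff)

lemma domains_Int: "outer_domain b \<inter> inner_domain b = {x. x$3 \<noteq> 0}"
  by (auto simp: outer_domain_def inner_domain_def)

text \<open>At a zero of \<open>N\<close> the product rule requires only continuity of the other factor.\<close>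
lemma has_derivative_mult_vanishing:
  fixes N c :: "'a::real_normed_vector \<Rightarrow> real"
  assumes N: "(N has_derivative D) (at x)" "N x = 0" and c: "isCont c x"
  shows "((\<lambda>y. N y * c y) has_derivative (\<lambda>v. D v * c x)) (at x)"
proof -
  have lin: "bounded_linear D" by (rule has_derivative_bounded_linear[OF N(1)])
  have lim: "(\<lambda>y. (N y - N x - D (y - x)) /\<^sub>R norm (y - x)) \<midarrow>x\<rightarrow> 0"
    using N(1) unfolding has_derivative_at_within by auto
  have c': "c \<midarrow>x\<rightarrow> c x" using c by (simp add: isCont_def)
  obtain K where K: "\<And>v. norm (D v) \<le> norm v * K" using bounded_linear.bounded[OF lin] by blast
  have "(\<lambda>y. ((N y - N x - D (y - x)) /\<^sub>R norm (y - x)) * c y) \<midarrow>x\<rightarrow> 0 * c x"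
    by (intro tendsto_mult lim c')
  moreover have "(\<lambda>y. (D (y - x) /\<^sub>R norm (y - x)) * (c y - c x)) \<midarrow>x\<rightarrow> 0"
  proof (rule Lim_null_comparison)
    show "\<forall>\<^sub>F y in at x. norm ((D (y - x) /\<^sub>R norm (y - x)) * (c y - c x)) \<le> \<bar>K\<bar> * \<bar>c y - c x\<bar>"
    proof (rule always_eventually, rule allI)
      fix y
      have "norm (D (y - x) /\<^sub>R norm (y - x)) \<le> \<bar>K\<bar>"
        using K[of "y - x"] by (auto simp: divide_simps mult.commute intro: order_trans mult_left_mono)
      then show "norm ((D (y - x) /\<^sub>R norm (y - x)) * (c y - c x)) \<le> \<bar>K\<bar> * \<bar>c y - c x\<bar>"
        unfolding real_norm_def abs_mult by (intro mult_right_mono) auto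
    qed
    show "(\<lambda>y. \<bar>K\<bar> * \<bar>c y - c x\<bar>) \<midarrow>x\<rightarrow> 0"
      by (rule tendsto_eq_intros c' refl | simp)+
  qed
  ultimately have "(\<lambda>y. ((N y - N x - D (y - x)) /\<^sub>R norm (y - x)) * c y
      + (D (y - x) /\<^sub>R norm (y - x)) * (c y - c x)) \<midarrow>x\<rightarrow> 0"
    using tendsto_add by fastforce
  then have "(\<lambda>y. (N y * c y - N x * c x - D (y - x) * c x) /\<^sub>R norm (y - x)) \<midarrow>x\<rightarrow> 0"
    by (simp add: N(2) algebra_simps)
  then show ?thesis
    unfolding has_derivative_at_within using lin by (auto intro: bounded_linear_mult_left[THEN bounded_linear_compose] )
qed

text \<open>A form of the implicit function theorem for an equation \<open>G(y, u(y)) = 0\<close> whose difference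
  quotient in the second argument is, up to sign, an explicitly known \<open>a \<ge> 1\<close>; \<open>N(y)\<close> stands for \<open>G(y, u(x))\<close>. The
  lower bound gives continuity of \<open>u\<close>, hence of \<open>a\<close>, and then \<open>u = u(x) + N/a\<close> is differentiable.\<close>
lemma implicit_function_differentiable:
  fixes N u a :: "'a::real_normed_vector \<Rightarrow> real"
  assumes "open S" "x \<in> S" and N: "N differentiable (at x)" "N x = 0"
    and eq: "\<And>y. y \<in> S \<Longrightarrow> N y = (u y - u x) * a y"
    and a: "\<And>y. y \<in> S \<Longrightarrow> 1 \<le> a y" and cont: "isCont u x \<Longrightarrow> isCont a x"
  shows "u differentiable (at x)"
proof -
  obtain D where D: "(N has_derivative D) (at x)" using N(1) differentiable_def by blast
  have ev: "\<forall>\<^sub>F y in at x. y \<in> S" using assms(1,2) eventually_at_topological by blast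
  have Nlim: "(\<lambda>y. \<bar>N y\<bar>) \<midarrow>x\<rightarrow> 0"
    using has_derivative_continuous[OF D] N(2) by (auto simp: isCont_def intro: tendsto_rabs_zero)
  have "isCont u x"
    unfolding isCont_def
  proof (rule LIM_zero_cancel, rule Lim_null_comparison[OF _ Nlim])
    show "\<forall>\<^sub>F y in at x. norm (u y - u x) \<le> \<bar>N y\<bar>"
      using ev
    proof eventually_elim
      case (elim y)
      have "\<bar>u y - u x\<bar> * 1 \<le> \<bar>u y - u x\<bar> * a y" by (rule mult_left_mono[OF a[OF elim]]) simp
      then show ?case using a[OF elim] by (simp add: eq[OF elim] abs_mult)
    qed
  qed
  then have "isCont (\<lambda>y. inverse (a y)) x"
    using cont a[OF assms(2)] by (intro continuous_intros) auto
  from has_derivative_mult_vanishing[OF D N(2) this]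
  have "((\<lambda>y. N y * inverse (a y) + u x) has_derivative (\<lambda>v. D v * inverse (a x) + 0)) (at x)"
    by (intro has_derivative_add has_derivative_const)
  then have "(u has_derivative (\<lambda>v. D v * inverse (a x) + 0)) (at x)"
  proof (rule has_derivative_transform_within_open[OF _ assms(1,2)])
    fix y assume y: "y \<in> S"
    have "a y \<noteq> 0" using a[OF y] by auto
    then show "N y * inverse (a y) + u x = u y" by (simp add: eq[OF y] mult.assoc)
  qed
  then show ?thesis by (rule differentiableI)
qed

text \<open>The confocal family \<open>Q(x,s)\<close>.\<close>
definition outer_eqn :: "real \<Rightarrow> real^3 \<Rightarrow> real \<Rightarrow> real" where
  "outer_eqn b x s = (x$2)\<^sup>2 / (b + s) + (x$3)\<^sup>2 / s - 2 * x$1 - s"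

text \<open>The same equation after the substitution \<open>s = x\<^sub>3\<^sup>2/m\<close>, written so that it makes sense for
  \<open>x\<^sub>3 = 0\<close>: on the second chart it is \<open>m = \<sigma>\<^sup>2\<close> that stays positive.\<close>
definition inner_eqn :: "real \<Rightarrow> real^3 \<Rightarrow> real \<Rightarrow> real" where
  "inner_eqn b x m = m + parabola_defect b x - (x$3)\<^sup>2 / m - (x$3)\<^sup>2 * (x$2)\<^sup>2 / (b * (b * m + (x$3)\<^sup>2))"

text \<open>The coefficient is at least \<open>1\<close>: the equation is strictly decreasing in \<open>s\<close>, which gives
  the lower bound that the implicit function theorem above requires.\<close>
lemma outer_eqn_diff:
  assumes "0 < b" "0 < s" "0 < s'"
  shows "outer_eqn b x s - outer_eqn b x s' =
    (s' - s) * (1 + (x$2)\<^sup>2 / ((b + s) * (b + s')) + (x$3)\<^sup>2 / (s * s'))"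
proof -
  have "b + s \<noteq> 0" "b + s' \<noteq> 0" using assms by auto
  then have "(x$2)\<^sup>2 / (b + s) - (x$2)\<^sup>2 / (b + s') = (s' - s) * ((x$2)\<^sup>2 / ((b + s) * (b + s')))"
    by (simp add: field_simps)
  moreover have "(x$3)\<^sup>2 / s - (x$3)\<^sup>2 / s' = (s' - s) * ((x$3)\<^sup>2 / (s * s'))"
    using assms by (simp add: field_simps)
  ultimately show ?thesis unfolding outer_eqn_def by (simp add: distrib_left)
qed

lemma inner_eqn_diff:
  assumes "0 < b" "0 < m" "0 < m'"
  shows "inner_eqn b x m' - inner_eqn b x m =
    (m' - m) * (1 + (x$3)\<^sup>2 / (m * m') + (x$3)\<^sup>2 * (x$2)\<^sup>2 / ((b * m + (x$3)\<^sup>2) * (b * m' + (x$3)\<^sup>2)))"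
proof -
  have pos: "b * m + (x$3)\<^sup>2 > 0" "b * m' + (x$3)\<^sup>2 > 0" using assms by (auto simp: add_pos_nonneg)
  define p p' where "p = b * m + (x$3)\<^sup>2" and "p' = b * m' + (x$3)\<^sup>2"
  have p: "p > 0" "p' > 0" "p' - p = b * (m' - m)" using pos by (simp_all add: p_def p'_def algebra_simps)
  have "1 / (b * p) - 1 / (b * p') = (p' - p) / (b * p * p')"
    using assms(1) p by (simp add: field_simps)
  also have "\<dots> = (m' - m) / (p * p')" unfolding p(3) using assms(1) by simp
  finally have "(x$3)\<^sup>2 * (x$2)\<^sup>2 * (1 / (b * p) - 1 / (b * p')) = (x$3)\<^sup>2 * (x$2)\<^sup>2 * ((m' - m) / (p * p'))"
    by simp
  then have "(x$3)\<^sup>2 * (x$2)\<^sup>2 / (b * p) - (x$3)\<^sup>2 * (x$2)\<^sup>2 / (b * p') = (m' - m) * ((x$3)\<^sup>2 * (x$2)\<^sup>2 / (p * p'))"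
    by (simp add: algebra_simps)
  moreover have "(x$3)\<^sup>2 / m - (x$3)\<^sup>2 / m' = (m' - m) * ((x$3)\<^sup>2 / (m * m'))"
    using assms by (simp add: field_simps)
  ultimately show ?thesis unfolding inner_eqn_def p_def p'_def by (simp add: distrib_left)
qed

lemma outer_root_exists:
  assumes "0 < b" "x \<in> outer_domain b"
  shows "\<exists>s>0. outer_eqn b x s = 0"
proof -
  \<comment> \<open>For \<open>x\<^sub>3 = 0\<close> a factor \<open>s\<close> splits off from the equation cleared of denominators; the other factor is \<open>P\<close>.\<close>
  define P where "P s = (x$2)\<^sup>2 - (2 * x$1 + s) * (b + s)" for s
  \<comment> \<open>Large enough for the term \<open>- s\<close> to dominate all others.\<close>
  define L where "L = (x$2)\<^sup>2 / b + (x$3)\<^sup>2 + 2 * \<bar>x$1\<bar> + 1"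
  have L1: "L \<ge> 1" using assms(1) by (simp add: L_def)
  have "(x$2)\<^sup>2 / (b + L) \<le> (x$2)\<^sup>2 / b" using assms(1) L1 by (intro divide_left_mono) auto
  moreover have "(x$3)\<^sup>2 / L \<le> (x$3)\<^sup>2" using L1 by (simp add: divide_le_eq mult_le_cancel_left1)
  ultimately have neg: "outer_eqn b x L < 0" unfolding outer_eqn_def L_def[symmetric]
    using L_def by (auto simp: abs_if split: if_splits)
  have mult: "s * (b + s) * outer_eqn b x s = s * P s + (x$3)\<^sup>2 * (b + s)" if "s > 0" for s
  proof -
    define A B where "A = (x$2)\<^sup>2 / (b + s)" and "B = (x$3)\<^sup>2 / s"
    have A: "(x$2)\<^sup>2 = A * (b + s)" and B: "(x$3)\<^sup>2 = B * s"
      using assms(1) that by (auto simp: A_def B_def)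
    have e: "outer_eqn b x s = A + B - 2 * x$1 - s" by (simp add: outer_eqn_def A_def B_def)
    show ?thesis unfolding e P_def A B by (simp add: algebra_simps)
  qed
  have contP: "continuous_on A P" for A unfolding P_def by (intro continuous_intros)
  show ?thesis
  proof (cases "x$3 = 0")
    case True
    then have "0 < (x$2)\<^sup>2 / b - 2 * x$1"
      using assms(2) by (simp add: outer_domain_def parabola_defect_def)
    then have P0: "P 0 > 0" using assms(1) by (simp add: P_def field_simps)
    have "L * (b + L) * outer_eqn b x L < 0" using neg L1 assms(1) by (simp add: mult_pos_neg)
    then have PL: "P L < 0" unfolding mult[OF less_le_trans[OF zero_less_one L1]]
      using L1 True by (simp add: mult_less_0_iff)
    obtain s where s: "0 \<le> s" "s \<le> L" "P s = 0"
      using IVT2'[of P L 0 0] P0 PL L1 contP by auto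
    have "s > 0" using s P0 by (cases "s = 0") auto
    then have "s * (b + s) * outer_eqn b x s = 0" unfolding mult[OF \<open>s > 0\<close>] using s(3) True by simp
    then show ?thesis using \<open>s > 0\<close> assms(1) by auto
  next
    case False
    define H where "H s = s * P s + (x$3)\<^sup>2 * (b + s)" for s
    have H0: "H 0 > 0" using False assms(1) by (simp add: H_def)
    have "L * (b + L) * outer_eqn b x L < 0" using neg L1 assms(1) by (simp add: mult_pos_neg)
    then have HL: "H L < 0" unfolding mult[OF less_le_trans[OF zero_less_one L1]] H_def .
    have "continuous_on {0..L} H" unfolding H_def by (intro continuous_intros contP)
    then obtain s where s: "0 \<le> s" "s \<le> L" "H s = 0"
      using IVT2'[of H L 0 0] H0 HL L1 by auto
    have "s > 0" using s H0 by (cases "s = 0") auto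
    then have "s * (b + s) * outer_eqn b x s = 0" unfolding mult[OF \<open>s > 0\<close>] using s(3) by (simp add: H_def)
    then show ?thesis using \<open>s > 0\<close> assms(1) by auto
  qed
qed

definition outer_root :: "real \<Rightarrow> real^3 \<Rightarrow> real" where
  "outer_root b x = (SOME s. 0 < s \<and> outer_eqn b x s = 0)"

definition inner_root :: "real \<Rightarrow> real^3 \<Rightarrow> real" where
  "inner_root b x = (if x$3 = 0 then - parabola_defect b x else (x$3)\<^sup>2 / outer_root b x)"

lemma outer_root:
  assumes "0 < b" "x \<in> outer_domain b"
  shows "0 < outer_root b x" "outer_eqn b x (outer_root b x) = 0"
  using someI_ex[OF outer_root_exists[OF assms, unfolded Bex_def]] unfolding outer_root_def by auto

lemma inner_root:
  assumes "0 < b" "x \<in> inner_domain b"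
  shows "0 < inner_root b x" "inner_eqn b x (inner_root b x) = 0"
proof -
  have "0 < inner_root b x \<and> inner_eqn b x (inner_root b x) = 0"
  proof (cases "x$3 = 0")
    case True
    then show ?thesis using assms(2) by (simp add: inner_root_def inner_domain_def inner_eqn_def)
  next
    case False
    then have "x \<in> outer_domain b" by (simp add: outer_domain_def)
    note r = outer_root[OF assms(1) this]
    define s where "s = outer_root b x"
    have s: "s > 0" "b + s > 0" using r(1) assms(1) by (auto simp: s_def)
    have "(x$3)\<^sup>2 * (x$2)\<^sup>2 / (b * (b * ((x$3)\<^sup>2 / s) + (x$3)\<^sup>2)) = (x$2)\<^sup>2 * s / (b * (b + s))"
    proof -
      have "b * ((x$3)\<^sup>2 / s) + (x$3)\<^sup>2 = (x$3)\<^sup>2 * ((b + s) / s)" using s by (simp add: field_simps)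
      then show ?thesis using False by simp
    qed
    also have "\<dots> = (x$2)\<^sup>2 / b - (x$2)\<^sup>2 / (b + s)" using assms(1) s by (simp add: field_simps)
    finally have "inner_eqn b x ((x$3)\<^sup>2 / s) = outer_eqn b x s"
      using False by (simp add: inner_eqn_def outer_eqn_def parabola_defect_def)
    then show ?thesis using False r s by (simp add: inner_root_def s_def)
  qed
  then show "0 < inner_root b x" "inner_eqn b x (inner_root b x) = 0" by auto
qed

lemma differentiable_vec_nth: "(\<lambda>x::real^3. x $ i) differentiable (at x)"
  by (rule bounded_linear_imp_differentiable[OF bounded_linear_vec_nth])

lemma outer_root_differentiable:
  assumes "0 < b" "x \<in> outer_domain b"
  shows "outer_root b differentiable (at x)"
proof (rule implicit_function_differentiable[OF open_domains(1) assms(2)])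
  let ?s = "outer_root b"
  let ?a = "\<lambda>y. 1 + (y$2)\<^sup>2 / ((b + ?s x) * (b + ?s y)) + (y$3)\<^sup>2 / (?s x * ?s y)"
  note r = outer_root[OF assms(1)]
  have sx: "?s x \<noteq> 0" "b + ?s x \<noteq> 0" using r(1)[OF assms(2)] assms(1) by auto
  show "(\<lambda>y. outer_eqn b y (?s x)) differentiable (at x)"
    unfolding outer_eqn_def using sx
    by (intro differentiable_diff differentiable_add differentiable_divide differentiable_power
        differentiable_mult differentiable_const differentiable_vec_nth) auto
  show "outer_eqn b x (?s x) = 0" by (rule r(2)[OF assms(2)])
  show "outer_eqn b y (?s x) = (?s y - ?s x) * ?a y" if "y \<in> outer_domain b" for y
    using outer_eqn_diff[OF assms(1) r(1)[OF assms(2)] r(1)[OF that], of y] r(2)[OF that] by simp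
  show "1 \<le> ?a y" if "y \<in> outer_domain b" for y
    using r(1)[OF assms(2)] r(1)[OF that] assms(1) by (simp add: add_nonneg_nonneg)
  show "isCont ?a x" if "isCont ?s x"
    using sx that by (intro continuous_intros) auto
qed

lemma inner_root_differentiable:
  assumes "0 < b" "x \<in> inner_domain b"
  shows "inner_root b differentiable (at x)"
proof (rule implicit_function_differentiable[OF open_domains(2) assms(2)])
  let ?m = "inner_root b"
  let ?a = "\<lambda>y. 1 + (y$3)\<^sup>2 / (?m x * ?m y)
      + (y$3)\<^sup>2 * (y$2)\<^sup>2 / ((b * ?m x + (y$3)\<^sup>2) * (b * ?m y + (y$3)\<^sup>2))"
  note r = inner_root[OF assms(1)]
  have mx: "?m x \<noteq> 0" using r(1)[OF assms(2)] by auto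
  have "0 < b * ?m x + (y$3)\<^sup>2" for y :: "real^3"
    using r(1)[OF assms(2)] assms(1) by (simp add: add_pos_nonneg)
  then have px: "b * ?m x + (y$3)\<^sup>2 \<noteq> 0" for y :: "real^3" by (metis less_irrefl)
  show "(\<lambda>y. - inner_eqn b y (?m x)) differentiable (at x)"
    unfolding inner_eqn_def parabola_defect_def using mx px assms(1)
    by (intro differentiable_minus differentiable_diff differentiable_add differentiable_divide differentiable_power
        differentiable_mult differentiable_const differentiable_vec_nth) auto
  show "- inner_eqn b x (?m x) = 0" by (simp add: r(2)[OF assms(2)])
  show "- inner_eqn b y (?m x) = (?m y - ?m x) * ?a y" if "y \<in> inner_domain b" for y
    using inner_eqn_diff[OF assms(1) r(1)[OF assms(2)] r(1)[OF that], of y] r(2)[OF that] by simp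
  show "1 \<le> ?a y" if "y \<in> inner_domain b" for y
    using r(1)[OF assms(2)] r(1)[OF that] assms(1) by (simp add: add_nonneg_nonneg)
  show "isCont ?a x" if "isCont ?m x"
    using mx that px by (intro continuous_intros) auto
qed

text \<open>Index \<open>0\<close> is the branch with \<open>\<tau> > 0\<close>; every other index stands for the branch with \<open>\<sigma> > 0\<close>.\<close>
definition branch_tau :: "real \<Rightarrow> nat \<Rightarrow> real^3 \<Rightarrow> real" where
  "branch_tau b i x = (if i = 0 then sqrt (outer_root b x) else x$3 / sqrt (inner_root b x))"

definition branch_sigma :: "real \<Rightarrow> nat \<Rightarrow> real^3 \<Rightarrow> real" where
  "branch_sigma b i x = (if i = 0 then x$3 / sqrt (outer_root b x) else sqrt (inner_root b x))"

definition chart :: "real \<Rightarrow> nat \<Rightarrow> (real^3) set" where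
  "chart b i = (if i = 0 then outer_domain b else inner_domain b)"

text \<open>The two branches agree where \<open>x\<^sub>3 > 0\<close> and are opposite where \<open>x\<^sub>3 < 0\<close>.\<close>
definition transition :: "nat \<Rightarrow> nat \<Rightarrow> real^3 \<Rightarrow> real" where
  "transition i j x = (if (i = 0) = (j = 0) then 1 else sgn (x$3))"

lemma sqrt_differentiable:
  fixes f :: "'a::real_normed_vector \<Rightarrow> real"
  assumes "f differentiable (at x)" "0 < f x"
  shows "(\<lambda>x. sqrt (f x)) differentiable (at x)"
proof -
  obtain D where "(f has_derivative D) (at x)" using assms(1) differentiable_def by blast
  from has_derivative_real_sqrt[OF assms(2) this] show ?thesis by (rule differentiableI)
qed

lemma branch_pair_chart:
  assumes "0 < b"
  shows "branch_pair b (chart b i) (branch_tau b i) (branch_sigma b i)"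
proof (cases "i = 0")
  case True
  have "branch_tau b i x * branch_sigma b i x = x$3 \<and>
        (branch_sigma b i x)\<^sup>2 + (x$2)\<^sup>2 / (b + (branch_tau b i x)\<^sup>2) - 2 * x$1 - (branch_tau b i x)\<^sup>2 = 0 \<and>
        branch_tau b i differentiable (at x) \<and> branch_sigma b i differentiable (at x)"
    if x: "x \<in> outer_domain b" for x
  proof (intro conjI)
    have r: "0 < outer_root b x" "outer_eqn b x (outer_root b x) = 0" by (rule outer_root[OF assms x])+
    show "branch_tau b i x * branch_sigma b i x = x$3"
      using r True by (simp add: branch_tau_def branch_sigma_def)
    show "(branch_sigma b i x)\<^sup>2 + (x$2)\<^sup>2 / (b + (branch_tau b i x)\<^sup>2) - 2 * x$1 - (branch_tau b i x)\<^sup>2 = 0"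
      using r True by (simp add: branch_tau_def branch_sigma_def power_divide outer_eqn_def)
    have d: "(\<lambda>x. sqrt (outer_root b x)) differentiable (at x)"
      by (rule sqrt_differentiable[OF outer_root_differentiable[OF assms x] r(1)])
    then show "branch_tau b i differentiable (at x)" using True by (simp add: branch_tau_def[abs_def])
    have "(\<lambda>x. x$3 / sqrt (outer_root b x)) differentiable (at x)"
      using r(1) by (intro differentiable_divide differentiable_vec_nth d) auto
    then show "branch_sigma b i differentiable (at x)" using True by (simp add: branch_sigma_def[abs_def])
  qed
  moreover have "outer_domain b \<inter> parabola b = {}" using domains_Un[OF assms] by blast
  ultimately show ?thesis using True open_domains by (simp add: branch_pair_def chart_def)
next
  case False
  have "branch_tau b i x * branch_sigma b i x = x$3 \<and>
        (branch_sigma b i x)\<^sup>2 + (x$2)\<^sup>2 / (b + (branch_tau b i x)\<^sup>2) - 2 * x$1 - (branch_tau b i x)\<^sup>2 = 0 \<and>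
        branch_tau b i differentiable (at x) \<and> branch_sigma b i differentiable (at x)"
    if x: "x \<in> inner_domain b" for x
  proof (intro conjI)
    define m where "m = inner_root b x"
    have r: "0 < m" "inner_eqn b x m = 0" unfolding m_def by (rule inner_root[OF assms x])+
    show "branch_tau b i x * branch_sigma b i x = x$3"
      using r(1) False by (simp add: branch_tau_def branch_sigma_def m_def)
    \<comment> \<open>This turns the equation for \<open>m\<close> back into that of the confocal family.\<close>
    have "(x$2)\<^sup>2 / (b + (x$3)\<^sup>2 / m) = (x$2)\<^sup>2 / b - (x$3)\<^sup>2 * (x$2)\<^sup>2 / (b * (b * m + (x$3)\<^sup>2))"
    proof -
      have p: "b * m + (x$3)\<^sup>2 > 0" using r(1) assms by (simp add: add_pos_nonneg)
      have "b + (x$3)\<^sup>2 / m = (b * m + (x$3)\<^sup>2) / m" using r(1) by (simp add: field_simps)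
      moreover have "(x$2)\<^sup>2 / b - (x$3)\<^sup>2 * (x$2)\<^sup>2 / (b * (b * m + (x$3)\<^sup>2)) = (x$2)\<^sup>2 * m / (b * m + (x$3)\<^sup>2)"
        using p assms by (simp add: divide_simps) (simp add: algebra_simps)
      ultimately show ?thesis by simp
    qed
    then show "(branch_sigma b i x)\<^sup>2 + (x$2)\<^sup>2 / (b + (branch_tau b i x)\<^sup>2) - 2 * x$1 - (branch_tau b i x)\<^sup>2 = 0"
      using r False
      by (simp add: branch_tau_def branch_sigma_def power_divide inner_eqn_def parabola_defect_def m_def)
    have d: "(\<lambda>x. sqrt (inner_root b x)) differentiable (at x)"
      by (rule sqrt_differentiable[OF inner_root_differentiable[OF assms x] r(1)[unfolded m_def]])
    then show "branch_sigma b i differentiable (at x)" using False by (simp add: branch_sigma_def[abs_def])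
    have "(\<lambda>x. x$3 / sqrt (inner_root b x)) differentiable (at x)"
      using r(1) by (intro differentiable_divide differentiable_vec_nth d) (auto simp: m_def)
    then show "branch_tau b i differentiable (at x)" using False by (simp add: branch_tau_def[abs_def])
  qed
  moreover have "inner_domain b \<inter> parabola b = {}" using domains_Un[OF assms] by blast
  ultimately show ?thesis using False open_domains by (simp add: branch_pair_def chart_def)
qed

lemma branch_transition:
  assumes "0 < b" "x \<in> chart b i \<inter> chart b j"
  shows "branch_tau b i x = transition i j x * branch_tau b j x"
    and "branch_sigma b i x = transition i j x * branch_sigma b j x"
proof -
  have "branch_tau b i x = transition i j x * branch_tau b j x \<and>
    branch_sigma b i x = transition i j x * branch_sigma b j x"
  proof (cases "(i = 0) = (j = 0)")
    case True
    then show ?thesis by (auto simp: branch_tau_def branch_sigma_def transition_def)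
  next
    case False
    then have x3: "x$3 \<noteq> 0" using assms(2) domains_Int by (auto simp: chart_def split: if_splits)
    then have "0 < outer_root b x" using outer_root[OF assms(1)] by (simp add: outer_domain_def)
    then have q: "sqrt (inner_root b x) = \<bar>x$3\<bar> / sqrt (outer_root b x)" and p: "0 < sqrt (outer_root b x)"
      using x3 by (simp_all add: inner_root_def real_sqrt_divide)
    show ?thesis
      using False x3 p unfolding branch_tau_def branch_sigma_def transition_def q
      by (auto simp: sgn_if field_simps abs_if)
  qed
  then show "branch_tau b i x = transition i j x * branch_tau b j x"
    "branch_sigma b i x = transition i j x * branch_sigma b j x" by auto
qed

lemma flat_line_bundle_chart:
  assumes "0 < b"
  shows "flat_line_bundle (- parabola b) (chart b) transition"
  unfolding flat_line_bundle_def
proof (intro conjI allI ballI)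
  show "open (chart b i)" for i using open_domains by (simp add: chart_def)
  have "(\<Union>i. chart b i) = chart b 0 \<union> chart b 1" unfolding chart_def by (auto split: if_splits)
  then show "(\<Union>i. chart b i) = - parabola b" using domains_Un[OF assms] by (simp add: chart_def)
  fix i j k :: nat
  have x3: "x$3 \<noteq> 0" if "x \<in> chart b i \<inter> chart b j" "(i = 0) \<noteq> (j = 0)" for x
    using that domains_Int by (auto simp: chart_def split: if_splits)
  show "transition i j ` (chart b i \<inter> chart b j) \<subseteq> {1, - 1}"
    using x3 by (auto simp: transition_def sgn_if)
  show "continuous_on (chart b i \<inter> chart b j) (transition i j)"
  proof (cases "(i = 0) = (j = 0)")
    case True
    then show ?thesis by (simp add: transition_def[abs_def])
  next
    case False
    have "continuous_on (chart b i \<inter> chart b j) (\<lambda>x. sgn (x$3))"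
      using x3[OF _ False] by (intro continuous_intros ballI)
    moreover have "transition i j = (\<lambda>x. sgn (x$3))" using False by (auto simp: transition_def)
    ultimately show ?thesis by simp
  qed
  fix x assume x: "x \<in> chart b i \<inter> chart b j \<inter> chart b k"
  show "transition i j x * transition j k x = transition i k x"
  proof (cases "(i = 0) = (j = 0) \<and> (j = 0) = (k = 0)")
    case False
    then have "x$3 \<noteq> 0" using x domains_Int by (auto simp: chart_def split: if_splits)
    then show ?thesis by (auto simp: transition_def sgn_if)
  qed (auto simp: transition_def)
qed

section \<open>Sections and local square integrability\<close>

lemma potential_uminus: "potential b x (- t) (- s) = - potential b x t s"
  by (simp add: potential_def arsinh_minus_real minus_divide_left[symmetric])

lemma transition_cases: "x \<in> chart b i \<inter> chart b j \<Longrightarrow> transition i j x = 1 \<or> transition i j x = -1"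
  using domains_Int by (auto simp: transition_def chart_def sgn_if split: if_splits)

definition pot_section :: "real \<Rightarrow> nat \<Rightarrow> real^3 \<Rightarrow> real" where
  "pot_section b i x = potential b x (branch_tau b i x) (branch_sigma b i x)"

definition grad_potential :: "real \<Rightarrow> real^3 \<Rightarrow> real \<Rightarrow> real \<Rightarrow> real^3" where
  "grad_potential b x t s = vector [-2 * arsinh (t / sqrt b), 2 * x$2 * t / (b * sqrt (b + t\<^sup>2)),
       -2 * s * sqrt (b + t\<^sup>2) / b]"

lemma grad_potential_uminus: "grad_potential b x (- t) (- s) = - grad_potential b x t s"
  by (simp add: grad_potential_def arsinh_minus_real vector3_sum minus_divide_left[symmetric])

lemma gradient_pot_section:
  assumes "0 < b" "x \<in> chart b i"
  shows "gradient (pot_section b i) x = grad_potential b x (branch_tau b i x) (branch_sigma b i x)"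
  unfolding pot_section_def[abs_def] grad_potential_def
  by (rule potential_gradient[OF assms(1) branch_pair_chart[OF assms(1)] assms(2)])

text \<open>The pair \<open>(\<tau>,\<sigma>)\<close> is itself a section of the bundle tensored with the plane, so
  odd functions of it are sections.\<close>
lemma odd_function_bundle_section:
  assumes "0 < b" and odd: "\<And>x t s. \<Phi> x (- t) (- s) = - (\<Phi> x t s)"
    and f: "\<And>i x. x \<in> chart b i \<Longrightarrow> f i x = \<Phi> x (branch_tau b i x) (branch_sigma b i x)"
  shows "bundle_section (chart b) transition (- parabola b) f"
  unfolding bundle_section_def
proof (intro allI ballI)
  fix i j x assume "x \<in> chart b i \<inter> chart b j \<inter> - parabola b"
  then have x: "x \<in> chart b i \<inter> chart b j" by blast
  show "f i x = transition i j x *\<^sub>R f j x"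
    using transition_cases[OF x] x branch_transition[OF assms(1) x] odd by (auto simp: f)
qed

text \<open>If \<open>\<tau>\<^sup>2 > 1\<close> then \<open>\<sigma>\<^sup>2 \<le> x\<^sub>3\<^sup>2\<close> by the first equation, and the second bounds \<open>\<tau>\<^sup>2\<close>.\<close>
lemma branch_bounds:
  assumes "0 < b" "branch_pair b S \<tau> \<sigma>" "x \<in> S"
  shows "(\<tau> x)\<^sup>2 \<le> 1 + (x$3)\<^sup>2 + (x$2)\<^sup>2 / b + 2 * \<bar>x$1\<bar>"
    and "(\<sigma> x)\<^sup>2 \<le> 2 * \<bar>x$1\<bar> + (\<tau> x)\<^sup>2"
proof -
  have E: "\<tau> x * \<sigma> x = x$3" "(\<sigma> x)\<^sup>2 + (x$2)\<^sup>2 / (b + (\<tau> x)\<^sup>2) - 2 * x$1 - (\<tau> x)\<^sup>2 = 0"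
    using assms(2,3) by (auto simp: branch_pair_def)
  have 1: "0 \<le> (x$2)\<^sup>2 / (b + (\<tau> x)\<^sup>2)" using assms(1) by (simp add: add_nonneg_nonneg)
  have 2: "(x$2)\<^sup>2 / (b + (\<tau> x)\<^sup>2) \<le> (x$2)\<^sup>2 / b"
    using assms(1) by (intro divide_left_mono) (auto simp: add_pos_nonneg)
  show "(\<sigma> x)\<^sup>2 \<le> 2 * \<bar>x$1\<bar> + (\<tau> x)\<^sup>2" using 1 E(2) by linarith
  show "(\<tau> x)\<^sup>2 \<le> 1 + (x$3)\<^sup>2 + (x$2)\<^sup>2 / b + 2 * \<bar>x$1\<bar>"
  proof (cases "(\<tau> x)\<^sup>2 \<le> 1")
    case True
    then show ?thesis using 1 2 by (smt (verit) zero_le_power2)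
  next
    case False
    then have "1 * (\<sigma> x)\<^sup>2 \<le> (\<tau> x)\<^sup>2 * (\<sigma> x)\<^sup>2" by (intro mult_right_mono) auto
    then have "(\<sigma> x)\<^sup>2 \<le> (x$3)\<^sup>2" by (simp add: E(1)[symmetric] power_mult_distrib)
    then show ?thesis using 2 E(2) by linarith
  qed
qed

lemma branch_locally_bounded:
  assumes "0 < b" "compact K"
  shows "\<exists>C. \<forall>i. \<forall>x\<in>chart b i \<inter> K. \<bar>branch_tau b i x\<bar> \<le> C \<and> \<bar>branch_sigma b i x\<bar> \<le> C"
proof -
  obtain N where N: "\<And>x. x \<in> K \<Longrightarrow> norm x \<le> N"
    using compact_imp_bounded[OF assms(2)] bounded_iff by blast
  define C where "C = 1 + N\<^sup>2 + N\<^sup>2 / b + 4 * N"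
  have "\<bar>branch_tau b i x\<bar> \<le> 1 + C \<and> \<bar>branch_sigma b i x\<bar> \<le> 1 + C" if "x \<in> chart b i \<inter> K" for i x
  proof -
    have x: "\<bar>x$k\<bar> \<le> N" for k using N[of x] that component_le_norm_cart[of x k] by auto
    have sq: "(x$k)\<^sup>2 \<le> N\<^sup>2" for k using power_mono[OF x[of k], of 2] by simp
    have sqb: "(x$2)\<^sup>2 / b \<le> N\<^sup>2 / b" using sq assms(1) by (intro divide_right_mono) auto
    note bd = branch_bounds[OF assms(1) branch_pair_chart[OF assms(1)], of x i]
    have t: "(branch_tau b i x)\<^sup>2 \<le> 1 + N\<^sup>2 + N\<^sup>2 / b + 2 * N"
      using bd(1) that sq[of 3] sqb x[of 1] by auto
    have s: "(branch_sigma b i x)\<^sup>2 \<le> C" using bd(2) that t x[of 1] by (auto simp: C_def)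
    have t': "(branch_tau b i x)\<^sup>2 \<le> C" using t x[of 1] by (auto simp: C_def)
    have "\<bar>u\<bar> \<le> 1 + u\<^sup>2" for u :: real
      using zero_le_power2[of "\<bar>u\<bar> - 1"] zero_le_power2[of u] by (simp add: power2_diff)
    then show ?thesis using s t' by (meson add_left_mono order_trans)
  qed
  then show ?thesis by blast
qed

text \<open>The pointwise norm of a continuous section is a continuous function off \<open>\<Sigma>\<close>, hence
  measurable, and a bounded measurable function on a bounded set is square integrable.\<close>
lemma locally_bounded_section_locally_L2:
  fixes s :: "nat \<Rightarrow> real^3 \<Rightarrow> 'b::{real_normed_vector, second_countable_topology}"
  assumes flat: "flat_line_bundle (- \<Sigma>) U g" and "closed \<Sigma>"
    and sec: "bundle_section U g (- \<Sigma>) s"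
    and cont: "\<And>i. continuous_on (U i) (s i)"
    and bdd: "\<And>K. compact K \<Longrightarrow> \<exists>C. \<forall>i. \<forall>x\<in>U i \<inter> K. norm (s i x) \<le> C"
  shows "locally_L2 \<Sigma> U s"
  unfolding locally_L2_def
proof (intro allI impI)
  fix K :: "(real^3) set" assume K: "compact K"
  let ?h = "section_norm U s"
  have U: "open (U i)" "(\<Union>i. U i) = - \<Sigma>" for i using flat by (auto simp: flat_line_bundle_def)
  have h: "?h x = norm (s i x)" if "x \<in> U i" for i x
  proof (rule section_norm_eq[OF flat sec that])
    show "x \<in> - \<Sigma>" using that U(2) by blast
  qed
  have conth: "continuous_on (- \<Sigma>) ?h"
  proof (rule continuous_at_imp_continuous_on, rule ballI)
    fix x assume "x \<in> - \<Sigma>"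
    then obtain i where i: "x \<in> U i" using U(2) by blast
    have "continuous_on (U i) (\<lambda>y. norm (s i y))" by (intro continuous_on_norm cont)
    then have cy: "isCont (\<lambda>y. norm (s i y)) x"
      using continuous_on_eq_continuous_at[OF U(1)] i by blast
    have ev: "\<forall>\<^sub>F y in nhds x. norm (s i y) = ?h y"
      unfolding eventually_nhds using U(1) i by (intro exI[of _ "U i"]) (simp add: h)
    from cy show "isCont ?h x" by (simp only: isCont_cong[OF ev])
  qed
  obtain C where C: "\<And>i x. x \<in> U i \<inter> K \<Longrightarrow> norm (s i x) \<le> C" using bdd[OF K] by blast
  let ?A = "K - \<Sigma>"
  have A: "?A \<in> sets borel" using K assms(2) by (intro sets.Diff) (auto intro: borel_compact borel_closed)
  have "bounded ?A" using K compact_imp_bounded bounded_subset by blast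
  moreover have AL: "?A \<in> sets lebesgue" using A by simp
  ultimately have fin: "emeasure lebesgue ?A < \<infinity>"
    using bounded_set_imp_lmeasurable fmeasurableD2 by (metis infinity_ennreal_def top.not_eq_extremum)
  have "(\<lambda>x. indicator ?A x *\<^sub>R (?h x)\<^sup>2) \<in> borel_measurable borel"
    by (rule borel_measurable_continuous_on_indicator[OF A])
       (intro continuous_on_power continuous_on_subset[OF conth], auto)
  then have meas: "(\<lambda>x. indicator ?A x *\<^sub>R (?h x)\<^sup>2) \<in> borel_measurable lebesgue"
    by (simp add: measurable_completion)
  show "set_integrable lebesgue ?A (\<lambda>x. (?h x)\<^sup>2)"
    unfolding set_integrable_def
  proof (rule integrableI_bounded_set[OF AL meas fin, of "C\<^sup>2"])
    show "AE x in lebesgue. x \<in> ?A \<longrightarrow> norm (indicator ?A x *\<^sub>R (?h x)\<^sup>2) \<le> C\<^sup>2"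
    proof (rule AE_I2, rule impI)
      fix x assume x: "x \<in> ?A"
      then obtain i where i: "x \<in> U i" using U(2) by blast
      have "?h x \<le> C" using h[OF i] C[of x i] i x by auto
      then show "norm (indicator ?A x *\<^sub>R (?h x)\<^sup>2) \<le> C\<^sup>2"
        using x h[OF i] by (simp add: power_mono)
    qed
  qed (auto intro!: AE_I2)
qed

lemma continuous_on_branch:
  assumes "0 < b"
  shows "continuous_on (chart b i) (branch_tau b i)" "continuous_on (chart b i) (branch_sigma b i)"
  using branch_pair_Ck[OF assms branch_pair_chart[OF assms], of 0] by auto

lemma branch_function_locally_L2:
  fixes \<Phi> :: "real^3 \<Rightarrow> real \<Rightarrow> real \<Rightarrow> 'b::{real_normed_vector, second_countable_topology}"
  assumes "0 < b" "closed (parabola b)" and odd: "\<And>x t s. \<Phi> x (- t) (- s) = - (\<Phi> x t s)"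
    and cont: "continuous_on UNIV (\<lambda>p. \<Phi> (fst p) (fst (snd p)) (snd (snd p)))"
    and f: "\<And>i x. x \<in> chart b i \<Longrightarrow> f i x = \<Phi> x (branch_tau b i x) (branch_sigma b i x)"
  shows "locally_L2 (parabola b) (chart b) f"
proof (rule locally_bounded_section_locally_L2[OF flat_line_bundle_chart[OF assms(1)] assms(2)
      odd_function_bundle_section[OF assms(1) odd f]])
  show "continuous_on (chart b i) (f i)" for i
  proof -
    have "continuous_on (chart b i) (\<lambda>x. (x, branch_tau b i x, branch_sigma b i x))"
      by (intro continuous_intros continuous_on_branch assms(1))
    from continuous_on_compose2[OF cont this] show ?thesis
      by (simp add: f cong: continuous_on_cong)
  qed
  fix K :: "(real^3) set" assume K: "compact K"
  obtain C where C: "\<And>i x. x \<in> chart b i \<inter> K \<Longrightarrow> \<bar>branch_tau b i x\<bar> \<le> C \<and> \<bar>branch_sigma b i x\<bar> \<le> C"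
    using branch_locally_bounded[OF assms(1) K] by blast
  have "compact (K \<times> ({-C..C} \<times> {-C..C}))" using K by (intro compact_Times) auto
  then have "bounded ((\<lambda>p. \<Phi> (fst p) (fst (snd p)) (snd (snd p))) ` (K \<times> ({-C..C} \<times> {-C..C})))"
    by (intro compact_imp_bounded compact_continuous_image continuous_on_subset[OF cont]) auto
  then obtain D where D: "\<And>p. p \<in> K \<times> ({-C..C} \<times> {-C..C}) \<Longrightarrow> norm (\<Phi> (fst p) (fst (snd p)) (snd (snd p))) \<le> D"
    unfolding bounded_iff by blast
  have "norm (f i x) \<le> D" if "x \<in> chart b i \<inter> K" for i x
    using D[of "(x, branch_tau b i x, branch_sigma b i x)"] C[OF that] that f
    by (auto simp: abs_le_iff minus_le_iff)
  then show "\<exists>D. \<forall>i. \<forall>x\<in>chart b i \<inter> K. norm (f i x) \<le> D" by blast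
qed

section \<open>Square roots and monodromy\<close>

text \<open>A square root on the plane slit along the negative (index \<open>0\<close>) or positive (other indices) real axis,
  normalised so that both agree on the upper half-plane.\<close>
definition half_power :: "nat \<Rightarrow> complex \<Rightarrow> complex" where
  "half_power i z = (if i = 0 then csqrt z else \<i> * csqrt (- z))"

lemma half_power_square: "(half_power i z)\<^sup>2 = z"
  by (simp add: half_power_def power_mult_distrib)

lemma half_power_continuous: "continuous_on {z. Im z \<noteq> 0 \<or> (if i = 0 then 0 < Re z else Re z < 0)} (half_power i)"
proof (cases "i = 0")
  case True
  have "continuous_on {z. Im z \<noteq> 0 \<or> 0 < Re z} csqrt"
    by (rule continuous_on_subset[OF continuous_on_csqrt]) (auto simp: complex_nonpos_Reals_iff)
  then show ?thesis using True by (simp add: half_power_def[abs_def])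
next
  case False
  have "continuous_on {z. Im z \<noteq> 0 \<or> Re z < 0} (\<lambda>z. \<i> * csqrt (- z))"
    by (intro continuous_on_mult_left continuous_on_compose2[OF continuous_on_csqrt] continuous_intros)
       (auto simp: complex_nonpos_Reals_iff)
  then show ?thesis using False by (simp add: half_power_def[abs_def])
qed

lemma half_power_transition:
  assumes "(i = 0) = (j = 0) \<or> Im z = x$3 \<and> x$3 \<noteq> 0"
  shows "half_power i z = transition i j x *\<^sub>R half_power j z"
proof -
  have a: "csqrt z = sgn (Im z) *\<^sub>R (\<i> * csqrt (- z))" if "Im z \<noteq> 0"
    using that by (auto simp: complex_eq_iff sgn_if)
  have b: "\<i> * csqrt (- z) = sgn (Im z) *\<^sub>R csqrt z" if "Im z \<noteq> 0"
    using that by (auto simp: complex_eq_iff sgn_if)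
  show ?thesis
  proof (cases "(i = 0) = (j = 0)")
    case False
    then have z: "Im z = x$3" "Im z \<noteq> 0" using assms by auto
    show ?thesis
    proof (cases "i = 0")
      case True
      then show ?thesis using False a[OF z(2)] z(1) by (simp add: half_power_def transition_def)
    next
      case i: False
      then show ?thesis using False b[OF z(2)] z(1) by (simp add: half_power_def transition_def)
    qed
  qed (auto simp: half_power_def transition_def)
qed

text \<open>Such a \<open>D\<close> takes values in the discrete set of multiples of \<open>2\<pi>\<i>\<close>.\<close>
lemma exp_eq_1_loop:
  assumes "continuous_on {0..1::real} D" "\<And>t. t \<in> {0..1} \<Longrightarrow> exp (D t) = (1::complex)"
  shows "D 1 = D 0"
proof -
  have "D constant_on {0..1}"
  proof (rule continuous_discrete_range_constant[OF _ assms(1)])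
    fix x :: real assume x: "x \<in> {0..1}"
    have "2 * pi \<le> norm (D y - D x)" if y: "y \<in> {0..1}" "D y \<noteq> D x" for y
    proof -
      obtain m n :: int where mn: "Re (D x) = 0" "Im (D x) = of_int (2 * m) * pi"
        "Re (D y) = 0" "Im (D y) = of_int (2 * n) * pi"
        using assms(2)[OF x] assms(2)[OF y(1)] by (auto simp: exp_eq_1)
      then have "n \<noteq> m" using y(2) by (auto simp: complex_eq_iff)
      then have "1 \<le> \<bar>real_of_int (n - m)\<bar>" by linarith
      then have "2 * pi * 1 \<le> 2 * pi * \<bar>real_of_int (n - m)\<bar>" by (intro mult_left_mono) auto
      moreover have "Im (D y - D x) = 2 * pi * real_of_int (n - m)" using mn by (simp add: algebra_simps)
      then have "\<bar>Im (D y - D x)\<bar> = 2 * pi * \<bar>real_of_int (n - m)\<bar>" by (simp add: abs_mult)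
      ultimately have "2 * pi \<le> \<bar>Im (D y - D x)\<bar>" by linarith
      then show ?thesis using abs_Im_le_cmod[of "D y - D x"] by simp
    qed
    then show "\<exists>e>0. \<forall>y. y \<in> {0..1} \<and> D y \<noteq> D x \<longrightarrow> e \<le> norm (D y - D x)"
      by (intro exI[of _ "2 * pi"]) auto
  qed auto
  then show ?thesis unfolding constant_on_def by auto
qed

text \<open>The increment of the logarithm of \<open>Z\<close> along a loop is \<open>2\<pi>\<i>\<close> times a winding number and so a
  homotopy invariant: a logarithm exists on the whole parameter square of the homotopy, because
  the square is contractible.\<close>
lemma homotopic_loops_logarithm:
  fixes Z :: "'a::real_normed_vector \<Rightarrow> complex"
  assumes "homotopic_loops S \<gamma>0 \<gamma>1" "continuous_on S Z" "\<And>x. x \<in> S \<Longrightarrow> Z x \<noteq> 0"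
    and l0: "continuous_on {0..1} l0" "\<And>t. t \<in> {0..1} \<Longrightarrow> exp (l0 t) = Z (\<gamma>0 t)"
  shows "\<exists>l1. continuous_on {0..1} l1 \<and> (\<forall>t\<in>{0..1}. exp (l1 t) = Z (\<gamma>1 t)) \<and> l1 1 - l1 0 = l0 1 - l0 0"
proof -
  let ?Q = "{0..1::real} \<times> {0..1::real}"
  obtain h where h: "continuous_on ?Q h" "h ` ?Q \<subseteq> S"
      "\<And>t. t \<in> {0..1} \<Longrightarrow> h (0, t) = \<gamma>0 t" "\<And>t. t \<in> {0..1} \<Longrightarrow> h (1, t) = \<gamma>1 t"
      "\<And>u. u \<in> {0..1} \<Longrightarrow> pathfinish (h \<circ> Pair u) = pathstart (h \<circ> Pair u)"
    using assms(1) unfolding homotopic_loops by blast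
  have Zh: "continuous_on ?Q (\<lambda>p. Z (h p))" by (rule continuous_on_compose2[OF assms(2) h(1,2)])
  have cQ: "contractible ?Q" by (intro convex_imp_contractible convex_Times) auto
  have nz: "Z (h p) \<noteq> 0" if "p \<in> ?Q" for p using assms(3) h(2) that by blast
  have "\<exists>L. continuous_on ?Q L \<and> (\<forall>p\<in>?Q. Z (h p) = exp (L p))"
    by (rule continuous_logarithm_on_contractible[OF Zh cQ]) (use nz in auto)
  then obtain L where L1: "continuous_on ?Q L" and L2: "\<forall>p\<in>?Q. Z (h p) = exp (L p)"
    by (elim exE conjE)
  note L = L1 bspec[OF L2]
  have cl: "continuous_on {0..1} (\<lambda>t. L (f t, g t))"
    if "continuous_on {0..1} f" "continuous_on {0..1} g" "\<And>t. t \<in> {0..1} \<Longrightarrow> (f t, g t) \<in> ?Q" for f g :: "real \<Rightarrow> real"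
    by (rule continuous_on_compose2[OF L(1) continuous_on_Pair[OF that(1,2)]])
       (rule image_subsetI, rule that(3))
  have "L (1, 1) - L (1, 0) = L (0, 1) - L (0, 0)"
  proof (rule exp_eq_1_loop[where D = "\<lambda>u. L (u, 1) - L (u, 0)"])
    show "continuous_on {0..1} (\<lambda>u. L (u, 1) - L (u, 0))"
      by (intro continuous_on_diff cl continuous_intros) auto
    fix u :: real assume u: "u \<in> {0..1}"
    have "h (u, 1) = h (u, 0)" using h(5)[OF u] by (simp add: pathfinish_def pathstart_def)
    then have "exp (L (u, 1)) = exp (L (u, 0))" using L(2)[of "(u, 1)"] L(2)[of "(u, 0)"] u by simp
    then show "exp (L (u, 1) - L (u, 0)) = 1" by (simp add: exp_diff)
  qed
  moreover have "l0 1 - L (0, 1) = l0 0 - L (0, 0)"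
  proof (rule exp_eq_1_loop[where D = "\<lambda>t. l0 t - L (0, t)"])
    show "continuous_on {0..1} (\<lambda>t. l0 t - L (0, t))"
      by (intro continuous_on_diff cl l0 continuous_intros) auto
    show "exp (l0 t - L (0, t)) = 1" if "t \<in> {0..1}" for t
      using that L(2)[of "(0, t)"] l0(2)[OF that] h(3)[OF that] by (simp add: exp_diff)
  qed
  ultimately have A: "L (1, 1) - L (1, 0) = l0 1 - l0 0" by algebra
  have B: "continuous_on {0..1} (\<lambda>t. L (1, t))" by (intro cl continuous_intros) auto
  have C: "exp (L (1, t)) = Z (\<gamma>1 t)" if "t \<in> {0..1}" for t
    using that L(2)[of "(1, t)"] h(4)[OF that] by simp
  show ?thesis by (intro exI[of _ "\<lambda>t. L (1, t)"] conjI ballI A B C)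
qed

text \<open>Dividing a square root \<open>w\<close> of \<open>Z\<close>, as a section, by the square root \<open>exp (l/2)\<close>, as a function
  along the loop, leaves a parallel unit section; it changes sign exactly if \<open>exp (l/2)\<close> does.\<close>
lemma monodromy_from_logarithm:
  fixes w :: "'i \<Rightarrow> 'a::real_normed_vector \<Rightarrow> complex" and l :: "real \<Rightarrow> complex"
  assumes flat: "flat_line_bundle X U g" and sec: "bundle_section U g X w"
    and cont: "\<And>i. continuous_on (U i) (w i)" and sq: "\<And>i x. x \<in> U i \<Longrightarrow> (w i x)\<^sup>2 = Z x"
    and path: "path \<gamma>" "pathfinish \<gamma> = pathstart \<gamma>"
    and l: "continuous_on {0..1} l" "\<And>t. t \<in> {0..1} \<Longrightarrow> exp (l t) = Z (\<gamma> t)"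
    and turn: "exp ((l 1 - l 0) / 2) = -1"
  shows "monodromy U g \<gamma> (-1)"
proof -
  have X: "U i \<subseteq> X" for i using flat by (auto simp: flat_line_bundle_def)
  define v where "v i t = w i (\<gamma> t) / exp (l t / 2)" for i t
  have v: "v i t = 1 \<or> v i t = -1" if "t \<in> {0..1}" "\<gamma> t \<in> U i" for i t
  proof -
    have "(exp (l t / 2))\<^sup>2 = exp (l t)" by (simp add: exp_double[symmetric])
    moreover have "Z (\<gamma> t) \<noteq> 0" unfolding l(2)[OF that(1), symmetric] by simp
    ultimately have "(v i t)\<^sup>2 = 1" using sq[OF that(2)] l(2)[OF that(1)] by (simp add: v_def power_divide)
    then show ?thesis by (simp add: power2_eq_1_iff)
  qed
  show ?thesis
    unfolding monodromy_def
  proof (intro exI[of _ "\<lambda>i t. Re (v i t)"] conjI allI ballI impI)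
    fix i j
    let ?T = "{t \<in> {0..1}. \<gamma> t \<in> U i}"
    have "continuous_on ?T \<gamma>" using path(1) unfolding path_def by (rule continuous_on_subset) auto
    moreover have "continuous_on ?T l" using l(1) by (rule continuous_on_subset) auto
    ultimately show "continuous_on ?T (\<lambda>t. Re (v i t))"
      unfolding v_def by (intro continuous_intros continuous_on_compose2[OF cont]) auto
    show "(\<lambda>t. Re (v i t)) ` ?T \<subseteq> {1, -1}"
    proof (rule image_subsetI)
      fix t assume "t \<in> ?T"
      then show "Re (v i t) \<in> {1, -1}" using v[of t i] by auto
    qed
    show "Re (v i t) = g i j (\<gamma> t) * Re (v j t)" if "t \<in> {0..1}" "\<gamma> t \<in> U i \<inter> U j" for t
    proof -
      have "w i (\<gamma> t) = g i j (\<gamma> t) *\<^sub>R w j (\<gamma> t)"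
        using sec that X unfolding bundle_section_def by blast
      then have "v i t = g i j (\<gamma> t) *\<^sub>R v j t" by (simp add: v_def scaleR_conv_of_real)
      then show ?thesis by simp
    qed
    show "Re (v i 1) = -1 * Re (v i 0)"
    proof -
      have "exp (l 1 / 2) = exp ((l 1 - l 0) / 2) * exp (l 0 / 2)"
        by (simp add: exp_add[symmetric] diff_divide_distrib)
      then have "exp (l 1 / 2) = - exp (l 0 / 2)" using turn by simp
      moreover have "\<gamma> 1 = \<gamma> 0" using path(2) by (simp add: pathfinish_def pathstart_def)
      ultimately show ?thesis by (simp add: v_def)
    qed
  qed
qed

section \<open>The parabola as an oriented submanifold\<close>

definition parabola_point :: "real \<Rightarrow> real \<Rightarrow> real^3" where
  "parabola_point b y = vector [y\<^sup>2 / (2 * b), y, 0]"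

text \<open>The unit normal in the plane of the parabola that points to its outside. With the orientation
  of the parabola it completes to a frame whose third vector is the \<open>x\<^sub>3\<close> direction
  (\<open>tangent_cross_normal\<close>), so that \<open>\<zeta> = Y + \<i> x\<^sub>3\<close>.\<close>
definition parabola_normal :: "real \<Rightarrow> real^3 \<Rightarrow> real^3" where
  "parabola_normal b x = (1 / sqrt ((x$2)\<^sup>2 + b\<^sup>2)) *\<^sub>R vector [- b, x$2, 0]"

lemma parabola_point_nth [simp]:
  "parabola_point b y $ 1 = y\<^sup>2 / (2 * b)" "parabola_point b y $ 2 = y" "parabola_point b y $ 3 = 0"
  by (simp_all add: parabola_point_def)

lemma parabola_eq_range: "0 < b \<Longrightarrow> parabola b = range (parabola_point b)"
  by (auto simp: parabola_def image_iff vec_eq_iff forall_3 field_simps)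

lemma smooth_along_global: "smooth_on UNIV f \<Longrightarrow> smooth_along S f"
  unfolding smooth_along_def by (metis UNIV_I open_UNIV)

lemma closed_parabola: "closed (parabola b)"
  unfolding parabola_def by (intro closed_Collect_conj closed_Collect_eq continuous_intros)

lemma sum_squares_pos: "0 < b \<Longrightarrow> 0 < (y::real)\<^sup>2 + b\<^sup>2"
  by (simp add: add_nonneg_pos)

lemma norm_vec3: "norm (v :: real^3) = sqrt ((v$1)\<^sup>2 + (v$2)\<^sup>2 + (v$3)\<^sup>2)"
  by (simp add: norm_vec_def L2_set_def sum_3)

lemma inner_vec3: "(v :: real^3) \<bullet> w = v$1 * w$1 + v$2 * w$2 + v$3 * w$3"
  by (simp add: inner_vec_def sum_3)

lemma parabola_codim2:
  assumes "0 < b"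
  shows "codim2_submanifold (parabola b)"
proof -
  define h :: "real^3 \<Rightarrow> real^2" where "h x = parabola_defect b x *\<^sub>R axis 1 1 + x$3 *\<^sub>R axis 2 1" for x
  have "smooth_on UNIV h"
    unfolding smooth_on_def h_def parabola_defect_def
    by (intro allI Ck_on_intros) (use assms in auto)
  moreover have "surj (frechet_derivative h (at x))" for x
  proof -
    have "(h has_derivative (\<lambda>v. (2 * x$2 * v$2 / b - 2 * v$1) *\<^sub>R axis 1 1 + v$3 *\<^sub>R axis 2 1)) (at x)"
      unfolding h_def parabola_defect_def
      by (rule derivative_eq_intros vec_nth_has_derivative refl | use assms in \<open>force simp: mult_ac\<close>)+
    then have D: "frechet_derivative h (at x) v = (2 * x$2 * v$2 / b - 2 * v$1) *\<^sub>R axis 1 1 + v$3 *\<^sub>R axis 2 1" for v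
      by (rule frechet_derivative_at_eq)
    have "frechet_derivative h (at x) (vector [- (w$1) / 2, 0, w$2]) = w" for w
      unfolding D by (simp add: vec_eq_iff forall_2 axis_def)
    then show ?thesis by (rule surjI)
  qed
  moreover have "parabola b = {x. h x = 0}"
    using assms by (auto simp: parabola_iff h_def vec_eq_iff forall_2 axis_def)
  ultimately show ?thesis
    unfolding codim2_submanifold_def by (intro ballI exI[of _ UNIV] exI[of _ h]) simp
qed

lemma parabola_tangent_unit: "0 < b \<Longrightarrow> norm (parabola_tangent b x) = 1"
  and parabola_normal_unit: "0 < b \<Longrightarrow> norm (parabola_normal b x) = 1"
  using sum_squares_pos[of b "x$2"]
  by (simp_all add: parabola_tangent_def parabola_normal_def norm_vec3 add.commute power_divide
      add_divide_distrib[symmetric])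

lemma parabola_tangent_smooth: "0 < b \<Longrightarrow> smooth_on UNIV (parabola_tangent b)"
  and parabola_normal_smooth: "0 < b \<Longrightarrow> smooth_on UNIV (parabola_normal b)"
proof -
  assume b: "0 < b"
  have "Ck_on k UNIV (\<lambda>x::real^3. 1 / sqrt ((x$2)\<^sup>2 + b\<^sup>2))" for k
    using sum_squares_pos[OF b] b by (intro Ck_on_intros open_UNIV) simp_all
  then show "smooth_on UNIV (parabola_tangent b)" "smooth_on UNIV (parabola_normal b)"
    unfolding smooth_on_def parabola_tangent_def[abs_def] parabola_normal_def[abs_def]
    by (auto intro!: Ck_on_scaleR Ck_on_vector3 Ck_on_vec_nth Ck_on_const)
qed

lemma parabola_tangent_in_tangent_space:
  assumes "0 < b" "p \<in> parabola b"
  shows "parabola_tangent b p \<in> tangent_space (parabola b) p"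
proof -
  obtain y where p: "p = parabola_point b y" using assms parabola_eq_range by blast
  \<comment> \<open>The reparametrisation that gives the velocity unit length at \<open>p\<close>.\<close>
  define k where "k = b / sqrt (y\<^sup>2 + b\<^sup>2)"
  define c where "c t = parabola_point b (y + k * t)" for t
  have "smooth_on {-1<..<1} c"
    unfolding smooth_on_def c_def parabola_point_def
  proof
    fix m
    have "Ck_on m {-1<..<1} (\<lambda>t::real. t)" by (rule Ck_on_linear) auto
    then show "Ck_on m {-1<..<1} (\<lambda>t. vector [(y + k * t)\<^sup>2 / (2 * b), y + k * t, 0] :: real^3)"
      by (intro Ck_on_intros) (use assms(1) in auto)
  qed
  moreover have "c ` {-1<..<1} \<subseteq> parabola b"
    using assms(1) by (auto simp: c_def parabola_eq_range)
  moreover have "c 0 = p" by (simp add: c_def p)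
  moreover have "(c has_vector_derivative parabola_tangent b p) (at 0)"
  proof -
    have "((\<lambda>t. ((y + k * t)\<^sup>2 / (2 * b)) *\<^sub>R axis 1 1 + (y + k * t) *\<^sub>R axis 2 1 + 0 *\<^sub>R (axis 3 1 :: real^3))
        has_vector_derivative ((y * k / b) *\<^sub>R axis 1 1 + k *\<^sub>R axis 2 1 + 0 *\<^sub>R axis 3 1)) (at 0)"
    proof -
      have "((\<lambda>t. (y + k * t)\<^sup>2 / (2 * b)) has_real_derivative (y * k / b)) (at 0)"
        by (rule derivative_eq_intros refl | use assms(1) in \<open>force simp: field_simps\<close>)+
      moreover have "((\<lambda>t. y + k * t) has_real_derivative k) (at 0)"
        by (rule derivative_eq_intros refl | simp)+
      ultimately show ?thesis
        by (intro has_vector_derivative_add has_vector_derivative_const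
            has_vector_derivative_scaleR[OF _ has_vector_derivative_const, simplified] DERIV_const)
    qed
    moreover have "parabola_tangent b p = (y * k / b) *\<^sub>R axis 1 1 + k *\<^sub>R axis 2 1 + 0 *\<^sub>R axis 3 1"
      using assms(1) by (simp add: parabola_tangent_def p k_def vec_eq_iff forall_3 axis_def)
    ultimately show ?thesis unfolding c_def parabola_point_def vector3_sum by simp
  qed
  ultimately show ?thesis unfolding tangent_space_def by (auto intro!: exI[of _ c] exI[of _ 1])
qed

lemma parabola_oriented_submanifold:
  assumes "0 < b"
  shows "closed_oriented_submanifold (parabola b) (parabola_tangent b)"
  unfolding closed_oriented_submanifold_def
  using closed_parabola parabola_codim2[OF assms] parabola_tangent_unit[OF assms]
    parabola_tangent_in_tangent_space[OF assms]
    smooth_along_global[OF parabola_tangent_smooth[OF assms]] by blast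

lemma parabola_tangent_inner:
  "0 < b \<Longrightarrow> v \<bullet> parabola_tangent b p = 0 \<longleftrightarrow> v$1 * p$2 + v$2 * b = 0"
  using sum_squares_pos[of b "p$2"] by (auto simp: parabola_tangent_def inner_vec3 divide_simps)

lemma tangent_cross_normal:
  assumes "0 < b"
  shows "cross3 (parabola_tangent b p) (parabola_normal b p) = axis 3 1"
proof -
  define n where "n = sqrt ((p$2)\<^sup>2 + b\<^sup>2)"
  have n: "n * n = p$2 * p$2 + b * b" "n > 0" using sum_squares_pos[OF assms, of "p$2"]
    by (simp_all add: n_def power2_eq_square)
  have "p$2 / n * (p$2 / n) + b / n * (b / n) = (p$2 * p$2 + b * b) / (n * n)"
    by (simp add: add_divide_distrib)
  also have "\<dots> = 1" using n assms by simp
  finally show ?thesis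
    by (simp add: cross3_def parabola_tangent_def parabola_normal_def n_def[symmetric] vec_eq_iff forall_3 axis_def)
qed

section \<open>Monodromy around the parabola\<close>

text \<open>At normal distance \<open>Y\<close> from the point of the parabola with second coordinate \<open>y\<close>, the defect is
  \<open>Y\<close> times a factor that is positive as long as \<open>|Y| < b\<close>.\<close>
lemma parabola_defect_normal:
  assumes "0 < b" "0 < n" "n\<^sup>2 = y\<^sup>2 + b\<^sup>2" "x$1 = y\<^sup>2 / (2 * b) - b * Y / n" "x$2 = y + y * Y / n"
  shows "parabola_defect b x = Y * ((2 * n + Y * y\<^sup>2 / n\<^sup>2) / b)"
proof -
  have "parabola_defect b x = (Y * (2 * (y\<^sup>2 + b\<^sup>2) / n + Y * y\<^sup>2 / n\<^sup>2)) / b"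
    unfolding parabola_defect_def assms(4,5) using assms(1,2)
    by (simp add: divide_simps) (simp add: algebra_simps power2_eq_square)
  also have "2 * (y\<^sup>2 + b\<^sup>2) / n = 2 * n"
    unfolding assms(3)[symmetric] using assms(2) by (simp add: power2_eq_square)
  finally show ?thesis by simp
qed

lemma defect_factor_pos:
  fixes b n y Y :: real
  assumes "0 < b" "0 < n" "n\<^sup>2 = y\<^sup>2 + b\<^sup>2" "\<bar>Y\<bar> < b"
  shows "0 < (2 * n + Y * y\<^sup>2 / n\<^sup>2) / b"
proof -
  have "y\<^sup>2 / n\<^sup>2 \<le> 1"
    using sum_squares_pos[OF assms(1), of y] assms(3) by (simp add: divide_le_eq)
  then have "\<bar>Y\<bar> * (y\<^sup>2 / n\<^sup>2) \<le> \<bar>Y\<bar> * 1" by (intro mult_left_mono) auto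
  moreover have "\<bar>Y * y\<^sup>2 / n\<^sup>2\<bar> = \<bar>Y\<bar> * (y\<^sup>2 / n\<^sup>2)" by (simp add: abs_mult)
  ultimately have "\<bar>Y * y\<^sup>2 / n\<^sup>2\<bar> \<le> \<bar>Y\<bar>" by linarith
  moreover have "b \<le> n"
  proof (rule power2_le_imp_le)
    show "b\<^sup>2 \<le> n\<^sup>2" unfolding assms(3) by simp
  qed (use assms(2) in simp)
  ultimately have "0 < 2 * n + Y * y\<^sup>2 / n\<^sup>2" using assms(4) by linarith
  then show ?thesis using assms(1) by simp
qed

text \<open>A defining function of the parabola; the charts are the preimages of the two slit planes.\<close>
definition parabola_fn :: "real \<Rightarrow> real^3 \<Rightarrow> complex" where
  "parabola_fn b x = Complex (parabola_defect b x) (x$3)"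

lemma parabola_fn_chart: "x \<in> chart b i \<Longrightarrow> parabola_fn b x \<in> {z. Im z \<noteq> 0 \<or> (if i = 0 then 0 < Re z else Re z < 0)}"
  by (auto simp: chart_def parabola_fn_def outer_domain_def inner_domain_def split: if_splits)

lemma parabola_fn_continuous: "continuous_on S (parabola_fn b)"
  unfolding parabola_fn_def Complex_eq by (intro continuous_intros continuous_on_parabola_defect)

text \<open>The point of the meridian at angle \<open>\<alpha>\<close> from the normal \<open>parabola_normal\<close> is mapped to \<open>r (k cos \<alpha> + \<i> sin \<alpha>)\<close> with \<open>k > 0\<close>.
  Multiplied by \<open>cis (- \<alpha>)\<close> this has positive real part, so it has a principal logarithm, and the
  remaining factor \<open>cis \<alpha>\<close> contributes the increment \<open>2\<pi>\<i>\<close>.\<close>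
lemma meridian_logarithm:
  assumes "0 < b" "p \<in> parabola b" "norm e = 1" "e \<bullet> parabola_tangent b p = 0" "0 < r" "r < b"
  obtains l where "continuous_on {0..1} l" "l 1 - l 0 = 2 * pi * \<i>"
    "\<And>t. t \<in> {0..1} \<Longrightarrow> exp (l t) = parabola_fn b (meridian (parabola_tangent b) p e r t)"
proof -
  obtain y where p: "p = parabola_point b y" using assms(1,2) parabola_eq_range by blast
  define n where "n = sqrt (y\<^sup>2 + b\<^sup>2)"
  have n: "0 < n" "n\<^sup>2 = y\<^sup>2 + b\<^sup>2" using sum_squares_pos[OF assms(1), of y] by (simp_all add: n_def)
  define C where "C = (- b * e$1 + y * e$2) / n"
  have perp: "e$1 * y + e$2 * b = 0" using assms(1,4) by (simp add: parabola_tangent_inner p)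
  have e1: "e$1 = - b * C / n" and e2: "e$2 = y * C / n"
  proof -
    have "n * n * e$1 = b * b * e$1 + y * (e$1 * y)" using n(2) by (simp add: power2_eq_square algebra_simps)
    also have "e$1 * y = - (e$2 * b)" using perp by simp
    finally show "e$1 = - b * C / n" using n(1) by (simp add: C_def field_simps)
    have "n * n * e$2 = b * (e$2 * b) + y * y * e$2" using n(2) by (simp add: power2_eq_square algebra_simps)
    also have "e$2 * b = - (e$1 * y)" using perp by simp
    finally show "e$2 = y * C / n" using n(1) by (simp add: C_def field_simps)
  qed
  have "(e$1)\<^sup>2 + (e$2)\<^sup>2 + (e$3)\<^sup>2 = 1" using assms(3) by (simp add: norm_vec3)
  moreover have "(e$1)\<^sup>2 + (e$2)\<^sup>2 = C\<^sup>2 * ((y\<^sup>2 + b\<^sup>2) / n\<^sup>2)"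
    unfolding e1 e2 by (simp add: power_mult_distrib power_divide algebra_simps add_divide_distrib)
  moreover have "(y\<^sup>2 + b\<^sup>2) / n\<^sup>2 = 1" using n assms(1) by simp
  ultimately have "C\<^sup>2 + (e$3)\<^sup>2 = 1" by simp
  then obtain \<phi> where \<phi>: "C = cos \<phi>" "e$3 = sin \<phi>" using sincos_total_2pi by metis
  define \<alpha> where "\<alpha> t = 2 * pi * t + \<phi>" for t
  define k where "k t = (2 * n + r * cos (\<alpha> t) * y\<^sup>2 / n\<^sup>2) / b" for t
  define w where "w t = Complex (k t * cos (\<alpha> t)) (sin (\<alpha> t)) * cis (- \<alpha> t)" for t
  let ?m = "meridian (parabola_tangent b) p e r"
  have cross: "cross3 (parabola_tangent b p) e = vector [b * sin \<phi> / n, - y * sin \<phi> / n, C]"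
  proof -
    have "y / n * (y * C / n) - b / n * (- b * C / n) = C * ((y\<^sup>2 + b\<^sup>2) / n\<^sup>2)"
      by (simp add: algebra_simps add_divide_distrib power2_eq_square)
    then have "y / n * (y * C / n) - b / n * (- b * C / n) = C" using n assms(1) by simp
    then show ?thesis
      by (simp add: cross3_def parabola_tangent_def p n_def[symmetric] e1 e2 \<phi>(2) vec_eq_iff forall_3)
  qed
  have m1: "?m t $ 1 = y\<^sup>2 / (2 * b) - b * (r * cos (\<alpha> t)) / n"
    and m2: "?m t $ 2 = y + y * (r * cos (\<alpha> t)) / n"
    and m3: "?m t $ 3 = r * sin (\<alpha> t)" for t
    unfolding meridian_def cross using n(1)
    by (simp_all add: p e1 e2 \<phi> \<alpha>_def cos_add sin_add field_simps)
  have k: "0 < k t" for t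
  proof -
    have "r * \<bar>cos (\<alpha> t)\<bar> \<le> r * 1" using assms(5) by (intro mult_left_mono) auto
    moreover have "\<bar>r * cos (\<alpha> t)\<bar> = r * \<bar>cos (\<alpha> t)\<bar>" using assms(5) by (simp add: abs_mult)
    ultimately have "\<bar>r * cos (\<alpha> t)\<bar> < b" using assms(6) by linarith
    from defect_factor_pos[OF assms(1) n this] show ?thesis by (simp add: k_def)
  qed
  have Z: "parabola_fn b (?m t) = of_real r * (cis (\<alpha> t) * w t)" for t
  proof -
    have "cis (\<alpha> t) * w t = Complex (k t * cos (\<alpha> t)) (sin (\<alpha> t))"
      by (simp add: w_def cis_mult mult.left_commute)
    moreover have "parabola_defect b (?m t) = r * cos (\<alpha> t) * k t"
      using parabola_defect_normal[OF assms(1) n m1 m2] by (simp add: k_def)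
    ultimately show ?thesis by (simp add: parabola_fn_def m3 complex_eq_iff)
  qed
  have "Re (w t) = k t * (cos (\<alpha> t))\<^sup>2 + (sin (\<alpha> t))\<^sup>2" for t
    by (simp add: w_def power2_eq_square)
  moreover have "0 < k t * (cos (\<alpha> t))\<^sup>2 + (sin (\<alpha> t))\<^sup>2" for t
    using k[of t] sin_cos_squared_add[of "\<alpha> t"]
    by (cases "cos (\<alpha> t) = 0") (auto simp: add_pos_nonneg)
  ultimately have w: "0 < Re (w t)" for t by simp
  then have w0: "w t \<noteq> 0" for t by (metis less_irrefl zero_complex.sel(1))
  define l where "l t = of_real (ln r) + \<i> * of_real (\<alpha> t) + Ln (w t)" for t
  show thesis
  proof
    have "continuous_on {0..1} w"
      unfolding w_def Complex_eq k_def \<alpha>_def cis_conv_exp using n(1) assms(1)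
      by (intro continuous_intros) auto
    then show "continuous_on {0..1} l"
      unfolding l_def \<alpha>_def using w by (intro continuous_intros) (auto simp: complex_nonpos_Reals_iff not_le)
    have "cos (\<alpha> 1) = cos (\<alpha> 0)" "sin (\<alpha> 1) = sin (\<alpha> 0)" by (simp_all add: \<alpha>_def cos_add sin_add)
    then have "w 1 = w 0" by (simp add: w_def k_def complex_eq_iff)
    then show "l 1 - l 0 = 2 * pi * \<i>" by (simp add: l_def \<alpha>_def algebra_simps)
    show "exp (l t) = parabola_fn b (?m t)" for t
      using assms(5) w0 by (simp add: Z l_def exp_add cis_conv_exp exp_of_real mult.assoc)
  qed
qed

lemma parabola_branched_bundle:
  assumes "0 < b"
  shows "branched_line_bundle (parabola b) (parabola_tangent b) (chart b) transition"
  unfolding branched_line_bundle_def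
proof (intro conjI ballI exI[of _ b] allI impI)
  show flat: "flat_line_bundle (- parabola b) (chart b) transition" by (rule flat_line_bundle_chart[OF assms])
  show "0 < b" by fact
  fix p \<gamma> assume p: "p \<in> parabola b" and "linking_loop (parabola b) (parabola_tangent b) p b \<gamma>"
  then obtain e r where e: "norm e = 1" "e \<bullet> parabola_tangent b p = 0" "0 < r" "r < b"
    and hom: "homotopic_loops (ball p b - parabola b) (meridian (parabola_tangent b) p e r) \<gamma> \<or>
         homotopic_loops (ball p b - parabola b) (reversepath (meridian (parabola_tangent b) p e r)) \<gamma>"
    unfolding linking_loop_def by blast
  let ?m = "meridian (parabola_tangent b) p e r"
  obtain l where l: "continuous_on {0..1} l" "l 1 - l 0 = 2 * pi * \<i>"
    "\<And>t. t \<in> {0..1} \<Longrightarrow> exp (l t) = parabola_fn b (?m t)"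
    using meridian_logarithm[OF assms p e] by blast
  have nz: "parabola_fn b x \<noteq> 0" if "x \<in> ball p b - parabola b" for x
    using that assms by (auto simp: parabola_fn_def parabola_iff complex_eq_iff)
  note lift = homotopic_loops_logarithm[where Z = "parabola_fn b", OF _ parabola_fn_continuous nz]
  have "\<exists>l1. continuous_on {0..1} l1 \<and> (\<forall>t\<in>{0..1}. exp (l1 t) = parabola_fn b (\<gamma> t)) \<and> exp ((l1 1 - l1 0) / 2) = -1"
    using hom
  proof
    assume h: "homotopic_loops (ball p b - parabola b) ?m \<gamma>"
    have "\<exists>l1. continuous_on {0..1} l1 \<and> (\<forall>t\<in>{0..1}. exp (l1 t) = parabola_fn b (\<gamma> t)) \<and> l1 1 - l1 0 = l 1 - l 0"
      by (rule lift[OF h]) (assumption | rule l)+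
    moreover have "exp ((2 * pi * \<i>) / 2) = -1" by (simp add: mult.commute)
    ultimately show ?thesis unfolding l(2) by metis
  next
    assume h: "homotopic_loops (ball p b - parabola b) (reversepath ?m) \<gamma>"
    have c: "continuous_on {0..1} (\<lambda>t. l (1 - t))"
      by (rule continuous_on_compose2[OF l(1)]) (auto intro: continuous_intros)
    have E: "exp (l (1 - t)) = parabola_fn b (reversepath ?m t)" if "t \<in> {0..1}" for t
      using l(3)[of "1 - t"] that by (simp add: reversepath_def)
    have "\<exists>l1. continuous_on {0..1} l1 \<and> (\<forall>t\<in>{0..1}. exp (l1 t) = parabola_fn b (\<gamma> t)) \<and>
        l1 1 - l1 0 = l (1 - 1) - l (1 - 0)"
      by (rule lift[OF h _ c]) (assumption | rule E)+
    moreover have "l (1 - 1) - l (1 - 0) = - (2 * pi * \<i>)" unfolding l(2)[symmetric] by simp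
    moreover have "exp (- (2 * pi * \<i>) / 2) = -1" by (simp add: exp_minus mult.commute)
    ultimately show ?thesis by metis
  qed
  then obtain l1 where l1: "continuous_on {0..1} l1" "\<And>t. t \<in> {0..1} \<Longrightarrow> exp (l1 t) = parabola_fn b (\<gamma> t)"
    "exp ((l1 1 - l1 0) / 2) = -1" by blast
  show "monodromy (chart b) transition \<gamma> (- 1)"
  proof (rule monodromy_from_logarithm[OF flat _ _ _ _ _ l1, where w = "\<lambda>i x. half_power i (parabola_fn b x)"])
    show "bundle_section (chart b) transition (- parabola b) (\<lambda>i x. half_power i (parabola_fn b x))"
      unfolding bundle_section_def
    proof (intro allI ballI half_power_transition)
      fix i j x assume "x \<in> chart b i \<inter> chart b j \<inter> - parabola b"
      then show "(i = 0) = (j = 0) \<or> Im (parabola_fn b x) = x$3 \<and> x$3 \<noteq> 0"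
        using domains_Int by (auto simp: parabola_fn_def chart_def split: if_splits)
    qed
    show "continuous_on (chart b i) (\<lambda>x. half_power i (parabola_fn b x))" for i
      by (rule continuous_on_compose2[OF half_power_continuous parabola_fn_continuous])
         (use parabola_fn_chart in blast)
    show "(half_power i (parabola_fn b x))\<^sup>2 = parabola_fn b x" for i x by (rule half_power_square)
    show "path \<gamma>" using hom homotopic_loops_imp_path by blast
    show "pathfinish \<gamma> = pathstart \<gamma>" using hom homotopic_loops_imp_loop by metis
  qed
qed

section \<open>The tubular neighbourhood\<close>

text \<open>Orthogonality of \<open>x\<close> minus the point of the parabola with second coordinate \<open>y\<close> to the tangent at that
  point.\<close>
definition foot_eqn :: "real \<Rightarrow> real^3 \<Rightarrow> real \<Rightarrow> bool" where
  "foot_eqn b x y \<longleftrightarrow> (x$1 - y\<^sup>2 / (2 * b)) * y + (x$2 - y) * b = 0"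

text \<open>The radius \<open>b\<close> is the smallest radius of curvature of the parabola, attained at the vertex.\<close>
definition tube :: "real \<Rightarrow> (real^3) set" where
  "tube b = {x. \<exists>y. foot_eqn b x y \<and> norm (x - parabola_point b y) < b}"

definition foot :: "real \<Rightarrow> real^3 \<Rightarrow> real" where
  "foot b x = (SOME y. foot_eqn b x y \<and> norm (x - parabola_point b y) < b)"

text \<open>The difference quotient of the foot point equation. It is symmetric in the two points, with
  both first displacements entering through their average; in this form its positivity on the
  tube is evident, and both uniqueness and regularity of the foot point follow.\<close>
definition foot_slope :: "real \<Rightarrow> real^3 \<Rightarrow> real^3 \<Rightarrow> real \<Rightarrow> real \<Rightarrow> real" where
  "foot_slope b x x' y y' =
     (y + y')\<^sup>2 / (4 * b) + b - ((x$1 - y\<^sup>2 / (2 * b)) + (x'$1 - y'\<^sup>2 / (2 * b))) / 2"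

lemma foot:
  assumes "x \<in> tube b"
  shows "foot_eqn b x (foot b x)" "norm (x - parabola_point b (foot b x)) < b"
  using someI_ex[of "\<lambda>y. foot_eqn b x y \<and> norm (x - parabola_point b y) < b"] assms
  unfolding tube_def foot_def by auto

lemma foot_eqn_diff:
  assumes "0 < b" "foot_eqn b x y" "foot_eqn b x' y'"
  shows "(y' - y) * foot_slope b x x' y y' = (x'$1 - x$1) * ((y + y') / 2) + (x'$2 - x$2) * b"
proof -
  have "(y' - y) * foot_slope b x x' y y' - ((x'$1 - x$1) * ((y + y') / 2) + (x'$2 - x$2) * b) =
      ((x$1 - y\<^sup>2 / (2 * b)) * y + (x$2 - y) * b) - ((x'$1 - y'\<^sup>2 / (2 * b)) * y' + (x'$2 - y') * b)"
    using assms(1) unfolding foot_slope_def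
    by (simp add: divide_simps) (simp add: algebra_simps power2_eq_square)
  then show ?thesis using assms(2,3) by (simp add: foot_eqn_def)
qed

lemma first_displacement_bound:
  "norm (x - parabola_point b y) < b \<Longrightarrow> \<bar>x$1 - y\<^sup>2 / (2 * b)\<bar> < b"
  using component_le_norm_cart[of "x - parabola_point b y" 1] by simp

lemma foot_slope_pos:
  assumes "0 < b" "norm (x - parabola_point b y) < b" "norm (x' - parabola_point b y') < b"
  shows "0 < foot_slope b x x' y y'"
proof -
  define A A' where "A = x$1 - y\<^sup>2 / (2 * b)" and "A' = x'$1 - y'\<^sup>2 / (2 * b)"
  have "A < b" "A' < b"
    using first_displacement_bound[OF assms(2)] first_displacement_bound[OF assms(3)]
    by (auto simp: A_def A'_def)
  moreover have "0 \<le> (y + y')\<^sup>2 / (4 * b)" using assms(1) by simp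
  moreover have "foot_slope b x x' y y' = (y + y')\<^sup>2 / (4 * b) + b - (A + A') / 2"
    by (simp only: foot_slope_def A_def A'_def)
  ultimately show ?thesis by argo
qed

lemma foot_unique:
  assumes "0 < b" "foot_eqn b x y" "norm (x - parabola_point b y) < b"
  shows "foot b x = y"
proof -
  have x: "x \<in> tube b" using assms by (auto simp: tube_def)
  have "(foot b x - y) * foot_slope b x x y (foot b x) = 0"
    using foot_eqn_diff[OF assms(1,2) foot(1)[OF x]] by simp
  moreover have "0 < foot_slope b x x y (foot b x)"
    by (rule foot_slope_pos[OF assms(1,3) foot(2)[OF x]])
  ultimately show ?thesis by simp
qed

text \<open>A nearest point of the parabola is a foot point, by vanishing of the derivative of the squared
  distance. In particular the tube is open.\<close>
lemma tube_eq_infdist: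
  assumes "0 < b"
  shows "tube b = {x. infdist x (parabola b) < b}"
proof (intro equalityI subsetI)
  fix x assume x: "x \<in> tube b"
  have "infdist x (parabola b) \<le> dist x (parabola_point b (foot b x))"
    by (rule infdist_le) (use assms in \<open>simp add: parabola_eq_range\<close>)
  then show "x \<in> {x. infdist x (parabola b) < b}" using foot(2)[OF x] by (simp add: dist_norm)
next
  fix x assume x: "x \<in> {x. infdist x (parabola b) < b}"
  have ne: "parabola b \<noteq> {}" using assms by (simp add: parabola_eq_range)
  obtain p where p: "p \<in> parabola b" "infdist x (parabola b) = dist x p"
    using infdist_attains_inf[OF closed_parabola ne] by blast
  then obtain y where y: "p = parabola_point b y" using assms by (auto simp: parabola_eq_range)
  define \<phi> where "\<phi> t = (x$1 - t\<^sup>2 / (2 * b))\<^sup>2 + (x$2 - t)\<^sup>2 + (x$3)\<^sup>2" for t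
  have \<phi>: "\<phi> t = (dist x (parabola_point b t))\<^sup>2" for t
    by (simp add: \<phi>_def dist_norm norm_vec3)
  have min: "\<phi> y \<le> \<phi> t" for t
  proof -
    have "dist x p \<le> dist x (parabola_point b t)"
      unfolding p(2)[symmetric] by (rule infdist_le) (use assms in \<open>simp add: parabola_eq_range\<close>)
    then show ?thesis unfolding \<phi> y by (intro power_mono) auto
  qed
  have "(\<phi> has_real_derivative (2 * (x$1 - y\<^sup>2 / (2 * b)) * (- (y / b)) + 2 * (x$2 - y) * (- 1))) (at y)"
    unfolding \<phi>_def by (rule derivative_eq_intros refl | use assms in \<open>force simp: field_simps\<close>)+
  from DERIV_local_min[OF this zero_less_one] min
  have e0: "2 * (x$1 - y\<^sup>2 / (2 * b)) * (- (y / b)) + 2 * (x$2 - y) * (- 1) = 0" by blast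
  have "(- b / 2) * (2 * (x$1 - y\<^sup>2 / (2 * b)) * (- (y / b)) + 2 * (x$2 - y) * (- 1)) =
      (x$1 - y\<^sup>2 / (2 * b)) * y + (x$2 - y) * b"
    using assms by (simp add: divide_simps) (simp add: algebra_simps)
  then have "foot_eqn b x y" unfolding e0 foot_eqn_def by simp
  moreover have "norm (x - parabola_point b y) < b" using x p(2) y by (simp add: dist_norm)
  ultimately show "x \<in> tube b" by (auto simp: tube_def)
qed

lemma open_tube: "0 < b \<Longrightarrow> open (tube b)"
  by (simp add: tube_eq_infdist) (intro open_Collect_less continuous_intros)

text \<open>The slope bounds the displacement of the foot point. Since the right-hand side of the difference
  equation grows linearly in \<open>y + y'\<close> but the slope grows quadratically, the bound is uniform in
  \<open>y'\<close>.\<close>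
lemma foot_continuous:
  assumes "0 < b" "x \<in> tube b"
  shows "isCont (foot b) x"
proof -
  note fx = foot[OF assms(2)]
  define m where "m = (b - (x$1 - (foot b x)\<^sup>2 / (2 * b))) / 2"
  have m: "0 < m" using first_displacement_bound[OF fx(2)] by (auto simp: m_def)
  define C where "C = b + 1 / (4 * m)"
  have bound: "\<bar>foot b x' - foot b x\<bar> \<le> C * \<bar>x'$1 - x$1\<bar> + b / m * \<bar>x'$2 - x$2\<bar>" if x': "x' \<in> tube b" for x'
  proof -
    note fx' = foot[OF x']
    define d where "d = foot b x + foot b x'"
    define K where "K = foot_slope b x x' (foot b x) (foot b x')"
    define A A' where "A = x$1 - (foot b x)\<^sup>2 / (2 * b)" and "A' = x'$1 - (foot b x')\<^sup>2 / (2 * b)"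
    have "A' < b" using first_displacement_bound[OF fx'(2)] by (auto simp: A'_def)
    moreover have "K = d\<^sup>2 / (4 * b) + b - (A + A') / 2"
      by (simp only: K_def foot_slope_def d_def A_def A'_def)
    moreover have "m = (b - A) / 2" by (simp only: m_def A_def)
    ultimately have K: "d\<^sup>2 / (4 * b) + m \<le> K" by argo
    have "0 \<le> d\<^sup>2 / (4 * b)" using assms(1) by simp
    then have Kp: "m \<le> K" "0 < K" using K m by linarith+
    have le: "d\<^sup>2 / (4 * b) \<le> K" using K m by linarith
    \<comment> \<open>The linear growth in \<open>d\<close> is absorbed by the quadratic growth of the slope.\<close>
    have "\<bar>d\<bar> / 2 \<le> d\<^sup>2 / 4 + 1 / 4"
      using zero_le_power2[of "\<bar>d\<bar> - 1"] by (simp add: power2_diff)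
    also have "d\<^sup>2 / 4 = b * (d\<^sup>2 / (4 * b))" using assms(1) by simp
    also have "1 / 4 = 1 / (4 * m) * m" using m by simp
    also have "b * (d\<^sup>2 / (4 * b)) + 1 / (4 * m) * m \<le> b * K + 1 / (4 * m) * K"
      using m assms(1) by (intro add_mono mult_left_mono le Kp) auto
    finally have d: "\<bar>d\<bar> / 2 \<le> C * K" by (simp add: C_def algebra_simps)
    have "\<bar>foot b x' - foot b x\<bar> * K = \<bar>(foot b x' - foot b x) * K\<bar>" using Kp by (simp add: abs_mult)
    also have "\<dots> = \<bar>(x'$1 - x$1) * (d / 2) + (x'$2 - x$2) * b\<bar>"
      unfolding K_def d_def foot_eqn_diff[OF assms(1) fx(1) fx'(1)] ..
    also have "\<dots> \<le> \<bar>x'$1 - x$1\<bar> * (\<bar>d\<bar> / 2) + \<bar>x'$2 - x$2\<bar> * b"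
      using abs_triangle_ineq[of "(x'$1 - x$1) * (d / 2)" "(x'$2 - x$2) * b"] assms(1) by (simp add: abs_mult)
    also have "\<dots> \<le> \<bar>x'$1 - x$1\<bar> * (C * K) + \<bar>x'$2 - x$2\<bar> * (b / m * K)"
    proof (intro add_mono mult_left_mono d)
      have "b / m * m \<le> b / m * K" using Kp m assms(1) by (intro mult_left_mono) auto
      then show "b \<le> b / m * K" using m by simp
    qed auto
    also have "\<dots> = (C * \<bar>x'$1 - x$1\<bar> + b / m * \<bar>x'$2 - x$2\<bar>) * K" by (simp add: algebra_simps)
    finally show ?thesis using Kp(2) by (rule mult_right_le_imp_le)
  qed
  show ?thesis
    unfolding isCont_def
  proof (rule LIM_zero_cancel, rule Lim_null_comparison)
    have "\<forall>\<^sub>F x' in at x. x' \<in> tube b"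
      using open_tube[OF assms(1)] assms(2) eventually_at_topological by blast
    then show "\<forall>\<^sub>F x' in at x. norm (foot b x' - foot b x) \<le> C * \<bar>x'$1 - x$1\<bar> + b / m * \<bar>x'$2 - x$2\<bar>"
      by eventually_elim (use bound in simp)
    have "isCont (\<lambda>x'. C * \<bar>x'$1 - x$1\<bar> + b / m * \<bar>x'$2 - x$2\<bar>) x"
      using m by (intro continuous_intros) auto
    then show "(\<lambda>x'. C * \<bar>x'$1 - x$1\<bar> + b / m * \<bar>x'$2 - x$2\<bar>) \<midarrow>x\<rightarrow> 0"
      by (simp add: isCont_def)
  qed
qed

lemma foot_has_derivative:
  assumes "0 < b" "x \<in> tube b"
  shows "(foot b has_derivative
     (\<lambda>v. (v$1 * foot b x + v$2 * b) / ((foot b x)\<^sup>2 / b + b - (x$1 - (foot b x)\<^sup>2 / (2 * b))))) (at x)"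
proof -
  let ?K = "\<lambda>x'. foot_slope b x x' (foot b x) (foot b x')"
  note fx = foot[OF assms(2)]
  have pos: "0 < ?K x'" if "x' \<in> tube b" for x' by (rule foot_slope_pos[OF assms(1) fx(2) foot(2)[OF that]])
  have Kx: "?K x = (foot b x)\<^sup>2 / b + b - (x$1 - (foot b x)\<^sup>2 / (2 * b))"
    using assms(1) by (simp add: foot_slope_def field_simps power2_eq_square)
  have c: "isCont (foot b) x" by (rule foot_continuous[OF assms])
  have cK: "isCont ?K x" unfolding foot_slope_def using assms(1) by (intro continuous_intros c) auto
  have K0: "?K x \<noteq> 0" using pos[OF assms(2)] by simp
  have 1: "((\<lambda>x'. (x'$1 - x$1) * (((foot b x + foot b x') / 2) / ?K x')) has_derivative
      (\<lambda>v. v$1 * (((foot b x + foot b x) / 2) / ?K x))) (at x)"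
    by (rule has_derivative_mult_vanishing) (auto intro!: derivative_eq_intros vec_nth_has_derivative continuous_intros c cK simp: K0)
  have 2: "((\<lambda>x'. (x'$2 - x$2) * (b / ?K x')) has_derivative (\<lambda>v. v$2 * (b / ?K x))) (at x)"
    by (rule has_derivative_mult_vanishing) (auto intro!: derivative_eq_intros vec_nth_has_derivative continuous_intros cK simp: K0)
  have "((\<lambda>x'. foot b x + ((x'$1 - x$1) * (((foot b x + foot b x') / 2) / ?K x') + (x'$2 - x$2) * (b / ?K x')))
      has_derivative (\<lambda>v. 0 + (v$1 * (((foot b x + foot b x) / 2) / ?K x) + v$2 * (b / ?K x)))) (at x)"
    by (intro has_derivative_add has_derivative_const 1 2)
  then have "(foot b has_derivative (\<lambda>v. 0 + (v$1 * (((foot b x + foot b x) / 2) / ?K x) + v$2 * (b / ?K x)))) (at x)"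
  proof (rule has_derivative_transform_within_open[OF _ open_tube[OF assms(1)] assms(2)])
    fix x' assume x': "x' \<in> tube b"
    have "(foot b x' - foot b x) * ?K x' / ?K x' =
        (x'$1 - x$1) * (((foot b x + foot b x') / 2) / ?K x') + (x'$2 - x$2) * (b / ?K x')"
      unfolding foot_eqn_diff[OF assms(1) fx(1) foot(1)[OF x']]
      by (subst add_divide_distrib) (simp only: times_divide_eq_right)
    then show "foot b x + ((x'$1 - x$1) * (((foot b x + foot b x') / 2) / ?K x') + (x'$2 - x$2) * (b / ?K x')) = foot b x'"
      using pos[OF x'] by simp
  qed
  then show ?thesis unfolding Kx by (simp add: add_divide_distrib)
qed

lemma foot_Ck:
  assumes "0 < b"
  shows "Ck_on k (tube b) (foot b)"
proof (induction k)
  case 0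
  then show ?case using foot_continuous[OF assms] by (simp add: continuous_at_imp_continuous_on)
next
  case (Suc k)
  show ?case
  proof (rule Ck_on_SucI[OF open_tube[OF assms] foot_has_derivative[OF assms]])
    fix v :: "real^3"
    have "(foot b x)\<^sup>2 / b + b - (x$1 - (foot b x)\<^sup>2 / (2 * b)) \<noteq> 0" if "x \<in> tube b" for x
    proof -
      have "0 \<le> (foot b x)\<^sup>2 / b" using assms by simp
      then show ?thesis using first_displacement_bound[OF foot(2)[OF that]] by linarith
    qed
    then show "Ck_on k (tube b) (\<lambda>x. (v$1 * foot b x + v$2 * b)
        / ((foot b x)\<^sup>2 / b + b - (x$1 - (foot b x)\<^sup>2 / (2 * b))))"
      using assms by (intro Ck_on_intros open_tube Suc) auto
  qed
qed

definition tube_coord :: "real \<Rightarrow> real^3 \<Rightarrow> (real^3) \<times> (real^3)" where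
  "tube_coord b x = (parabola_point b (foot b x), x - parabola_point b (foot b x))"

lemma tube_coord_smooth: "0 < b \<Longrightarrow> smooth_on (tube b) (tube_coord b)"
  unfolding smooth_on_def tube_coord_def[abs_def] parabola_point_def
  by (intro allI Ck_on_intros Ck_on_linear[OF bounded_linear_ident] open_tube foot_Ck) auto

lemma parabola_tubular_neighbourhood:
  assumes "0 < b"
  shows "tubular_neighbourhood (parabola b) (parabola_tangent b) (tube b) (tube_coord b)"
  unfolding tubular_neighbourhood_def
proof (intro exI[of _ "\<lambda>_. b"] conjI ballI)
  let ?N = "{(p, v) \<in> normal_bundle (parabola b) (parabola_tangent b). norm v < b}"
  have N: "(p, v) \<in> ?N \<longleftrightarrow> (\<exists>y. p = parabola_point b y \<and> foot_eqn b (p + v) y \<and> norm v < b)" for p v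
    using assms by (auto simp: normal_bundle_def parabola_eq_range parabola_tangent_inner foot_eqn_def)
  show "homeomorphism ?N (tube b) (\<lambda>(p, v). p + v) (tube_coord b)"
  proof (rule homeomorphismI)
    show "continuous_on ?N (\<lambda>(p, v). p + v)"
      unfolding case_prod_beta by (intro continuous_intros)
    show "continuous_on (tube b) (tube_coord b)"
      using tube_coord_smooth[OF assms] Ck_on_continuous unfolding smooth_on_def by blast
    show "(\<lambda>(p, v). p + v) ` ?N \<subseteq> tube b"
    proof (rule image_subsetI)
      fix q assume qN: "q \<in> ?N"
      obtain p v where pv: "q = (p, v)" by (cases q)
      then have "(p, v) \<in> ?N" using qN by simp
      then obtain y where q: "p = parabola_point b y" "foot_eqn b (p + v) y" "norm v < b"
        unfolding N by blast
      then have "norm ((p + v) - parabola_point b y) < b" by simp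
      then have "p + v \<in> tube b" using q(2) unfolding tube_def by blast
      then show "(case q of (p, v) \<Rightarrow> p + v) \<in> tube b" by (simp add: pv)
    qed
    show "tube_coord b ` tube b \<subseteq> ?N"
    proof (rule image_subsetI)
      fix x assume "x \<in> tube b"
      from foot[OF this] show "tube_coord b x \<in> ?N" unfolding tube_coord_def N by auto
    qed
    show "tube_coord b (case q of (p, v) \<Rightarrow> p + v) = q" if "q \<in> ?N" for q
    proof -
      obtain p v where pv: "q = (p, v)" by (cases q)
      then have "(p, v) \<in> ?N" using that by simp
      then obtain y where q: "p = parabola_point b y" "foot_eqn b (p + v) y" "norm v < b"
        unfolding N by blast
      have "foot b (p + v) = y" by (rule foot_unique[OF assms q(2)]) (simp add: q(1,3))
      then show ?thesis by (simp add: pv q(1) tube_coord_def)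
    qed
    show "(case tube_coord b x of (p, v) \<Rightarrow> p + v) = x" for x by (simp add: tube_coord_def)
  qed
qed (use assms open_tube tube_coord_smooth in auto)

section \<open>The expansion at the parabola\<close>

text \<open>The trivialisation in which \<open>section_norm\<close> evaluates a section at \<open>x\<close>; with it the
  expansion becomes a statement about ordinary functions.\<close>
definition chart_index :: "real \<Rightarrow> real^3 \<Rightarrow> nat" where
  "chart_index b x = (SOME i. x \<in> chart b i)"

lemma chart_index: "0 < b \<Longrightarrow> x \<notin> parabola b \<Longrightarrow> x \<in> chart b (chart_index b x)"
  unfolding chart_index_def
  by (rule someI_ex) (use domains_Un[of b] in \<open>auto simp: chart_def intro: exI[of _ 0] exI[of _ 1]\<close>)

definition normal_part :: "real \<Rightarrow> real^3 \<Rightarrow> real" where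
  "normal_part b x = snd (tube_coord b x) \<bullet> parabola_normal b (fst (tube_coord b x))"

definition foot_scale :: "real \<Rightarrow> real^3 \<Rightarrow> real" where
  "foot_scale b x = sqrt ((foot b x)\<^sup>2 + b\<^sup>2)"

lemma foot_scale:
  assumes "0 < b"
  shows "0 < foot_scale b x" "(foot_scale b x)\<^sup>2 = (foot b x)\<^sup>2 + b\<^sup>2" "b \<le> foot_scale b x"
proof -
  show n: "0 < foot_scale b x" "(foot_scale b x)\<^sup>2 = (foot b x)\<^sup>2 + b\<^sup>2"
    using sum_squares_pos[OF assms, of "foot b x"] by (simp_all add: foot_scale_def)
  show "b \<le> foot_scale b x"
  proof (rule power2_le_imp_le)
    show "b\<^sup>2 \<le> (foot_scale b x)\<^sup>2" unfolding n(2) by simp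
  qed (use n in simp)
qed

text \<open>A normal vector, being orthogonal to the tangent, is \<open>Y\<close> times the unit normal in the plane plus
  \<open>x\<^sub>3\<close> times the third basis vector.\<close>
lemma tube_coordinates:
  assumes "0 < b" "x \<in> tube b"
  defines "y \<equiv> foot b x" and "n \<equiv> foot_scale b x" and "Y \<equiv> normal_part b x"
  shows "x$1 = y\<^sup>2 / (2 * b) - b * Y / n" "x$2 = y + y * Y / n"
    and "(norm (snd (tube_coord b x)))\<^sup>2 = Y\<^sup>2 + (x$3)\<^sup>2"
    and "normal_coord (parabola_tangent b) (parabola_normal b) (tube_coord b x) = Complex Y (x$3)"
proof -
  define v1 v2 where "v1 = x$1 - y\<^sup>2 / (2 * b)" and "v2 = x$2 - y"
  have n: "0 < n" "n * n = y * y + b * b" using foot_scale[OF assms(1), of x]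
    by (simp_all add: n_def y_def power2_eq_square)
  have perp: "v1 * y + v2 * b = 0"
    using foot(1)[OF assms(2)] by (simp add: foot_eqn_def v1_def v2_def y_def)
  have "Y = v1 * (- b / n) + v2 * (y / n)"
    by (simp add: Y_def normal_part_def tube_coord_def parabola_normal_def inner_vec3
        foot_scale_def n_def y_def v1_def v2_def)
  then have Y: "n * Y = y * v2 - b * v1" using n(1) by (simp add: field_simps)
  have "n * n * v1 = - b * (n * Y) + y * (v1 * y + v2 * b)"
    unfolding n(2) Y by (simp add: algebra_simps)
  then have "n * (n * v1) = n * (- (b * Y))" unfolding perp by (simp add: algebra_simps)
  then have "n * v1 = - (b * Y)" using n(1) by (metis less_irrefl mult_left_cancel)
  then have v1: "v1 = - (b * Y / n)" using n(1) by (simp add: field_simps)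
  have "n * n * v2 = y * (n * Y) + b * (v1 * y + v2 * b)"
    unfolding n(2) Y by (simp add: algebra_simps)
  then have "n * (n * v2) = n * (y * Y)" unfolding perp by (simp add: algebra_simps)
  then have "n * v2 = y * Y" using n(1) by (metis less_irrefl mult_left_cancel)
  then have v2: "v2 = y * Y / n" using n(1) by (simp add: field_simps)
  show "x$1 = y\<^sup>2 / (2 * b) - b * Y / n" using v1 by (simp add: v1_def)
  show "x$2 = y + y * Y / n" using v2 by (simp add: v2_def)
  have "v1\<^sup>2 + v2\<^sup>2 = Y\<^sup>2 * ((y * y + b * b) / (n * n))"
    unfolding v1 v2 by (simp add: power2_eq_square algebra_simps add_divide_distrib)
  also have "(y * y + b * b) / (n * n) = 1" unfolding n(2)[symmetric] using n(1) by simp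
  finally have "v1\<^sup>2 + v2\<^sup>2 = Y\<^sup>2" by simp
  then show "(norm (snd (tube_coord b x)))\<^sup>2 = Y\<^sup>2 + (x$3)\<^sup>2"
    by (simp add: tube_coord_def norm_vec3 v1_def v2_def y_def)
  show "normal_coord (parabola_tangent b) (parabola_normal b) (tube_coord b x) = Complex Y (x$3)"
    unfolding normal_coord_def case_prod_beta tangent_cross_normal[OF assms(1)] Y_def normal_part_def
    by (simp add: tube_coord_def inner_axis)
qed

lemma normal_part_bound:
  assumes "0 < b" "x \<in> tube b"
  shows "\<bar>normal_part b x\<bar> \<le> norm (snd (tube_coord b x))" "\<bar>x$3\<bar> \<le> norm (snd (tube_coord b x))"
    and "norm (snd (tube_coord b x)) < b"
proof -
  note c = tube_coordinates(3)[OF assms]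
  show "\<bar>normal_part b x\<bar> \<le> norm (snd (tube_coord b x))" "\<bar>x$3\<bar> \<le> norm (snd (tube_coord b x))"
    by (rule power2_le_imp_le; simp add: c)+
  show "norm (snd (tube_coord b x)) < b" using foot(2)[OF assms(2)] by (simp add: tube_coord_def)
qed

lemma tube_defect:
  assumes "0 < b" "x \<in> tube b"
  shows "parabola_defect b x = normal_part b x *
      ((2 * foot_scale b x + normal_part b x * (foot b x)\<^sup>2 / (foot_scale b x)\<^sup>2) / b)"
    and "0 < (2 * foot_scale b x + normal_part b x * (foot b x)\<^sup>2 / (foot_scale b x)\<^sup>2) / b"
proof -
  note n = foot_scale[OF assms(1), of x]
  show "parabola_defect b x = normal_part b x *
      ((2 * foot_scale b x + normal_part b x * (foot b x)\<^sup>2 / (foot_scale b x)\<^sup>2) / b)"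
    by (rule parabola_defect_normal[OF assms(1) n(1,2) tube_coordinates(1,2)[OF assms]])
  have "\<bar>normal_part b x\<bar> < b" using normal_part_bound[OF assms] by linarith
  then show "0 < (2 * foot_scale b x + normal_part b x * (foot b x)\<^sup>2 / (foot_scale b x)\<^sup>2) / b"
    by (rule defect_factor_pos[OF assms(1) n(1,2)])
qed

lemma tube_chart_coord:
  assumes "0 < b" "x \<in> tube b" "x \<in> chart b i"
  shows "Complex (normal_part b x) (x$3) \<in> {z. Im z \<noteq> 0 \<or> (if i = 0 then 0 < Re z else Re z < 0)}"
proof -
  obtain F where F: "parabola_defect b x = normal_part b x * F" "0 < F"
    using tube_defect[OF assms(1,2)] by blast
  then have "0 < parabola_defect b x \<longleftrightarrow> 0 < normal_part b x" "parabola_defect b x < 0 \<longleftrightarrow> normal_part b x < 0"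
    by (simp_all add: zero_less_mult_iff mult_less_0_iff)
  then show ?thesis using assms(3) by (auto simp: chart_def outer_domain_def inner_domain_def split: if_splits)
qed

lemma parabola_sqrt_section:
  assumes "0 < b"
  shows "sqrt_section (parabola_tangent b) (chart b) transition (tube b) (tube_coord b) (parabola_normal b)
    (\<lambda>i x. half_power i (Complex (normal_part b x) (x$3)))"
  unfolding sqrt_section_def
proof (intro conjI allI ballI)
  show "bundle_section (chart b) transition (tube b) (\<lambda>i x. half_power i (Complex (normal_part b x) (x$3)))"
    unfolding bundle_section_def
  proof (intro allI ballI half_power_transition)
    fix i j x assume "x \<in> chart b i \<inter> chart b j \<inter> tube b"
    then show "(i = 0) = (j = 0) \<or> Im (Complex (normal_part b x) (x$3)) = x$3 \<and> x$3 \<noteq> 0"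
      using domains_Int by (auto simp: chart_def split: if_splits)
  qed
  fix i
  have ct: "continuous_on (tube b) (tube_coord b)"
    using tube_coord_smooth[OF assms] Ck_on_continuous unfolding smooth_on_def by blast
  have cn: "continuous_on UNIV (parabola_normal b)"
    using parabola_normal_smooth[OF assms] Ck_on_continuous unfolding smooth_on_def by blast
  have "continuous_on (tube b) (\<lambda>x. parabola_normal b (fst (tube_coord b x)))"
    by (rule continuous_on_compose2[OF cn continuous_on_fst[OF ct] subset_UNIV])
  then have cY: "continuous_on (tube b) (normal_part b)"
    unfolding normal_part_def[abs_def] by (rule continuous_on_inner[OF continuous_on_snd[OF ct]])
  have "continuous_on (chart b i \<inter> tube b) (normal_part b)"
    by (rule continuous_on_subset[OF cY]) simp
  then have "continuous_on (chart b i \<inter> tube b) (\<lambda>x. Complex (normal_part b x) (x$3))"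
    unfolding Complex_eq
    by (intro continuous_on_add continuous_on_mult continuous_on_const continuous_on_of_real
        continuous_on_component continuous_on_id)
  then show "continuous_on (chart b i \<inter> tube b) (\<lambda>x. half_power i (Complex (normal_part b x) (x$3)))"
  proof (rule continuous_on_compose2[OF half_power_continuous])
    show "(\<lambda>x. Complex (normal_part b x) (x$3)) ` (chart b i \<inter> tube b) \<subseteq>
       {z. Im z \<noteq> 0 \<or> (if i = 0 then 0 < Re z else Re z < 0)}"
    proof (rule image_subsetI)
      fix x assume "x \<in> chart b i \<inter> tube b"
      then show "Complex (normal_part b x) (x$3) \<in> {z. Im z \<noteq> 0 \<or> (if i = 0 then 0 < Re z else Re z < 0)}"
        by (intro tube_chart_coord[OF assms]) auto
    qed
  qed
  fix x assume "x \<in> chart b i \<inter> tube b"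
  then show "(half_power i (Complex (normal_part b x) (x$3)))\<^sup>2 =
      normal_coord (parabola_tangent b) (parabola_normal b) (tube_coord b x)"
    by (simp add: half_power_square tube_coordinates(4)[OF assms])
qed

lemma parabola_normal_frame:
  assumes "0 < b"
  shows "normal_frame (parabola b) (parabola_tangent b) (parabola_normal b)"
proof -
  have "parabola_normal b p \<bullet> parabola_tangent b p = 0" for p
    unfolding parabola_tangent_inner[OF assms] by (simp add: parabola_normal_def)
  then show ?thesis
    unfolding normal_frame_def
    using smooth_along_global[OF parabola_normal_smooth[OF assms]] parabola_normal_unit[OF assms] by blast
qed

text \<open>The branch pair and the square root of \<open>\<zeta>\<close> are chosen consistently in each chart: their real
  parts never have opposite signs, and neither do their imaginary parts.\<close>
lemma half_power_branch_sign:
  fixes Y :: real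
  assumes "0 < b" "x \<in> chart b i"
  defines "r \<equiv> half_power i (Complex Y (x$3))"
  shows "0 \<le> branch_tau b i x * Re r" "0 \<le> branch_sigma b i x * Im r"
proof -
  have "r\<^sup>2 = Complex Y (x$3)" by (simp add: r_def half_power_square)
  then have z: "x$3 = 2 * Re r * Im r"
    by (metis Im_power2 complex.sel(2))
  have "0 \<le> branch_tau b i x * Re r \<and> 0 \<le> branch_sigma b i x * Im r"
  proof (cases "i = 0")
    case True
    have s: "0 < outer_root b x" using outer_root(1) assms(1,2) True by (simp add: chart_def)
    have R: "0 \<le> Re r" using True Re_csqrt by (simp add: r_def half_power_def del: csqrt.sel)
    have "branch_sigma b i x * Im r = 2 * Re r * (Im r)\<^sup>2 / sqrt (outer_root b x)"
      using True by (simp add: branch_sigma_def z power2_eq_square)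
    then show ?thesis using True R s by (simp add: branch_tau_def)
  next
    case False
    have s: "0 < inner_root b x" using inner_root(1) assms(1,2) False by (simp add: chart_def)
    have R: "0 \<le> Im r" using False Re_csqrt by (simp add: r_def half_power_def del: csqrt.sel)
    have "branch_tau b i x * Re r = 2 * Im r * (Re r)\<^sup>2 / sqrt (inner_root b x)"
      using False by (simp add: branch_tau_def z power2_eq_square)
    then show ?thesis using False R s by (simp add: branch_sigma_def)
  qed
  then show "0 \<le> branch_tau b i x * Re r" "0 \<le> branch_sigma b i x * Im r" by auto
qed

lemma norm_add_ge_of_inner_nonneg:
  fixes w r :: complex
  assumes "0 \<le> Re w * Re r" "0 \<le> Im w * Im r"
  shows "norm r \<le> norm (w + r)"
proof -
  have "(Re r)\<^sup>2 + (Im r)\<^sup>2 \<le> (Re w + Re r)\<^sup>2 + (Im w + Im r)\<^sup>2"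
    using assms zero_le_power2[of "Re w"] zero_le_power2[of "Im w"]
    unfolding power2_sum mult.assoc by linarith
  then show ?thesis by (simp add: cmod_def)
qed

text \<open>Since \<open>w\<close> and \<open>r\<close> lie in the same quadrant, \<open>|w + r| \<ge> |r|\<close>, so closeness of the squares gives
  closeness of \<open>w\<close> and \<open>r\<close> themselves with a loss of only a factor \<open>|r|\<close>.\<close>
lemma cube_difference_bound:
  fixes w r :: complex
  assumes "0 \<le> Re w * Re r" "0 \<le> Im w * Im r" "r \<noteq> 0"
  shows "\<bar>Re (w ^ 3) - Re (r ^ 3)\<bar> \<le> norm (w\<^sup>2 - r\<^sup>2) / norm r * (norm w + norm r)\<^sup>2"
proof -
  have "norm (w - r) * norm r \<le> norm (w - r) * norm (w + r)"
    by (intro mult_left_mono norm_add_ge_of_inner_nonneg assms) auto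
  also have "\<dots> = norm (w\<^sup>2 - r\<^sup>2)"
    by (simp add: norm_mult[symmetric] power2_eq_square algebra_simps)
  finally have d: "norm (w - r) \<le> norm (w\<^sup>2 - r\<^sup>2) / norm r" using assms(3) by (simp add: le_divide_eq)
  have "norm (w\<^sup>2 + w * r + r\<^sup>2) \<le> norm (w\<^sup>2) + norm (w * r) + norm (r\<^sup>2)"
    by (meson norm_triangle_ineq add_right_mono order_trans)
  also have "\<dots> \<le> (norm w + norm r)\<^sup>2" by (simp add: norm_mult norm_power power2_sum)
  finally have q: "norm (w\<^sup>2 + w * r + r\<^sup>2) \<le> (norm w + norm r)\<^sup>2" .
  have "\<bar>Re (w ^ 3) - Re (r ^ 3)\<bar> = \<bar>Re ((w - r) * (w\<^sup>2 + w * r + r\<^sup>2))\<bar>"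
    by (simp add: power2_eq_square power3_eq_cube algebra_simps)
  also have "\<dots> \<le> norm (w - r) * norm (w\<^sup>2 + w * r + r\<^sup>2)"
    using abs_Re_le_cmod[of "(w - r) * (w\<^sup>2 + w * r + r\<^sup>2)"] by (simp add: norm_mult)
  also have "\<dots> \<le> norm (w\<^sup>2 - r\<^sup>2) / norm r * (norm w + norm r)\<^sup>2"
    by (intro mult_mono d q) auto
  finally show ?thesis .
qed

text \<open>The coefficients of the potential as a function of \<open>t = \<tau>/\<surd>b\<close>, once \<open>x\<^sub>1\<close> has been
  eliminated by means of the branch equation. They are odd with expansions \<open>2/3 t\<^sup>3\<close>, \<open>2t\<close> and \<open>2/3 t\<^sup>3\<close>; that
  \<open>\<alpha>\<close> and \<open>\<gamma>\<close> begin with the cubic term, while \<open>\<beta>\<close> is multiplied by \<open>\<sigma>\<^sup>2\<close>, is why the coefficient of \<open>\<zeta>\<^sup>1\<^sup>/\<^sup>2\<close> vanishes.\<close>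
definition pot_alpha :: "real \<Rightarrow> real" where "pot_alpha t = t / sqrt (1 + t\<^sup>2) - arsinh t / (1 + t\<^sup>2)"
definition pot_beta :: "real \<Rightarrow> real" where "pot_beta t = t * sqrt (1 + t\<^sup>2) + arsinh t"
definition pot_gamma :: "real \<Rightarrow> real" where
  "pot_gamma t = (t\<^sup>2 + 1/2) * arsinh t - t * sqrt (1 + t\<^sup>2) / 2"

lemma bigo_nhds_0:
  fixes f g :: "real \<Rightarrow> real"
  assumes "f \<in> O[at 0](g)" "f 0 = 0"
  shows "f \<in> O[nhds 0](g)"
proof -
  obtain c where "\<forall>\<^sub>F t in at 0. norm (f t) \<le> c * norm (g t)" "0 < c"
    using landau_o.bigE[OF assms(1)] by blast
  then have "\<forall>\<^sub>F t in nhds 0. norm (f t) \<le> c * norm (g t)"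
    using assms(2) by (auto simp: eventually_at_filter elim!: eventually_mono)
  then show ?thesis by (rule landau_o.bigI[OF \<open>0 < c\<close>])
qed

lemma pot_asymp:
  "(\<lambda>t. pot_alpha t - 2/3 * t^3) \<in> O[nhds 0](\<lambda>t. t^5)"
  "(\<lambda>t. pot_beta t - 2 * t) \<in> O[nhds 0](\<lambda>t. t^3)"
  "(\<lambda>t. pot_gamma t - 2/3 * t^3) \<in> O[nhds 0](\<lambda>t. t^5)"
  unfolding pot_alpha_def pot_beta_def pot_gamma_def arsinh_real_def
  by (rule bigo_nhds_0, real_asymp, simp)+

lemma potential_normal_form:
  assumes "0 < b" "branch_pair b S \<tau> \<sigma>" "x \<in> S"
  defines "t \<equiv> \<tau> x / sqrt b"
  shows "potential b x (\<tau> x) (\<sigma> x) =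
     (x$2)\<^sup>2 / b * pot_alpha t - (\<sigma> x)\<^sup>2 * pot_beta t + b * pot_gamma t"
proof -
  have E: "x$3 = \<tau> x * \<sigma> x" "(\<sigma> x)\<^sup>2 + (x$2)\<^sup>2 / (b + (\<tau> x)\<^sup>2) - 2 * x$1 - (\<tau> x)\<^sup>2 = 0"
    using assms(2,3) by (auto simp: branch_pair_def)
  define a where "a = sqrt b"
  define q where "q = sqrt (1 + t\<^sup>2)"
  have a: "0 < a" "b = a * a" using assms(1) by (simp_all add: a_def)
  have q: "0 < q" "1 + t\<^sup>2 = q * q" by (simp_all add: q_def add_pos_nonneg)
  have tau: "\<tau> x = a * t" using a(1) by (simp add: t_def a_def)
  have "b + (\<tau> x)\<^sup>2 = (a * a) * (1 + t\<^sup>2)" unfolding a(2) tau by (simp add: power2_eq_square algebra_simps)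
  then have bq: "b + (\<tau> x)\<^sup>2 = (a * q)\<^sup>2" unfolding q(2) by (simp add: power2_eq_square)
  then have R: "sqrt (b + (\<tau> x)\<^sup>2) = a * q" using a q by simp
  have x1: "2 * x$1 = (\<sigma> x)\<^sup>2 + (x$2)\<^sup>2 / (a * q)\<^sup>2 - (\<tau> x)\<^sup>2" using E(2) unfolding bq by simp
  define X where "X = (x$2)\<^sup>2 / (a * a)"
  have X: "(x$2)\<^sup>2 = X * (a * a)" using a(1) by (simp add: X_def)
  have "potential b x (\<tau> x) (\<sigma> x) = X * (a * a) * (a * t) / (a * a * (a * q)) - (a * t * \<sigma> x) * \<sigma> x * (a * q) / (a * a)
     - ((\<sigma> x)\<^sup>2 + X * (a * a) / (a * q)\<^sup>2 - (a * t)\<^sup>2) * arsinh t - a * t * (a * q) / 2 + a * a * arsinh t / 2"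
    unfolding potential_def R x1 E(1) X a_def[symmetric] t_def[unfolded a_def[symmetric], symmetric]
    by (simp add: tau a(2))
  also have "X * (a * a) * (a * t) / (a * a * (a * q)) = X * (t / q)" using a(1) by simp
  also have "(a * t * \<sigma> x) * \<sigma> x * (a * q) / (a * a) = (\<sigma> x)\<^sup>2 * (t * q)"
    using a(1) by (simp add: power2_eq_square)
  also have "X * (a * a) / (a * q)\<^sup>2 = X * (1 / (q * q))" using a(1) by (simp add: power2_eq_square)
  also have "X * (t / q) - (\<sigma> x)\<^sup>2 * (t * q) - ((\<sigma> x)\<^sup>2 + X * (1 / (q * q)) - (a * t)\<^sup>2) * arsinh t
      - a * t * (a * q) / 2 + a * a * arsinh t / 2 =
    X * (t / q - arsinh t * (1 / (q * q))) - (\<sigma> x)\<^sup>2 * (t * q + arsinh t)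
      + a * a * ((t\<^sup>2 + 1/2) * arsinh t - t * q / 2)"
    by (simp add: algebra_simps power2_eq_square)
  also have "t / q - arsinh t * (1 / (q * q)) = pot_alpha t" by (simp add: pot_alpha_def q_def)
  also have "t * q + arsinh t = pot_beta t" by (simp add: pot_beta_def q_def)
  also have "(t\<^sup>2 + 1/2) * arsinh t - t * q / 2 = pot_gamma t" by (simp add: pot_gamma_def q_def)
  finally show ?thesis by (simp only: X_def a(2)[symmetric])
qed

text \<open>With \<open>\<kappa>\<close> the coefficient of \<open>\<tau>\<^sup>2\<close> in the branch equation, \<open>\<kappa>\<tau>\<^sup>2 - \<sigma>\<^sup>2\<close> is the defect and \<open>\<tau>\<sigma> = x\<^sub>3\<close>;
  so \<open>\<kappa>\<tau>\<^sup>2 + \<sigma>\<^sup>2\<close> is controlled as the modulus of the complex number \<open>(\<surd>\<kappa>\<tau> + \<i>\<sigma>)\<^sup>2\<close> by its real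
  and imaginary parts. Near the parabola \<open>\<tau>\<close> and \<open>\<sigma>\<close> are therefore of the order of the square root of the distance.\<close>
lemma branch_size:
  assumes "0 < b" "branch_pair b S \<tau> \<sigma>" "x \<in> S"
  shows "(\<tau> x)\<^sup>2 + (\<sigma> x)\<^sup>2 \<le> \<bar>parabola_defect b x\<bar> + 2 * (1 + (x$2)\<^sup>2 / b\<^sup>2) * \<bar>x$3\<bar>"
    and "(\<sigma> x)\<^sup>2 = (\<tau> x)\<^sup>2 - parabola_defect b x + (x$2)\<^sup>2 * (\<tau> x)\<^sup>2 / (b * (b + (\<tau> x)\<^sup>2))"
proof -
  have E: "\<tau> x * \<sigma> x = x$3" "(\<sigma> x)\<^sup>2 + (x$2)\<^sup>2 / (b + (\<tau> x)\<^sup>2) - 2 * x$1 - (\<tau> x)\<^sup>2 = 0"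
    using assms(2,3) by (auto simp: branch_pair_def)
  have p: "0 < b + (\<tau> x)\<^sup>2" using assms(1) by (simp add: add_pos_nonneg)
  have "(x$2)\<^sup>2 / b - (x$2)\<^sup>2 / (b + (\<tau> x)\<^sup>2) = (x$2)\<^sup>2 * (\<tau> x)\<^sup>2 / (b * (b + (\<tau> x)\<^sup>2))"
    using p assms(1) by (simp add: divide_simps) (simp add: algebra_simps)
  then show s: "(\<sigma> x)\<^sup>2 = (\<tau> x)\<^sup>2 - parabola_defect b x + (x$2)\<^sup>2 * (\<tau> x)\<^sup>2 / (b * (b + (\<tau> x)\<^sup>2))"
    using E(2) unfolding parabola_defect_def by linarith
  define \<kappa> where "\<kappa> = 1 + (x$2)\<^sup>2 / (b * (b + (\<tau> x)\<^sup>2))"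
  have k: "1 \<le> \<kappa>" using assms(1) p by (simp add: \<kappa>_def)
  have "b * b \<le> b * (b + (\<tau> x)\<^sup>2)" using assms(1) by (intro mult_left_mono) auto
  then have "(x$2)\<^sup>2 / (b * (b + (\<tau> x)\<^sup>2)) \<le> (x$2)\<^sup>2 / b\<^sup>2"
    unfolding power2_eq_square[of b] using assms(1) p by (intro divide_left_mono) auto
  then have k2: "\<kappa> \<le> 1 + (x$2)\<^sup>2 / b\<^sup>2" by (simp add: \<kappa>_def)
  define q where "q = parabola_defect b x"
  have q: "\<kappa> * (\<tau> x)\<^sup>2 - (\<sigma> x)\<^sup>2 = q" using s by (simp add: \<kappa>_def q_def algebra_simps)
  have "(\<kappa> * (\<tau> x)\<^sup>2 + (\<sigma> x)\<^sup>2)\<^sup>2 = q\<^sup>2 + 4 * \<kappa> * (x$3)\<^sup>2"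
    unfolding q[symmetric] E(1)[symmetric] by (simp add: power2_eq_square algebra_simps)
  also have "\<dots> \<le> q\<^sup>2 + (4 * \<kappa> * (x$3)\<^sup>2) * \<kappa> + 4 * \<bar>q\<bar> * \<kappa> * \<bar>x$3\<bar>"
  proof -
    have "(4 * \<kappa> * (x$3)\<^sup>2) * 1 \<le> (4 * \<kappa> * (x$3)\<^sup>2) * \<kappa>" using k by (intro mult_left_mono) auto
    moreover have "0 \<le> 4 * \<bar>q\<bar> * \<kappa> * \<bar>x$3\<bar>" using k by simp
    ultimately show ?thesis by linarith
  qed
  also have "\<dots> = (\<bar>q\<bar> + 2 * \<kappa> * \<bar>x$3\<bar>)\<^sup>2"
    by (simp add: power2_sum power_mult_distrib) (simp add: power2_eq_square)
  finally have "\<kappa> * (\<tau> x)\<^sup>2 + (\<sigma> x)\<^sup>2 \<le> \<bar>q\<bar> + 2 * \<kappa> * \<bar>x$3\<bar>"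
    by (rule power2_le_imp_le) (use k in simp)
  moreover have "1 * (\<tau> x)\<^sup>2 \<le> \<kappa> * (\<tau> x)\<^sup>2" using k by (intro mult_right_mono) auto
  moreover have "2 * \<kappa> * \<bar>x$3\<bar> \<le> 2 * (1 + (x$2)\<^sup>2 / b\<^sup>2) * \<bar>x$3\<bar>"
    using k2 by (intro mult_right_mono) auto
  ultimately show "(\<tau> x)\<^sup>2 + (\<sigma> x)\<^sup>2 \<le> \<bar>parabola_defect b x\<bar> + 2 * (1 + (x$2)\<^sup>2 / b\<^sup>2) * \<bar>x$3\<bar>"
    unfolding q_def by linarith
qed

text \<open>The coefficient \<open>B\<close> at the point of the parabola with second coordinate \<open>y\<close>.\<close>
definition leading_coeff :: "real \<Rightarrow> real \<Rightarrow> real" where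
  "leading_coeff b y = 4 * sqrt 2 / (3 * sqrt b) * sqrt (sqrt (1 + y\<^sup>2 / b\<^sup>2))"

lemma cubic_main_term:
  fixes b y t s k :: real
  assumes "0 < b" "k = sqrt (sqrt (1 + y\<^sup>2 / b\<^sup>2))"
  shows "2/3 * (y\<^sup>2 / b + b) * (t / sqrt b)^3 - 2 * s\<^sup>2 * (t / sqrt b) =
    leading_coeff b y * Re (Complex (k * t / sqrt 2) (s / (k * sqrt 2)) ^ 3)"
proof -
  define a where "a = sqrt b"
  define c where "c = sqrt (2::real)"
  have a: "0 < a" "b = a\<^sup>2" using assms(1) by (simp_all add: a_def)
  have c: "0 < c" "c * c = 2" by (simp_all add: c_def)
  have pos: "0 < 1 + y\<^sup>2 / b\<^sup>2" by (simp add: add_pos_nonneg)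
  then have k: "0 < k" by (simp add: assms(2))
  have "k ^ 4 = (k\<^sup>2)\<^sup>2" by simp
  also have "\<dots> = 1 + y\<^sup>2 / b\<^sup>2" unfolding assms(2) using pos by simp
  finally have k4: "k ^ 4 = 1 + y\<^sup>2 / b\<^sup>2" .
  have yb: "y\<^sup>2 / b + b = b * k ^ 4" unfolding k4 using assms(1) by (simp add: field_simps power2_eq_square)
  have "Re (Complex (k * t / c) (s / (k * c)) ^ 3) = (k * t / c)^3 - 3 * (k * t / c) * (s / (k * c))\<^sup>2"
    by (simp add: power3_eq_cube power2_eq_square algebra_simps)
  also have "\<dots> = (k^3 * t^3 - 3 * t * s\<^sup>2 / k) / (c * c * c)"
    using k c(1) by (simp add: power3_eq_cube power2_eq_square divide_simps)
  also have "\<dots> = (k^3 * t^3 - 3 * t * s\<^sup>2 / k) / (2 * c)" unfolding c(2) ..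
  finally have "leading_coeff b y * Re (Complex (k * t / c) (s / (k * c)) ^ 3) =
      4 * c / (3 * a) * k * ((k^3 * t^3 - 3 * t * s\<^sup>2 / k) / (2 * c))"
    by (simp add: leading_coeff_def assms(2) a_def c_def)
  also have "\<dots> = 2 / (3 * a) * (k ^ 4 * t^3 - 3 * t * s\<^sup>2)"
    using k c(1) a(1) by (simp add: divide_simps) (simp add: algebra_simps power_numeral_reduce)
  also have "\<dots> = 2/3 * (b * k ^ 4) * (t / a)^3 - 2 * s\<^sup>2 * (t / a)"
    unfolding a(2) using a(1) by (simp add: divide_simps) (simp add: algebra_simps power_numeral_reduce)
  finally show ?thesis unfolding yb a_def c_def ..
qed

text \<open>The imaginary parts of \<open>w\<^sup>2\<close> and \<open>\<zeta>\<close> agree exactly because \<open>\<tau>\<sigma> = x\<^sub>3\<close>. The real parts differ by a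
  sum of three terms each of second order in the distance, given that \<open>\<tau>\<^sup>2\<close> is of first order.\<close>
lemma square_defect:
  assumes "0 < b" "x \<in> tube b" "branch_pair b S \<tau> \<sigma>" "x \<in> S"
  defines "k \<equiv> sqrt (sqrt (1 + (foot b x)\<^sup>2 / b\<^sup>2))"
  shows "(Complex (k * \<tau> x / sqrt 2) (\<sigma> x / (k * sqrt 2)))\<^sup>2 - Complex (normal_part b x) (x$3) =
    of_real (b / (2 * foot_scale b x) * ((\<tau> x)\<^sup>2 * ((foot b x)\<^sup>2 - (x$2)\<^sup>2) / b\<^sup>2
       + (x$2)\<^sup>2 * (\<tau> x)^4 / (b\<^sup>2 * (b + (\<tau> x)\<^sup>2))
       + (normal_part b x)\<^sup>2 * (foot b x)\<^sup>2 / ((foot_scale b x)\<^sup>2 * b)))"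
    (is "?w\<^sup>2 - ?z = of_real ?H")
proof -
  define n y Y where "n = foot_scale b x" and "y = foot b x" and "Y = normal_part b x"
  define D where "D = b + (\<tau> x)\<^sup>2"
  have n: "0 < n" "n\<^sup>2 = y\<^sup>2 + b\<^sup>2" using foot_scale[OF assms(1), of x] by (simp_all add: n_def y_def)
  have D: "0 < D" using assms(1) by (simp add: D_def add_pos_nonneg)
  have "1 + y\<^sup>2 / b\<^sup>2 = (n / b)\<^sup>2" using n(2) assms(1) by (simp add: power_divide add_divide_distrib)
  then have k: "k = sqrt (n / b)" using n(1) assms(1) by (simp add: k_def y_def)
  have k2: "k\<^sup>2 = n / b" "0 < k" using n(1) assms(1) by (simp_all add: k)
  have z: "\<tau> x * \<sigma> x = x$3" using assms(3,4) by (simp add: branch_pair_def)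
  have I: "Im (?w\<^sup>2) = x$3" using k2(2) by (simp add: Im_power2 z[symmetric])
  have R: "Re (?w\<^sup>2) = (k\<^sup>2 * (\<tau> x)\<^sup>2 - (\<sigma> x)\<^sup>2 / k\<^sup>2) / 2"
    by (simp add: Re_power2 power_mult_distrib power_divide diff_divide_distrib)
  have H: "(k\<^sup>2 * (\<tau> x)\<^sup>2 - (\<sigma> x)\<^sup>2 / k\<^sup>2) / 2 - Y = ?H"
  proof -
    have "(\<sigma> x)\<^sup>2 = (\<tau> x)\<^sup>2 - Y * ((2 * n + Y * y\<^sup>2 / n\<^sup>2) / b) + (x$2)\<^sup>2 * (\<tau> x)\<^sup>2 / (b * D)"
      using branch_size(2)[OF assms(1,3,4)] tube_defect(1)[OF assms(1,2)]
      by (simp add: n_def y_def Y_def D_def)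
    then have "n / b * (\<tau> x)\<^sup>2 - (\<sigma> x)\<^sup>2 / (n / b) =
        n / b * (\<tau> x)\<^sup>2 - ((\<tau> x)\<^sup>2 - Y * ((2 * n + Y * y\<^sup>2 / n\<^sup>2) / b) + (x$2)\<^sup>2 * (\<tau> x)\<^sup>2 / (b * D)) / (n / b)"
      by simp
    also have "\<dots> = b / n * ((n\<^sup>2 / b\<^sup>2 - 1 - (x$2)\<^sup>2 / (b * D)) * (\<tau> x)\<^sup>2 + Y * ((2 * n + Y * y\<^sup>2 / n\<^sup>2) / b))"
      using n(1) assms(1) D by (simp add: divide_simps) (simp add: algebra_simps power2_eq_square)
    also have "n\<^sup>2 / b\<^sup>2 - 1 - (x$2)\<^sup>2 / (b * D) = (y\<^sup>2 - (x$2)\<^sup>2) / b\<^sup>2 + (x$2)\<^sup>2 * (D - b) / (b\<^sup>2 * D)"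
      unfolding n(2) using assms(1) D by (simp add: divide_simps) (simp add: algebra_simps power2_eq_square)
    also have "D - b = (\<tau> x)\<^sup>2" by (simp add: D_def)
    finally have "(n / b * (\<tau> x)\<^sup>2 - (\<sigma> x)\<^sup>2 / (n / b)) / 2 - Y =
      b / n * (((y\<^sup>2 - (x$2)\<^sup>2) / b\<^sup>2 + (x$2)\<^sup>2 * (\<tau> x)\<^sup>2 / (b\<^sup>2 * D)) * (\<tau> x)\<^sup>2 + Y * ((2 * n + Y * y\<^sup>2 / n\<^sup>2) / b)) / 2 - Y"
      by simp
    also have "\<dots> = b / (2 * n) * ((\<tau> x)\<^sup>2 * (y\<^sup>2 - (x$2)\<^sup>2) / b\<^sup>2
       + (x$2)\<^sup>2 * (\<tau> x)^4 / (b\<^sup>2 * D) + Y\<^sup>2 * y\<^sup>2 / (n\<^sup>2 * b))"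
      using n(1) assms(1) D
      by (simp add: divide_simps) (simp add: algebra_simps power2_eq_square power4_eq_xxxx)
    finally show ?thesis unfolding k2(1) by (simp only: n_def y_def Y_def D_def)
  qed
  show ?thesis
  proof (rule complex_eqI)
    show "Re (?w\<^sup>2 - ?z) = Re (of_real ?H)"
      unfolding minus_complex.simps R complex.sel Re_complex_of_real H[symmetric] Y_def ..
    show "Im (?w\<^sup>2 - ?z) = Im (of_real ?H)"
      unfolding minus_complex.simps I complex.sel Im_complex_of_real by simp
  qed
qed

lemma parabola_in_tube:
  assumes "0 < b" "p \<in> parabola b"
  shows "p \<in> tube b" "tube_coord b p = (p, 0)"
proof -
  obtain y where p: "p = parabola_point b y" using assms parabola_eq_range by blast
  have e: "foot_eqn b p y" "norm (p - parabola_point b y) < b"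
    using assms(1) by (simp_all add: p foot_eqn_def)
  show "p \<in> tube b" using e by (auto simp: tube_def)
  show "tube_coord b p = (p, 0)" using foot_unique[OF assms(1) e] by (simp add: tube_coord_def p)
qed

lemma tube_radius_pos:
  assumes "0 < b" "x \<in> tube b" "x \<notin> parabola b"
  shows "0 < norm (snd (tube_coord b x))"
proof (rule ccontr)
  assume "\<not> ?thesis"
  then have "x = parabola_point b (foot b x)" by (simp add: tube_coord_def)
  then show False using assms(1,3) by (metis parabola_eq_range rangeI)
qed

lemma isCont_bigo_1:
  fixes f :: "'a::real_normed_vector \<Rightarrow> real"
  assumes "isCont f p"
  shows "f \<in> O[at p within S](\<lambda>_. 1)"
proof -
  have "(f \<longlongrightarrow> f p) (at p within S)"
    using continuous_at_imp_continuous_at_within[OF assms] by (simp add: continuous_within)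
  then have "((\<lambda>x. norm (f x)) \<longlongrightarrow> norm (f p)) (at p within S)" by (rule tendsto_norm)
  from order_tendstoD(2)[OF this, of "norm (f p) + 1"]
  have "\<forall>\<^sub>F x in at p within S. norm (f x) < norm (f p) + 1" by simp
  then have "\<forall>\<^sub>F x in at p within S. norm (f x) \<le> (norm (f p) + 1) * norm (1::real)"
    by eventually_elim simp
  then show ?thesis by (rule bigoI)
qed

text \<open>All quantities are measured in powers of \<open>u\<close>, the square root of the distance: \<open>\<tau>\<close> and \<open>\<sigma>\<close> are
  \<open>O(u)\<close>, the defect of \<open>w\<^sup>2\<close> is \<open>O(u\<^sup>4)\<close> and hence the difference of the cubes is \<open>O(u\<^sup>5)\<close>. The other
  errors are the Taylor remainders of the three coefficient functions and the replacement of
  \<open>x\<^sub>2\<close> by the coordinate of the foot point.\<close>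
lemma expansion_error:
  assumes b: "0 < b" and p: "p \<in> parabola b"
  defines "G \<equiv> at p within (tube b - parabola b)"
    and "u \<equiv> \<lambda>x. sqrt (norm (snd (tube_coord b x)))"
    and "T \<equiv> \<lambda>x. branch_tau b (chart_index b x) x" and "S \<equiv> \<lambda>x. branch_sigma b (chart_index b x) x"
    and "r \<equiv> \<lambda>x. half_power (chart_index b x) (Complex (normal_part b x) (x$3))"
  shows "(\<lambda>x. potential b x (T x) (S x) - leading_coeff b (foot b x) * Re (r x ^ 3)) \<in> O[G](\<lambda>x. u x ^ 5)"
proof -
  note pt = parabola_in_tube[OF b p]
  define \<rho> where "\<rho> x = norm (snd (tube_coord b x))" for x
  define y where "y = foot b"
  define n where "n = foot_scale b"
  define Y where "Y = normal_part b"
  define k where "k x = sqrt (sqrt (1 + (y x)\<^sup>2 / b\<^sup>2))" for x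
  have ev: "\<forall>\<^sub>F x in G. x \<in> tube b \<and> x \<notin> parabola b"
    unfolding G_def by (auto simp: eventually_at_filter)
  have ch: "x \<in> chart b (chart_index b x)" if "x \<notin> parabola b" for x
    by (rule chart_index[OF b that])
  note bp = branch_pair_chart[OF b]
  have up: "0 < u x" "\<rho> x = (u x)\<^sup>2" if "x \<in> tube b" "x \<notin> parabola b" for x
    using tube_radius_pos[OF b that] by (simp_all add: u_def \<rho>_def)
  have n: "0 < n x" "b \<le> n x" for x using foot_scale[OF b] by (simp_all add: n_def)

  have yc: "isCont y p" unfolding y_def by (rule foot_continuous[OF b pt(1)])
  have nc: "isCont n p" unfolding n_def foot_scale_def[abs_def] y_def[symmetric] by (intro continuous_intros yc)
  have kc: "isCont k p" unfolding k_def using b by (intro continuous_intros yc) auto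
  have xc: "isCont (\<lambda>x::real^3. x$2) p" by (intro continuous_intros)
  have lc: "isCont (\<lambda>x. leading_coeff b (y x)) p"
    unfolding leading_coeff_def using b by (intro continuous_intros yc) auto
  \<comment> \<open>An upper bound for the ratio of \<open>\<tau>\<^sup>2 + \<sigma>\<^sup>2\<close> to the distance, from \<open>branch_size\<close>.\<close>
  define P where "P x = (2 * n x + b) / b + 2 * (1 + (x$2)\<^sup>2 / b\<^sup>2)" for x
  have Pc: "isCont P p" unfolding P_def using b by (intro continuous_intros nc) auto
  note O1 = isCont_bigo_1[where p = p and S = "tube b - parabola b", folded G_def]
  note yO = O1[OF yc] and xO = O1[OF xc] and kO = O1[OF kc] and lO = O1[OF lc]
  have mult1: "(\<lambda>x. f x * g x) \<in> O[G](h)" if "f \<in> O[G](\<lambda>_. 1)" "g \<in> O[G](h)" for f g h :: "real^3 \<Rightarrow> real"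
    using landau_o.big.mult[OF that] by simp
  have cst: "(\<lambda>_. c) \<in> O[G](\<lambda>_. 1)" for c :: real by simp

  have uc: "(u \<longlongrightarrow> 0) G"
  proof -
    have "isCont (tube_coord b) p"
      using tube_coord_smooth[OF b] Ck_on_continuous continuous_on_eq_continuous_at[OF open_tube[OF b]] pt(1)
      unfolding smooth_on_def by blast
    then have "isCont u p" unfolding u_def by (intro continuous_intros)
    then have "(u \<longlongrightarrow> u p) G" unfolding G_def
      using continuous_at_imp_continuous_at_within continuous_within by blast
    then show ?thesis by (simp add: u_def pt(2))
  qed

  have YO: "Y \<in> O[G](\<lambda>x. u x ^ 2)"
  proof (rule bigoI[where c = 1])
    show "\<forall>\<^sub>F x in G. norm (Y x) \<le> 1 * norm (u x ^ 2)"
      using ev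
    proof eventually_elim
      case (elim x)
      have "\<bar>Y x\<bar> \<le> \<rho> x" using normal_part_bound(1)[OF b, of x] elim by (simp add: Y_def \<rho>_def)
      then show ?case using up(2)[of x] elim by simp
    qed
  qed
  have niO: "(\<lambda>x. 1 / n x) \<in> O[G](\<lambda>_. 1)"
  proof (rule bigoI[where c = "1 / b"], rule always_eventually, rule allI)
    fix x
    show "norm (1 / n x) \<le> 1 / b * norm (1::real)" using n[of x] b by (simp add: frac_le)
  qed

  obtain P0 where P0: "0 < P0" "\<forall>\<^sub>F x in G. norm (P x) \<le> P0"
    using landau_o.bigE[OF O1[OF Pc]] by (metis mult.right_neutral norm_one)
  have size: "\<forall>\<^sub>F x in G. (T x)\<^sup>2 + (S x)\<^sup>2 \<le> P0 * (u x)\<^sup>2"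
    using ev P0(2)
  proof eventually_elim
    case (elim x)
    then have x: "x \<in> tube b" "x \<notin> parabola b" by auto
    note nb = normal_part_bound[OF b x(1), folded \<rho>_def Y_def]
    have "(y x)\<^sup>2 \<le> (n x)\<^sup>2" using foot_scale(2)[OF b, of x] by (simp add: n_def y_def)
    then have "(y x)\<^sup>2 / (n x)\<^sup>2 \<le> 1" using n(1)[of x] by (simp add: divide_le_eq)
    then have "\<bar>Y x\<bar> * ((y x)\<^sup>2 / (n x)\<^sup>2) \<le> \<bar>Y x\<bar> * 1" by (intro mult_left_mono) auto
    moreover have "\<bar>Y x * (y x)\<^sup>2 / (n x)\<^sup>2\<bar> = \<bar>Y x\<bar> * ((y x)\<^sup>2 / (n x)\<^sup>2)" by (simp add: abs_mult)
    ultimately have "\<bar>2 * n x + Y x * (y x)\<^sup>2 / (n x)\<^sup>2\<bar> \<le> 2 * n x + b" using nb n[of x] by linarith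
    then have "\<bar>Y x\<bar> * (\<bar>2 * n x + Y x * (y x)\<^sup>2 / (n x)\<^sup>2\<bar> / b) \<le> \<rho> x * ((2 * n x + b) / b)"
      using nb b by (intro mult_mono divide_right_mono) auto
    moreover have "\<bar>parabola_defect b x\<bar> = \<bar>Y x\<bar> * (\<bar>2 * n x + Y x * (y x)\<^sup>2 / (n x)\<^sup>2\<bar> / b)"
      unfolding tube_defect(1)[OF b x(1)] Y_def n_def y_def using b by (simp add: abs_mult)
    moreover have "2 * (1 + (x$2)\<^sup>2 / b\<^sup>2) * \<bar>x$3\<bar> \<le> 2 * (1 + (x$2)\<^sup>2 / b\<^sup>2) * \<rho> x"
      using nb by (intro mult_left_mono) auto
    moreover have "(T x)\<^sup>2 + (S x)\<^sup>2 \<le> \<bar>parabola_defect b x\<bar> + 2 * (1 + (x$2)\<^sup>2 / b\<^sup>2) * \<bar>x$3\<bar>"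
      unfolding T_def S_def by (rule branch_size(1)[OF b bp ch[OF x(2)]])
    moreover have "P x * \<rho> x = \<rho> x * ((2 * n x + b) / b) + 2 * (1 + (x$2)\<^sup>2 / b\<^sup>2) * \<rho> x"
      by (simp add: P_def algebra_simps)
    moreover have "P x * \<rho> x \<le> P0 * \<rho> x" using elim(2) by (intro mult_right_mono) (auto simp: \<rho>_def)
    ultimately show ?case unfolding up(2)[OF x] by linarith
  qed
  have bound: "\<bar>a\<bar> \<le> sqrt P0 * \<bar>v\<bar>" if "a\<^sup>2 \<le> P0 * v\<^sup>2" for a v :: real
  proof -
    have "sqrt (a\<^sup>2) \<le> sqrt (P0 * v\<^sup>2)" using that by (rule real_sqrt_le_mono)
    then show ?thesis by (simp add: real_sqrt_mult)
  qed
  have uO: "f \<in> O[G](u)" if f: "\<And>x. (f x)\<^sup>2 \<le> (T x)\<^sup>2 + (S x)\<^sup>2" for f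
  proof (rule bigoI[where c = "sqrt P0"])
    show "\<forall>\<^sub>F x in G. norm (f x) \<le> sqrt P0 * norm (u x)"
      using size
    proof eventually_elim
      case (elim x)
      have "(f x)\<^sup>2 \<le> P0 * (u x)\<^sup>2" using elim f[of x] by linarith
      from bound[OF this] show ?case by simp
    qed
  qed
  have TO: "T \<in> O[G](u)" and SO: "S \<in> O[G](u)" by (rule uO; simp)+
  define t where "t x = T x / sqrt b" for x
  have tO: "t \<in> O[G](u)"
    using mult1[OF cst[of "1 / sqrt b"] TO] by (simp add: t_def[abs_def])
  have t0: "filterlim t (nhds 0) G"
  proof -
    obtain c where "\<forall>\<^sub>F x in G. norm (t x) \<le> c * norm (u x)" using landau_o.bigE[OF tO] by blast
    moreover have "((\<lambda>x. c * norm (u x)) \<longlongrightarrow> 0) G"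
      using tendsto_mult_right_zero[OF tendsto_norm_zero[OF uc]] .
    ultimately show ?thesis by (rule Lim_null_comparison)
  qed
  have aO: "(\<lambda>x. pot_alpha (t x) - 2/3 * t x ^ 3) \<in> O[G](\<lambda>x. u x ^ 5)"
    using landau_o.big.compose[OF pot_asymp(1) t0] landau_o.big_power[OF tO, of 5]
    by (rule landau_o.big_trans)
  have bO: "(\<lambda>x. pot_beta (t x) - 2 * t x) \<in> O[G](\<lambda>x. u x ^ 3)"
    using landau_o.big.compose[OF pot_asymp(2) t0] landau_o.big_power[OF tO, of 3]
    by (rule landau_o.big_trans)
  have cO: "(\<lambda>x. pot_gamma (t x) - 2/3 * t x ^ 3) \<in> O[G](\<lambda>x. u x ^ 5)"
    using landau_o.big.compose[OF pot_asymp(3) t0] landau_o.big_power[OF tO, of 5]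
    by (rule landau_o.big_trans)

  have dO: "(\<lambda>x. (x$2)\<^sup>2 - (y x)\<^sup>2) \<in> O[G](\<lambda>x. u x ^ 2)"
  proof -
    have "(\<lambda>x. (x$2 + y x) * (y x * (1 / n x * Y x))) \<in> O[G](\<lambda>x. u x ^ 2)"
      by (intro mult1 sum_in_bigo xO yO niO YO)
    moreover have "\<forall>\<^sub>F x in G. (x$2)\<^sup>2 - (y x)\<^sup>2 = (x$2 + y x) * (y x * (1 / n x * Y x))"
      using ev
    proof eventually_elim
      case (elim x)
      have "x$2 - y x = y x * (1 / n x * Y x)"
        using tube_coordinates(2)[OF b, of x] elim by (simp add: y_def n_def Y_def)
      moreover have "(x$2)\<^sup>2 - (y x)\<^sup>2 = (x$2 + y x) * (x$2 - y x)" by (simp add: power2_eq_square algebra_simps)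
      ultimately show ?case by simp
    qed
    ultimately show ?thesis by (subst landau_o.big.in_cong)
  qed

  \<comment> \<open>The difference \<open>w\<^sup>2 - \<zeta>\<close>, which is real.\<close>
  define H where "H x = b / (2 * n x) * ((T x)\<^sup>2 * ((y x)\<^sup>2 - (x$2)\<^sup>2) / b\<^sup>2
       + (x$2)\<^sup>2 * (T x)^4 / (b\<^sup>2 * (b + (T x)\<^sup>2)) + (Y x)\<^sup>2 * (y x)\<^sup>2 / ((n x)\<^sup>2 * b))" for x
  have HO: "H \<in> O[G](\<lambda>x. u x ^ 4)"
  proof -
    have inv: "(\<lambda>x. 1 / (b\<^sup>2 * (b + (T x)\<^sup>2))) \<in> O[G](\<lambda>_. 1)"
    proof (rule bigoI[where c = "1 / (b\<^sup>2 * b)"], rule always_eventually, rule allI)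
      fix x
      have "b\<^sup>2 * b \<le> b\<^sup>2 * (b + (T x)\<^sup>2)" by (intro mult_left_mono) auto
      moreover have "0 < b\<^sup>2 * b" using b by simp
      ultimately show "norm (1 / (b\<^sup>2 * (b + (T x)\<^sup>2))) \<le> 1 / (b\<^sup>2 * b) * norm (1::real)"
        by (simp add: frac_le del: mult_le_cancel_left)
    qed
    have sq: "(\<lambda>x. f x ^ m) \<in> O[G](\<lambda>_. 1)" if "f \<in> O[G](\<lambda>_. 1)" for f :: "real^3 \<Rightarrow> real" and m
      using landau_o.big_power[OF that, of m] by simp
    have 1: "(\<lambda>x. - (1 / b\<^sup>2) * ((T x)\<^sup>2 * ((x$2)\<^sup>2 - (y x)\<^sup>2))) \<in> O[G](\<lambda>x. u x ^ 4)"
    proof (rule mult1[OF cst])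
      show "(\<lambda>x. (T x)\<^sup>2 * ((x$2)\<^sup>2 - (y x)\<^sup>2)) \<in> O[G](\<lambda>x. u x ^ 4)"
        using landau_o.big.mult[OF landau_o.big_power[OF TO, of 2] dO] by (simp add: power_add[symmetric])
    qed
    have 2: "(\<lambda>x. (x$2)\<^sup>2 * (1 / (b\<^sup>2 * (b + (T x)\<^sup>2)) * (T x)^4)) \<in> O[G](\<lambda>x. u x ^ 4)"
      by (intro mult1 sq xO inv landau_o.big_power TO)
    have "(\<lambda>x. (Y x)\<^sup>2) \<in> O[G](\<lambda>x. u x ^ 4)"
      using landau_o.big_power[OF YO, of 2] by (simp add: power_mult[symmetric])
    then have 3: "(\<lambda>x. 1 / b * ((y x)\<^sup>2 * ((1 / n x)\<^sup>2 * (Y x)\<^sup>2))) \<in> O[G](\<lambda>x. u x ^ 4)"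
      by (intro mult1 sq yO niO cst)
    have "(\<lambda>x. (b / 2) * ((1 / n x) * (- (1 / b\<^sup>2) * ((T x)\<^sup>2 * ((x$2)\<^sup>2 - (y x)\<^sup>2))
        + (x$2)\<^sup>2 * (1 / (b\<^sup>2 * (b + (T x)\<^sup>2)) * (T x)^4)
        + 1 / b * ((y x)\<^sup>2 * ((1 / n x)\<^sup>2 * (Y x)\<^sup>2))))) \<in> O[G](\<lambda>x. u x ^ 4)"
      by (intro mult1 cst niO sum_in_bigo 1 2 3)
    moreover have "(b / 2) * ((1 / n x) * (- (1 / b\<^sup>2) * ((T x)\<^sup>2 * ((x$2)\<^sup>2 - (y x)\<^sup>2))
        + (x$2)\<^sup>2 * (1 / (b\<^sup>2 * (b + (T x)\<^sup>2)) * (T x)^4)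
        + 1 / b * ((y x)\<^sup>2 * ((1 / n x)\<^sup>2 * (Y x)\<^sup>2)))) = H x" for x
    proof -
      have "- (1 / b\<^sup>2) * ((T x)\<^sup>2 * ((x$2)\<^sup>2 - (y x)\<^sup>2)) = (T x)\<^sup>2 * ((y x)\<^sup>2 - (x$2)\<^sup>2) / b\<^sup>2"
        by (simp add: algebra_simps diff_divide_distrib)
      then show ?thesis unfolding H_def by (simp add: power_divide mult_ac)
    qed
    ultimately show ?thesis by simp
  qed

  define w where "w x = Complex (k x * T x / sqrt 2) (S x / (k x * sqrt 2))" for x
  have wO: "(\<lambda>x. norm (w x)) \<in> O[G](u)"
  proof -
    have "(\<lambda>x. \<bar>k x * T x\<bar> + \<bar>S x\<bar>) \<in> O[G](u)"
      by (intro sum_in_bigo) (simp_all only: landau_o.big.abs_in_iff mult1[OF kO TO] SO)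
    moreover have "norm (norm (w x)) \<le> norm (\<bar>k x * T x\<bar> + \<bar>S x\<bar>)" for x
    proof -
      have k1: "1 \<le> k x" by (simp add: k_def)
      have s2: "1 \<le> sqrt (2::real)" by simp
      have "\<bar>k x * T x\<bar> / sqrt 2 \<le> \<bar>k x * T x\<bar> / 1" using s2 by (intro divide_left_mono) auto
      moreover have "\<bar>S x\<bar> / (k x * sqrt 2) \<le> \<bar>S x\<bar> / 1"
        using mult_mono[OF k1 s2] k1 by (intro divide_left_mono) auto
      moreover have "norm (w x) \<le> \<bar>k x * T x\<bar> / sqrt 2 + \<bar>S x\<bar> / (k x * sqrt 2)"
        using cmod_le[of "w x"] k1 by (simp add: w_def abs_mult)
      ultimately show ?thesis by simp
    qed
    then have "(\<lambda>x. norm (w x)) \<in> O[G](\<lambda>x. \<bar>k x * T x\<bar> + \<bar>S x\<bar>)"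
      by (intro bigoI[where c = 1] always_eventually) simp
    ultimately show ?thesis by (rule landau_o.big_trans[rotated])
  qed
  have rO: "(\<lambda>x. Re (w x ^ 3) - Re (r x ^ 3)) \<in> O[G](\<lambda>x. u x ^ 5)"
  proof -
    obtain c1 where c1: "0 < c1" "\<forall>\<^sub>F x in G. norm (H x) \<le> c1 * norm (u x ^ 4)"
      using landau_o.bigE[OF HO] by blast
    obtain c2 where c2: "0 < c2" "\<forall>\<^sub>F x in G. norm (norm (w x)) \<le> c2 * norm (u x)"
      using landau_o.bigE[OF wO] by blast
    show ?thesis
    proof (rule bigoI[where c = "c1 * (c2 + 1)\<^sup>2"])
      show "\<forall>\<^sub>F x in G. norm (Re (w x ^ 3) - Re (r x ^ 3)) \<le> c1 * (c2 + 1)\<^sup>2 * norm (u x ^ 5)"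
        using ev c1(2) c2(2)
      proof eventually_elim
        case (elim x)
        then have x: "x \<in> tube b" "x \<notin> parabola b" by auto
        note cx = ch[OF x(2)]
        have k0: "0 < k x" by (simp add: k_def add_pos_nonneg)
        have r2: "(r x)\<^sup>2 = Complex (Y x) (x$3)" by (simp add: r_def half_power_square Y_def)
        have "(norm (r x))\<^sup>2 = sqrt ((\<rho> x)\<^sup>2)"
          unfolding norm_power[symmetric] r2
          using tube_coordinates(3)[OF b x(1)] by (simp add: cmod_def \<rho>_def Y_def)
        then have "(norm (r x))\<^sup>2 = (u x)\<^sup>2"
          unfolding up(2)[OF x, symmetric] real_sqrt_abs by (simp add: \<rho>_def)
        then have nr: "norm (r x) = u x" using up(1)[OF x] by (simp add: power2_eq_iff_nonneg)
        note sg = half_power_branch_sign[OF b cx, of "Y x", folded T_def S_def]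
        have "0 \<le> (k x / sqrt 2) * (T x * Re (r x))"
          using sg(1) k0 by (simp add: r_def Y_def T_def)
        moreover have "0 \<le> (1 / (k x * sqrt 2)) * (S x * Im (r x))"
          using sg(2) k0 by (simp add: r_def Y_def S_def)
        ultimately have "0 \<le> Re (w x) * Re (r x)" "0 \<le> Im (w x) * Im (r x)" by (simp_all add: w_def)
        moreover have "r x \<noteq> 0" using nr up(1)[OF x] by auto
        ultimately have "\<bar>Re (w x ^ 3) - Re (r x ^ 3)\<bar> \<le> norm ((w x)\<^sup>2 - (r x)\<^sup>2) / norm (r x) * (norm (w x) + norm (r x))\<^sup>2"
          by (rule cube_difference_bound)
        also have "(w x)\<^sup>2 - (r x)\<^sup>2 = of_real (H x)"
          unfolding r2 w_def k_def y_def Y_def H_def n_def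
          using square_defect[OF b x(1) bp cx, folded T_def S_def] by (simp only: T_def S_def)
        also have "norm (complex_of_real (H x)) / norm (r x) * (norm (w x) + norm (r x))\<^sup>2
            \<le> (c1 * u x ^ 4) / u x * (c2 * u x + u x)\<^sup>2"
          unfolding nr using elim(2,3) up(1)[OF x] c1(1) c2(1)
          by (intro mult_mono divide_right_mono power_mono add_mono) (auto simp: power_even_abs)
        also have "\<dots> = c1 * (c2 + 1)\<^sup>2 * u x ^ 5"
          using up(1)[OF x] by (simp add: power2_eq_square power_numeral_reduce algebra_simps)
        finally show ?case using up(1)[OF x] by simp
      qed
    qed
  qed

  have 1: "(\<lambda>x. (1 / b * (x$2 * x$2)) * (pot_alpha (t x) - 2/3 * t x ^ 3)) \<in> O[G](\<lambda>x. u x ^ 5)"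
    by (rule mult1[OF mult1[OF cst mult1[OF xO xO]] aO])
  have 2: "(\<lambda>x. (S x)\<^sup>2 * (pot_beta (t x) - 2 * t x)) \<in> O[G](\<lambda>x. u x ^ 5)"
    using landau_o.big.mult[OF landau_o.big_power[OF SO, of 2] bO] by (simp add: power_add[symmetric])
  have 3: "(\<lambda>x. b * (pot_gamma (t x) - 2/3 * t x ^ 3)) \<in> O[G](\<lambda>x. u x ^ 5)"
    by (rule mult1[OF cst cO])
  have 4: "(\<lambda>x. (2 / (3 * b)) * (((x$2)\<^sup>2 - (y x)\<^sup>2) * t x ^ 3)) \<in> O[G](\<lambda>x. u x ^ 5)"
  proof (rule mult1[OF cst])
    show "(\<lambda>x. ((x$2)\<^sup>2 - (y x)\<^sup>2) * t x ^ 3) \<in> O[G](\<lambda>x. u x ^ 5)"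
      using landau_o.big.mult[OF dO landau_o.big_power[OF tO, of 3]] by (simp add: power_add[symmetric])
  qed
  have 5: "(\<lambda>x. leading_coeff b (y x) * (Re (w x ^ 3) - Re (r x ^ 3))) \<in> O[G](\<lambda>x. u x ^ 5)"
    by (rule mult1[OF lO rO])
  have "(\<lambda>x. (1 / b * (x$2 * x$2)) * (pot_alpha (t x) - 2/3 * t x ^ 3) - (S x)\<^sup>2 * (pot_beta (t x) - 2 * t x)
      + b * (pot_gamma (t x) - 2/3 * t x ^ 3) + (2 / (3 * b)) * (((x$2)\<^sup>2 - (y x)\<^sup>2) * t x ^ 3)
      + leading_coeff b (y x) * (Re (w x ^ 3) - Re (r x ^ 3))) \<in> O[G](\<lambda>x. u x ^ 5)"
    by (intro sum_in_bigo 1 2 3 4 5)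
  moreover have "\<forall>\<^sub>F x in G. potential b x (T x) (S x) - leading_coeff b (foot b x) * Re (r x ^ 3) =
      (1 / b * (x$2 * x$2)) * (pot_alpha (t x) - 2/3 * t x ^ 3) - (S x)\<^sup>2 * (pot_beta (t x) - 2 * t x)
      + b * (pot_gamma (t x) - 2/3 * t x ^ 3) + (2 / (3 * b)) * (((x$2)\<^sup>2 - (y x)\<^sup>2) * t x ^ 3)
      + leading_coeff b (y x) * (Re (w x ^ 3) - Re (r x ^ 3))"
    using ev
  proof eventually_elim
    case (elim x)
    then have cx: "x \<in> chart b (chart_index b x)" using ch by blast
    have pf: "potential b x (T x) (S x) = (x$2)\<^sup>2 / b * pot_alpha (t x) - (S x)\<^sup>2 * pot_beta (t x) + b * pot_gamma (t x)"
      unfolding t_def T_def S_def by (rule potential_normal_form[OF b bp cx])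
    have "2/3 * ((y x)\<^sup>2 / b + b) * t x ^ 3 - 2 * (S x)\<^sup>2 * t x = leading_coeff b (y x) * Re (w x ^ 3)"
      unfolding t_def w_def by (rule cubic_main_term[OF b]) (simp add: k_def)
    then show ?case
      unfolding pf y_def[symmetric] right_diff_distrib[of "leading_coeff b (y x)"]
      by (simp add: algebra_simps power2_eq_square add_divide_distrib diff_divide_distrib)
  qed
  ultimately show ?thesis by (subst landau_o.big.in_cong)
qed

section \<open>The harmonic function\<close>

text \<open>The curvature term of the expansion has the factor \<open>A\<close> and disappears with it.\<close>
lemma pot_section_expansion:
  assumes b: "0 < b"
  shows "has_expansion (parabola b) (parabola_tangent b) (chart b) transition (pot_section b)
    (\<lambda>_. 0) (\<lambda>p. of_real (leading_coeff b (p$2)))"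
proof -
  have pos: "0 < 1 + y\<^sup>2 / b\<^sup>2" for y :: real by (simp add: add_pos_nonneg)
  have "smooth_on UNIV (\<lambda>p::real^3. complex_of_real (leading_coeff b (p$2)))"
    unfolding smooth_on_def leading_coeff_def
    by (intro allI Ck_on_intros open_UNIV real_sqrt_gt_zero pos) (use b in auto)
  then have B: "smooth_along (parabola b) (\<lambda>p. complex_of_real (leading_coeff b (p$2)))"
    by (rule smooth_along_global)
  have A: "smooth_along (parabola b) (\<lambda>_. 0 :: complex)"
    by (intro smooth_along_global) (simp add: smooth_on_def Ck_on_const)
  let ?r = "\<lambda>i x. half_power i (Complex (normal_part b x) (x$3))"
  let ?\<zeta> = "tube_coord b"
  let ?err = "section_norm (chart b)
             (\<lambda>i x. pot_section b i x -
                (Re (0 * ?r i x + of_real (leading_coeff b (fst (?\<zeta> x) $ 2)) * ?r i x ^ 3)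
                 - 1/2 * (mean_curvature (parabola b) (parabola_tangent b) (fst (?\<zeta> x)) \<bullet> snd (?\<zeta> x)) * Re (0 * ?r i x)))"
  have err: "?err = (\<lambda>x. norm (potential b x (branch_tau b (chart_index b x) x) (branch_sigma b (chart_index b x) x)
      - leading_coeff b (foot b x) * Re (?r (chart_index b x) x ^ 3)))"
    by (simp add: fun_eq_iff section_norm_def chart_index_def pot_section_def tube_coord_def)
  have "?err \<in> O[at p within (tube b - parabola b)](\<lambda>x. norm (snd (?\<zeta> x)) powr (5/2))"
    if p: "p \<in> parabola b" for p
  proof -
    let ?G = "at p within (tube b - parabola b)"
    have "?err \<in> O[?G](\<lambda>x. sqrt (norm (snd (?\<zeta> x))) ^ 5)"
      unfolding err real_norm_def landau_o.big.abs_in_iff by (rule expansion_error[OF b p])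
    also have "(\<lambda>x. sqrt (norm (snd (?\<zeta> x))) ^ 5) = (\<lambda>x. norm (snd (?\<zeta> x)) powr (5/2))"
    proof
      fix x
      show "sqrt (norm (snd (?\<zeta> x))) ^ 5 = norm (snd (?\<zeta> x)) powr (5/2)"
      proof (cases "snd (?\<zeta> x) = 0")
        case False
        define \<rho> where "\<rho> = norm (snd (?\<zeta> x))"
        have "0 < sqrt \<rho>" using False by (simp add: \<rho>_def)
        then have "sqrt \<rho> ^ 5 = sqrt \<rho> powr real 5" by (rule powr_realpow[symmetric])
        also have "\<dots> = (\<rho> powr (1/2)) powr real 5" by (simp add: powr_half_sqrt \<rho>_def)
        also have "\<dots> = \<rho> powr (5/2)" by (simp add: powr_powr)
        finally show ?thesis unfolding \<rho>_def .
      qed simp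
    qed
    finally show ?thesis .
  qed
  then show ?thesis
    unfolding has_expansion_def
    using A B parabola_tubular_neighbourhood[OF b] parabola_normal_frame[OF b] parabola_sqrt_section[OF b]
    by (intro conjI exI[of _ "tube b"] exI[of _ "tube_coord b"] exI[of _ "parabola_normal b"] exI[of _ ?r]) auto
qed

lemma pot_section_nondegenerate:
  assumes "0 < b"
  shows "nondegenerate (parabola b) (parabola_tangent b) (chart b) transition (pot_section b)"
proof -
  have "leading_coeff b y \<noteq> 0" for y
  proof -
    have "0 < 1 + y\<^sup>2 / b\<^sup>2" by (simp add: add_pos_nonneg)
    then show ?thesis using assms by (simp add: leading_coeff_def)
  qed
  then show ?thesis
    unfolding nondegenerate_def critical_def
    by (intro conjI exI[of _ "\<lambda>_. 0"] exI[of _ "\<lambda>p. complex_of_real (leading_coeff b (p$2))"]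
        pot_section_expansion assms) auto
qed

lemma pot_section_Z2_harmonic:
  assumes b: "0 < b"
  shows "Z2_harmonic_function (parabola b) (parabola_tangent b) (chart b) transition (pot_section b)"
  unfolding Z2_harmonic_function_def
proof (intro conjI allI ballI)
  note bp = branch_pair_chart[OF b]
  show "closed_oriented_submanifold (parabola b) (parabola_tangent b)"
    by (rule parabola_oriented_submanifold[OF b])
  show "branched_line_bundle (parabola b) (parabola_tangent b) (chart b) transition"
    by (rule parabola_branched_bundle[OF b])
  show "bundle_section (chart b) transition (- parabola b) (pot_section b)"
    by (rule odd_function_bundle_section[OF b, where \<Phi> = "potential b"])
       (simp_all add: potential_uminus pot_section_def)
  show "smooth_on (chart b i) (pot_section b i)" for i
    unfolding smooth_on_def pot_section_def[abs_def] using potential_Ck[OF b bp] by blast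
  show "laplacian (pot_section b i) x = 0" if "x \<in> chart b i" for i x
    unfolding pot_section_def[abs_def] by (rule potential_laplacian[OF b bp that])
  have pos: "b + c\<^sup>2 > 0" for c using b by (simp add: add_pos_nonneg)
  then have nz: "sqrt (b + c\<^sup>2) \<noteq> 0" for c by (metis less_irrefl real_sqrt_eq_zero_cancel_iff)
  have arsinh: "continuous_on UNIV (\<lambda>p :: (real^3) \<times> real \<times> real. arsinh (fst (snd p) / sqrt b))"
    by (rule continuous_on_compose2[OF continuous_on_arsinh[of UNIV]]) (intro continuous_intros, use b in auto)
  show "locally_L2 (parabola b) (chart b) (pot_section b)"
  proof (rule branch_function_locally_L2[OF b closed_parabola, where \<Phi> = "potential b"])
    show "continuous_on UNIV (\<lambda>p. potential b (fst p) (fst (snd p)) (snd (snd p)))"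
      unfolding potential_def using b nz by (intro arsinh continuous_intros) auto
  qed (simp_all add: potential_uminus pot_section_def)
  show "locally_L2 (parabola b) (chart b) (\<lambda>i. gradient (pot_section b i))"
  proof (rule branch_function_locally_L2[OF b closed_parabola, where \<Phi> = "grad_potential b"])
    show "continuous_on UNIV (\<lambda>p. grad_potential b (fst p) (fst (snd p)) (snd (snd p)))"
      unfolding grad_potential_def vector3_sum using b nz by (intro arsinh continuous_intros) auto
  qed (simp_all add: grad_potential_uminus gradient_pot_section[OF b])
qed

theorem theorem1p9:
  fixes b :: real
  assumes "0 < b"
  shows "\<exists>(U :: nat \<Rightarrow> (real^3) set) g f.
           Z2_harmonic_function (parabola b) (parabola_tangent b) U g f \<and>
           nondegenerate (parabola b) (parabola_tangent b) U g f"
  using pot_section_Z2_harmonic[OF assms] pot_section_nondegenerate[OF assms] by blast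

end
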